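(* Let $G$ be a solvable non-nilpotent Lie group acting simply transitively on the $3$-dimensional Heisenberg group $H_3$ via affine transformations. Then the Lie algebra of $G$ is isomorphic to one of $\mathfrak{r}_3$, $\mathfrak{r}_{3,\lambda}$ with $\lambda \in \{1,-1\}$, or $\mathfrak{r}'_{3,0}$.
   Context: All Lie algebras and Lie groups are real and finite-dimensional. $H_3$ is the connected and simply connected Lie group whose Lie algebra $\mathfrak{h}_3$ has basis $f_1,f_2,f_3$ with only nonzero bracket $[f_1,f_2]=f_3$. For a connected and simply connected nilpotent Lie group $H$, $\mathrm{Aff}(H) = H \rtimes \mathrm{Aut}(H)$ is the group of affine transformations, where $(h,\alpha)$ acts on $H$ by $x \mapsto h\,\alpha(x)$. $G$ acts simply transitively on $H$ via affine transformations if there is a Lie group morphism $\rho: G \to \mathrm{Aff}(H)$ such that the induced action on $H$ is simply transitive. The $3$-dimensional Lie algebras involved are given on a basis $e_1,e_2,e_3$ by the following nonzero brackets: $\mathfrak{r}_3$: $[e_1,e_2]=e_2$, $[e_1,e_3]=e_2+e_3$; $\mathfrak{r}_{3,\lambda}$: $[e_1,e_2]=e_2$, $[e_1,e_3]=\lambda e_3$; $\mathfrak{r}'_{3,\lambda}$: $[e_1,e_2]=\lambda e_2 - e_3$, $[e_1,e_3]=e_2+\lambda e_3$. *)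

theory Defs
  imports "HOL-Analysis.Analysis" "HOL-Algebra.Solvable_Groups" "HOL-Algebra.Bij"
begin

section \<open>Smooth manifolds\<close>

text \<open>\<^term>\<open>C_k k S f\<close> says that \<open>f\<close> is of class \<open>C\<^sup>k\<close> on \<open>S\<close>. It is only used for open sets \<open>S\<close>.\<close>

fun C_k :: "nat \<Rightarrow> 'a::real_normed_vector set \<Rightarrow> ('a \<Rightarrow> 'b::real_normed_vector) \<Rightarrow> bool" where
  "C_k 0 S f \<longleftrightarrow> continuous_on S f"
| "C_k (Suc k) S f \<longleftrightarrow>
     (\<forall>x\<in>S. f differentiable (at x)) \<and> (\<forall>v. C_k k S (\<lambda>x. frechet_derivative f (at x) v))"

definition smooth_on :: "'a::real_normed_vector set \<Rightarrow> ('a \<Rightarrow> 'b::real_normed_vector) \<Rightarrow> bool" where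
  "smooth_on S f \<longleftrightarrow> (\<forall>k. C_k k S f)"

text \<open>A manifold is given by its topology and an atlas (not necessarily a maximal one) of charts
  \<open>(U, \<phi>)\<close>, where \<open>\<phi>\<close> is only meaningful on \<open>U\<close>.\<close>

type_synonym ('a, 'e) manifold = "'a topology \<times> ('a set \<times> ('a \<Rightarrow> 'e)) set"

definition smooth_manifold :: "('a, 'e::euclidean_space) manifold \<Rightarrow> bool" where
  "smooth_manifold M \<longleftrightarrow> (case M of (T, A) \<Rightarrow>
     Hausdorff_space T \<and> second_countable T \<and>
     (\<Union>(U, \<phi>)\<in>A. U) = topspace T \<and>
     (\<forall>(U, \<phi>)\<in>A. openin T U \<and> open (\<phi> ` U) \<and>
        homeomorphic_map (subtopology T U) (top_of_set (\<phi> ` U)) \<phi>) \<and>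
     (\<forall>(U, \<phi>)\<in>A. \<forall>(V, \<psi>)\<in>A. smooth_on (\<phi> ` (U \<inter> V)) (\<psi> \<circ> inv_into U \<phi>)))"

definition smooth_map ::
  "('a, 'e::euclidean_space) manifold \<Rightarrow> ('b, 'f::euclidean_space) manifold \<Rightarrow> ('a \<Rightarrow> 'b) \<Rightarrow> bool" where
  "smooth_map M N f \<longleftrightarrow> (case (M, N) of ((T, A), (T', A')) \<Rightarrow>
     continuous_map T T' f \<and>
     (\<forall>(U, \<phi>)\<in>A. \<forall>(V, \<psi>)\<in>A'. smooth_on (\<phi> ` (U \<inter> f -` V)) (\<psi> \<circ> f \<circ> inv_into U \<phi>)))"

definition prod_manifold ::
  "('a, 'e) manifold \<Rightarrow> ('b, 'f) manifold \<Rightarrow> ('a \<times> 'b, 'e \<times> 'f) manifold" where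
  "prod_manifold M N = (case (M, N) of ((T, A), (T', A')) \<Rightarrow>
     (prod_topology T T', {(U \<times> V, map_prod \<phi> \<psi>) | U \<phi> V \<psi>. (U, \<phi>) \<in> A \<and> (V, \<psi>) \<in> A'}))"

definition euclidean_manifold :: "('e::euclidean_space, 'e) manifold" where
  "euclidean_manifold = (euclidean, {(UNIV, \<lambda>x. x)})"

section \<open>Lie groups and their Lie algebras\<close>

record ('a, 'e) lie_group = "'a monoid" +
  mfd :: "('a, 'e) manifold"

definition is_lie_group :: "('a, 'e::euclidean_space) lie_group \<Rightarrow> bool" where
  "is_lie_group G \<longleftrightarrow>
     group G \<and> smooth_manifold (mfd G) \<and> topspace (fst (mfd G)) = carrier G \<and>
     smooth_map (prod_manifold (mfd G) (mfd G)) (mfd G) (\<lambda>(x, y). x \<otimes>\<^bsub>G\<^esub> y) \<and>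
     smooth_map (mfd G) (mfd G) (\<lambda>x. inv\<^bsub>G\<^esub> x)"

definition lie_group_hom ::
  "('a, 'e::euclidean_space) lie_group \<Rightarrow> ('b, 'f::euclidean_space) lie_group \<Rightarrow> ('a \<Rightarrow> 'b) set" where
  "lie_group_hom G H = {f \<in> hom G H. smooth_map (mfd G) (mfd H) f}"

primrec lower_central :: "('a, 'b) monoid_scheme \<Rightarrow> nat \<Rightarrow> 'a set" where
  "lower_central G 0 = carrier G"
| "lower_central G (Suc n) = generate G
     {x \<otimes>\<^bsub>G\<^esub> y \<otimes>\<^bsub>G\<^esub> inv\<^bsub>G\<^esub> x \<otimes>\<^bsub>G\<^esub> inv\<^bsub>G\<^esub> y | x y. x \<in> carrier G \<and> y \<in> lower_central G n}"

definition nilpotent_group :: "('a, 'b) monoid_scheme \<Rightarrow> bool" where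
  "nilpotent_group G \<longleftrightarrow> (\<exists>n. lower_central G n = {\<one>\<^bsub>G\<^esub>})"

record 'a real_lie_algebra =
  lie_carrier :: "'a set"
  lie_add :: "'a \<Rightarrow> 'a \<Rightarrow> 'a"
  lie_scale :: "real \<Rightarrow> 'a \<Rightarrow> 'a"
  lie_bracket :: "'a \<Rightarrow> 'a \<Rightarrow> 'a"

definition lie_algebra_isomorphic :: "'a real_lie_algebra \<Rightarrow> 'b real_lie_algebra \<Rightarrow> bool" where
  "lie_algebra_isomorphic L M \<longleftrightarrow> (\<exists>F. bij_betw F (lie_carrier L) (lie_carrier M) \<and>
     (\<forall>x\<in>lie_carrier L. \<forall>y\<in>lie_carrier L. F (lie_add L x y) = lie_add M (F x) (F y)) \<and>
     (\<forall>c. \<forall>x\<in>lie_carrier L. F (lie_scale L c x) = lie_scale M c (F x)) \<and>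
     (\<forall>x\<in>lie_carrier L. \<forall>y\<in>lie_carrier L.
        F (lie_bracket L x y) = lie_bracket M (F x) (F y)))"

definition smooth_functions :: "('a, 'e::euclidean_space) lie_group \<Rightarrow> ('a \<Rightarrow> real) set" where
  "smooth_functions G =
     {f \<in> extensional (carrier G). smooth_map (mfd G) euclidean_manifold f}"

text \<open>Vector fields are derivations of the algebra \<open>C\<^sup>\<infinity>(G)\<close>; a vector field is left-invariant iff it
  commutes with all left translations \<open>f \<mapsto> (x \<mapsto> f (a x))\<close>. Functions on \<open>G\<close> and operators on
  \<open>C\<^sup>\<infinity>(G)\<close> are extensional, so that equality of vector fields is equality in HOL.\<close>

definition left_invariant_fields ::
  "('a, 'e::euclidean_space) lie_group \<Rightarrow> (('a \<Rightarrow> real) \<Rightarrow> ('a \<Rightarrow> real)) set" where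
  "left_invariant_fields G = {D \<in> smooth_functions G \<rightarrow>\<^sub>E smooth_functions G.
     (\<forall>f\<in>smooth_functions G. \<forall>g\<in>smooth_functions G. \<forall>b c.
        D (\<lambda>x\<in>carrier G. b * f x + c * g x) = (\<lambda>x\<in>carrier G. b * D f x + c * D g x)) \<and>
     (\<forall>f\<in>smooth_functions G. \<forall>g\<in>smooth_functions G.
        D (\<lambda>x\<in>carrier G. f x * g x) = (\<lambda>x\<in>carrier G. D f x * g x + f x * D g x)) \<and>
     (\<forall>a\<in>carrier G. \<forall>f\<in>smooth_functions G.
        D (\<lambda>x\<in>carrier G. f (a \<otimes>\<^bsub>G\<^esub> x)) = (\<lambda>x\<in>carrier G. D f (a \<otimes>\<^bsub>G\<^esub> x)))}"

definition lie_algebra_of ::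
  "('a, 'e::euclidean_space) lie_group \<Rightarrow> (('a \<Rightarrow> real) \<Rightarrow> ('a \<Rightarrow> real)) real_lie_algebra" where
  "lie_algebra_of G =
     \<lparr>lie_carrier = left_invariant_fields G,
      lie_add = (\<lambda>D E. \<lambda>f\<in>smooth_functions G. \<lambda>x\<in>carrier G. D f x + E f x),
      lie_scale = (\<lambda>c D. \<lambda>f\<in>smooth_functions G. \<lambda>x\<in>carrier G. c * D f x),
      lie_bracket = (\<lambda>D E. \<lambda>f\<in>smooth_functions G. \<lambda>x\<in>carrier G. D (E f) x - E (D f) x)\<rparr>"

section \<open>Three-dimensional Lie algebras\<close>

text \<open>\<open>bracket3 u v w\<close> is the alternating bilinear map on \<open>\<real>\<^sup>3\<close> with \<open>[e\<^sub>1,e\<^sub>2] = u\<close>, \<open>[e\<^sub>1,e\<^sub>3] = v\<close>,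
  \<open>[e\<^sub>2,e\<^sub>3] = w\<close> on the standard basis.\<close>

definition bracket3 :: "real^3 \<Rightarrow> real^3 \<Rightarrow> real^3 \<Rightarrow> real^3 \<Rightarrow> real^3 \<Rightarrow> real^3" where
  "bracket3 u v w x y =
     (x$1 * y$2 - x$2 * y$1) *\<^sub>R u + (x$1 * y$3 - x$3 * y$1) *\<^sub>R v + (x$2 * y$3 - x$3 * y$2) *\<^sub>R w"

definition lie3 :: "real^3 \<Rightarrow> real^3 \<Rightarrow> real^3 \<Rightarrow> (real^3) real_lie_algebra" where
  "lie3 u v w = \<lparr>lie_carrier = UNIV, lie_add = (+), lie_scale = (*\<^sub>R), lie_bracket = bracket3 u v w\<rparr>"

abbreviation e1 :: "real^3" where "e1 \<equiv> axis 1 1"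
abbreviation e2 :: "real^3" where "e2 \<equiv> axis 2 1"
abbreviation e3 :: "real^3" where "e3 \<equiv> axis 3 1"

definition h3 :: "(real^3) real_lie_algebra" where
  "h3 = lie3 e3 0 0"

definition r3 :: "(real^3) real_lie_algebra" where
  "r3 = lie3 e2 (e2 + e3) 0"

definition r3_par :: "real \<Rightarrow> (real^3) real_lie_algebra" where
  "r3_par l = lie3 e2 (l *\<^sub>R e3) 0"

definition r3'_par :: "real \<Rightarrow> (real^3) real_lie_algebra" where
  "r3'_par l = lie3 (l *\<^sub>R e2 - e3) (e2 + l *\<^sub>R e3) 0"

section \<open>The Heisenberg group and its affine group\<close>

text \<open>\<open>H\<^sub>3\<close> in exponential coordinates: by the Baker-Campbell-Hausdorff formula the simply connected
  group of the two-step nilpotent Lie algebra \<open>\<hh>\<^sub>3\<close> is \<open>\<hh>\<^sub>3\<close> itself with product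
  \<open>x + y + [x,y]/2\<close>.\<close>

definition H3 :: "(real^3, real^3) lie_group" where
  "H3 = \<lparr>carrier = UNIV, mult = (\<lambda>x y. x + y + (1/2) *\<^sub>R lie_bracket h3 x y), one = 0,
         mfd = euclidean_manifold\<rparr>"

definition lie_auto :: "('a, 'e::euclidean_space) lie_group \<Rightarrow> ('a \<Rightarrow> 'a) set" where
  "lie_auto H = {\<alpha> \<in> auto H. smooth_map (mfd H) (mfd H) \<alpha> \<and>
     smooth_map (mfd H) (mfd H) (inv_into (carrier H) \<alpha>)}"

definition aff_group :: "('a, 'e::euclidean_space) lie_group \<Rightarrow> ('a \<times> ('a \<Rightarrow> 'a)) monoid" where
  "aff_group H = \<lparr>carrier = carrier H \<times> lie_auto H,
     mult = (\<lambda>(h, \<alpha>) (k, \<beta>). (h \<otimes>\<^bsub>H\<^esub> \<alpha> k, compose (carrier H) \<alpha> \<beta>)),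
     one = (\<one>\<^bsub>H\<^esub>, \<lambda>x\<in>carrier H. x)\<rparr>"

definition aff_act :: "('a, 'e) lie_group \<Rightarrow> 'a \<times> ('a \<Rightarrow> 'a) \<Rightarrow> 'a \<Rightarrow> 'a" where
  "aff_act H = (\<lambda>(h, \<alpha>) x. h \<otimes>\<^bsub>H\<^esub> \<alpha> x)"

text \<open>The Lie group structure of \<open>Aff(H\<^sub>3)\<close>. In exponential coordinates every Lie group automorphism
  \<open>\<alpha>\<close> of \<open>H\<^sub>3\<close> equals its differential at the identity, a Lie algebra automorphism of \<open>\<hh>\<^sub>3\<close>. As
  \<open>\<alpha> f\<^sub>3 = [\<alpha> f\<^sub>1, \<alpha> f\<^sub>2]\<close>, it is determined by the pair \<open>(\<alpha> f\<^sub>1, \<alpha> f\<^sub>2)\<close>, and all pairs with nonzero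
  bracket occur. So \<open>\<alpha> \<mapsto> (\<alpha> f\<^sub>1, \<alpha> f\<^sub>2)\<close> is a global chart with open image for the closed subgroup
  \<open>Aut(\<hh>\<^sub>3)\<close> of \<open>GL(\<hh>\<^sub>3)\<close>.\<close>

definition aff_H3_chart :: "(real^3) \<times> (real^3 \<Rightarrow> real^3) \<Rightarrow> (real^3) \<times> (real^3) \<times> (real^3)" where
  "aff_H3_chart = (\<lambda>(h, \<alpha>). (h, \<alpha> e1, \<alpha> e2))"

definition Aff_H3 ::
  "((real^3) \<times> (real^3 \<Rightarrow> real^3), (real^3) \<times> (real^3) \<times> (real^3)) lie_group" where
  "Aff_H3 = monoid.extend (aff_group H3)
     \<lparr>mfd = (pullback_topology (carrier (aff_group H3)) aff_H3_chart euclidean,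
             {(carrier (aff_group H3), aff_H3_chart)})\<rparr>"

end

theory Submission
  imports Defs
begin

text \<open>The orbit map \<open>\<theta>\<close> of \<open>0\<close> identifies \<open>G\<close> with \<open>\<real>\<^sup>3\<close>; invariance of domain and Sard's theorem show
  that it is a diffeomorphism. The group law becomes \<open>x * \<alpha>\<^sub>x(y)\<close> with \<open>*\<close> the product of \<open>H\<^sub>3\<close> and
  \<open>\<alpha> : \<real>\<^sup>3 \<rightarrow> Aut(H\<^sub>3)\<close>. Left translations are then affine maps of \<open>\<real>\<^sup>3\<close> and, by Hadamard's lemma, the
  left-invariant fields are the derivatives along \<open>a \<mapsto> A\<^sub>a v\<close>, where \<open>A\<^sub>a\<close> is the linear part of left
  translation by \<open>a\<close>. Let \<open>\<delta>\<close> be the differential of \<open>\<alpha>\<close> at \<open>0\<close>, with values in the derivations of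
  \<open>\<hh>\<^sub>3\<close>. The Lie algebra of \<open>G\<close> is \<open>\<real>\<^sup>3\<close> with the bracket \<open>[v,w] + \<delta>\<^sub>v w - \<delta>\<^sub>w v\<close>, for which \<open>\<delta>\<close> is a
  homomorphism.

  As right translations are diffeomorphisms, \<open>v \<mapsto> v + \<delta>\<^sub>v w + [v,w]/2\<close> is invertible for every \<open>w\<close>. Its
  determinant is a real polynomial in \<open>w\<close> without zeros, which makes enough traces vanish to determine
  the Lie algebra by cases: the block of \<open>\<delta>\<close> at \<open>f\<^sub>3\<close> acting on \<open>\<hh>\<^sub>3\<close> modulo its center is zero,
  nilpotent or invertible. The outcome is one of the listed algebras or a Lie algebra that is nilpotent
  of class at most two; in the latter case the adjoint representation of \<open>G\<close> shows that commutators are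
  central in \<open>G\<close>.\<close>

section \<open>Calculus of smooth functions\<close>

text \<open>The orbit map is at first only a smooth bijection, so even the dimension of
  \<open>G\<close> has to be derived.

  In the algebraic part, the third coordinate \<open>z\<close> of \<open>w\<close> enters only the
  last row of the matrix, linearly. So the determinant is affine in \<open>z\<close>, and a real
  affine function without zeros is constant. Let \<open>B v\<close> be the block of
  \<open>\<delta> v\<close> modulo the center and \<open>t v\<close> its trace. The coefficient of
  \<open>z\<close> gives \<open>t e3 = 0\<close> and \<open>(t e1, t e2) B e3 = 0\<close>. A
  singular traceless 2 x 2 matrix is nilpotent, which explains the three cases. In each of them,
  unless the algebra is nilpotent, it is an abelian plane together with a vector that acts on the
  plane by a matrix with a nonzero double eigenvalue or by an invertible traceless one. Rescaling
  that vector makes the eigenvalue 1, or the square of the matrix 1 or -1; hence the parameters 1,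
  -1 and 0.

  The hypothesis of non-nilpotency concerns the group, not the Lie algebra. The passage between them
  uses no exponential map, only that functions on \<real>^3 with zero derivative are
  constant.\<close>

lemma frechet_derivative_worksI:
  "f differentiable (at x) \<Longrightarrow> (f has_derivative frechet_derivative f (at x)) (at x)"
  using frechet_derivative_works by blast

lemma C_k_cong:
  assumes "open S" "\<And>x. x \<in> S \<Longrightarrow> f x = g x" "C_k k S f"
  shows "C_k k S g"
  using assms(2,3)
proof (induction k arbitrary: f g)
  case 0
  then show ?case by (simp cong: continuous_on_cong)
next
  case (Suc k)
  have d: "f differentiable at x" if "x \<in> S" for x using Suc.prems that by simp
  have 1: "(g has_derivative frechet_derivative f (at x)) (at x)" if "x \<in> S" for x
    by (rule has_derivative_transform_within_open[OF
          frechet_derivative_worksI[OF d[OF that]] assms(1) that Suc.prems(1)])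
  have 2: "frechet_derivative g (at x) = frechet_derivative f (at x)" if "x \<in> S" for x
    using frechet_derivative_at[OF 1[OF that]] by simp
  show ?case
    using 1 2 Suc.prems(2) Suc.IH[of "\<lambda>x. frechet_derivative f (at x) v" "\<lambda>x. frechet_derivative g (at x) v" for v]
    by (auto simp: differentiable_def)
qed

lemma C_k_subset: "C_k k S f \<Longrightarrow> T \<subseteq> S \<Longrightarrow> C_k k T f"
  by (induction k arbitrary: f) (auto intro: continuous_on_subset)

lemma C_k_Suc_D: "C_k (Suc k) S f \<Longrightarrow> C_k k S f"
proof (induction k arbitrary: f)
  case 0
  then show ?case
    by (simp add: differentiable_imp_continuous_within continuous_at_imp_continuous_on)
qed simp

text \<open>The closure properties below are proved by induction on \<open>k\<close>. This rule lets
  the derivative be any explicit formula instead of \<open>frechet_derivative\<close>.\<close>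

lemma C_k_Suc_I:
  assumes "open S" "\<And>x. x \<in> S \<Longrightarrow> (f has_derivative f' x) (at x)"
    "\<And>v. C_k k S (\<lambda>x. f' x v)"
  shows "C_k (Suc k) S f"
proof -
  have "frechet_derivative f (at x) = f' x" if "x \<in> S" for x
    using frechet_derivative_at[OF assms(2)[OF that]] by simp
  then show ?thesis
    using assms C_k_cong[OF assms(1) _ assms(3)] by (auto simp: differentiable_def)
qed

lemma C_k_derivative:
  "C_k (Suc k) S f \<Longrightarrow> x \<in> S \<Longrightarrow> (f has_derivative frechet_derivative f (at x)) (at x)"
  by (simp add: frechet_derivative_worksI)

lemma C_k_const: "C_k k S (\<lambda>x. c)"
  by (induction k arbitrary: c) auto

lemma C_k_linear:
  assumes "bounded_linear h" shows "C_k k S h"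
proof (cases k)
  case 0
  then show ?thesis using assms by (simp add: linear_continuous_on)
next
  case (Suc n)
  have "frechet_derivative h (at x) = h" for x
    using frechet_derivative_at[OF bounded_linear_imp_has_derivative[OF assms]] by simp
  then show ?thesis using Suc assms
    by (auto simp: C_k_const bounded_linear_imp_differentiable)
qed

lemma C_k_add:
  assumes "open S" "C_k k S f" "C_k k S g"
  shows "C_k k S (\<lambda>x. f x + g x)"
  using assms(2,3)
proof (induction k arbitrary: f g)
  case 0
  then show ?case by (simp add: continuous_on_add)
next
  case (Suc k)
  show ?case
    by (rule C_k_Suc_I[OF assms(1) has_derivative_add[OF C_k_derivative[OF Suc.prems(1)]
            C_k_derivative[OF Suc.prems(2)]]])
      (use Suc in auto)
qed

lemma C_k_sum:
  assumes "open S" "\<And>i. i \<in> I \<Longrightarrow> C_k k S (f i)"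
  shows "C_k k S (\<lambda>x. \<Sum>i\<in>I. f i x)"
  using assms(2)
  by (induction I rule: infinite_finite_induct) (auto simp: C_k_const intro!: C_k_add assms(1))

lemma C_k_bilinear:
  assumes "bounded_bilinear pr" "open S" "C_k k S f" "C_k k S g"
  shows "C_k k S (\<lambda>x. pr (f x) (g x))"
  using assms(3,4)
proof (induction k arbitrary: f g)
  case 0
  then show ?case using bounded_bilinear.continuous_on[OF assms(1)] by simp
next
  case (Suc k)
  have f: "C_k k S f" "C_k k S g" using Suc.prems C_k_Suc_D by blast+
  show ?case
    by (rule C_k_Suc_I[OF assms(2) bounded_bilinear.FDERIV[OF assms(1) C_k_derivative[OF Suc.prems(1)]
            C_k_derivative[OF Suc.prems(2)]]])
      (use Suc f in \<open>auto intro!: C_k_add assms(2)\<close>)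
qed

lemma C_k_linear_compose:
  assumes "bounded_linear h" "open S" "C_k k S f"
  shows "C_k k S (\<lambda>x. h (f x))"
  using assms(3)
proof (induction k arbitrary: f)
  case 0
  then show ?case using bounded_linear.continuous_on[OF assms(1)] by simp
next
  case (Suc k)
  show ?case
    by (rule C_k_Suc_I[OF assms(2) bounded_linear.has_derivative[OF assms(1) C_k_derivative[OF Suc.prems]]])
      (use Suc in auto)
qed

text \<open>\<open>C_k\<close> only sees derivatives in fixed directions, but the chain rule
  differentiates \<open>g\<close> in the direction \<open>?f' x v\<close>, which moves with
  \<open>x\<close>. Expanding it in \<open>Basis\<close> leaves sums of products of class
  \<open>C_k k\<close>; this is why the space in the middle is Euclidean.\<close>

lemma C_k_compose:
  fixes f :: "'a::real_normed_vector \<Rightarrow> 'b::euclidean_space"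
    and g :: "'b \<Rightarrow> 'c::real_normed_vector"
  assumes "open S" "f ` S \<subseteq> T" "C_k k S f" "C_k k T g"
  shows "C_k k S (\<lambda>x. g (f x))"
  using assms(3,4)
proof (induction k arbitrary: g)
  case 0
  then show ?case using continuous_on_compose2[OF _ _ assms(2)] by auto
next
  case (Suc k)
  have f: "C_k k S f" using Suc.prems C_k_Suc_D by blast
  let ?g' = "\<lambda>y. frechet_derivative g (at y)" and ?f' = "\<lambda>x. frechet_derivative f (at x)"
  have g: "(g has_derivative ?g' (f x)) (at (f x))" if "x \<in> S" for x
    using Suc.prems(2) assms(2) that by (auto intro!: frechet_derivative_worksI)
  have d: "((\<lambda>x. g (f x)) has_derivative (\<lambda>v. ?g' (f x) (?f' x v))) (at x)" if "x \<in> S" for x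
    by (rule has_derivative_compose[OF C_k_derivative[OF Suc.prems(1) that] g[OF that]])
  have e: "?g' (f x) (?f' x v) = (\<Sum>b\<in>Basis. (?f' x v \<bullet> b) *\<^sub>R ?g' (f x) b)" if "x \<in> S" for x v
  proof -
    have l: "linear (?g' (f x))" using g[OF that] has_derivative_linear by blast
    have "?g' (f x) (?f' x v) = ?g' (f x) (\<Sum>b\<in>Basis. (?f' x v \<bullet> b) *\<^sub>R b)"
      by (simp add: euclidean_representation)
    also have "\<dots> = (\<Sum>b\<in>Basis. (?f' x v \<bullet> b) *\<^sub>R ?g' (f x) b)"
      by (simp add: linear_sum[OF l] linear_scale[OF l])
    finally show ?thesis .
  qed
  have "C_k k S (\<lambda>x. ?g' (f x) (?f' x v))" for v
  proof (rule C_k_cong[OF assms(1) e[symmetric]])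
    show "C_k k S (\<lambda>x. \<Sum>b\<in>Basis. (?f' x v \<bullet> b) *\<^sub>R ?g' (f x) b)"
    proof (intro C_k_sum assms(1) C_k_bilinear[OF bounded_bilinear_scaleR])
      show "C_k k S (\<lambda>x. ?f' x v \<bullet> b)" for b
        by (rule C_k_linear_compose[OF bounded_linear_inner_left assms(1)]) (use Suc.prems in simp)
      show "C_k k S (\<lambda>x. ?g' (f x) b)" for b
        by (rule Suc.IH[OF f]) (use Suc.prems in simp)
    qed
  qed simp
  with d show ?case by (rule C_k_Suc_I[OF assms(1)])
qed

lemma C_k_Union:
  assumes "\<And>T. T \<in> \<T> \<Longrightarrow> open T" "\<And>T. T \<in> \<T> \<Longrightarrow> C_k k T f"
  shows "C_k k (\<Union>\<T>) f"
  using assms(2)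
proof (induction k arbitrary: f)
  case 0
  then show ?case using continuous_on_open_Union[of \<T>] assms(1) by auto
qed auto

lemma C_k_inverse:
  fixes f :: "'a::real_normed_vector \<Rightarrow> real"
  assumes "open S" "\<And>x. x \<in> S \<Longrightarrow> f x \<noteq> 0" "C_k k S f"
  shows "C_k k S (\<lambda>x. inverse (f x))"
  using assms(3)
proof (induction k)
  case 0
  then show ?case using assms by (simp add: continuous_on_inverse)
next
  case (Suc k)
  have f: "C_k k S (\<lambda>x. inverse (f x))" using Suc C_k_Suc_D by blast
  let ?f' = "\<lambda>x. frechet_derivative f (at x)"
  have "((\<lambda>x. inverse (f x)) has_derivative (\<lambda>v. - (inverse (f x) * ?f' x v * inverse (f x)))) (at x)"
    if "x \<in> S" for x
    by (rule Deriv.has_derivative_inverse[OF assms(2)[OF that] C_k_derivative[OF Suc.prems that]])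
  moreover have "C_k k S (\<lambda>x. - (inverse (f x) * ?f' x v * inverse (f x)))" for v
    by (intro C_k_linear_compose[OF bounded_linear_minus[OF bounded_linear_ident]]
         C_k_bilinear[OF bounded_bilinear_mult] assms(1) f) (use Suc.prems in simp)
  ultimately show ?case by (rule C_k_Suc_I[OF assms(1)])
qed

lemma smooth_on_cong:
  "open S \<Longrightarrow> (\<And>x. x \<in> S \<Longrightarrow> f x = g x) \<Longrightarrow> smooth_on S f \<Longrightarrow> smooth_on S g"
  unfolding smooth_on_def using C_k_cong by blast

lemma smooth_on_subset: "smooth_on S f \<Longrightarrow> T \<subseteq> S \<Longrightarrow> smooth_on T f"
  unfolding smooth_on_def using C_k_subset by blast

lemma smooth_on_const [intro]: "smooth_on S (\<lambda>x. c)"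
  unfolding smooth_on_def using C_k_const by blast

lemma smooth_on_linear: "bounded_linear h \<Longrightarrow> smooth_on S h"
  unfolding smooth_on_def using C_k_linear by blast

lemma smooth_on_add:
  "open S \<Longrightarrow> smooth_on S f \<Longrightarrow> smooth_on S g \<Longrightarrow> smooth_on S (\<lambda>x. f x + g x)"
  by (simp add: smooth_on_def C_k_add)

lemma smooth_on_sum:
  "open S \<Longrightarrow> (\<And>i. i \<in> I \<Longrightarrow> smooth_on S (f i)) \<Longrightarrow> smooth_on S (\<lambda>x. \<Sum>i\<in>I. f i x)"
  by (simp add: smooth_on_def C_k_sum)

lemma smooth_on_bilinear:
  "bounded_bilinear pr \<Longrightarrow> open S \<Longrightarrow> smooth_on S f \<Longrightarrow> smooth_on S g \<Longrightarrow>
    smooth_on S (\<lambda>x. pr (f x) (g x))"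
  by (simp add: smooth_on_def C_k_bilinear)

lemmas smooth_on_mult = smooth_on_bilinear[OF bounded_bilinear_mult]
lemmas smooth_on_scaleR = smooth_on_bilinear[OF bounded_bilinear_scaleR]

lemma smooth_on_linear_compose:
  "bounded_linear h \<Longrightarrow> open S \<Longrightarrow> smooth_on S f \<Longrightarrow> smooth_on S (\<lambda>x. h (f x))"
  by (simp add: smooth_on_def C_k_linear_compose)

lemma smooth_on_compose:
  fixes f :: "'a::real_normed_vector \<Rightarrow> 'b::euclidean_space"
  shows "open S \<Longrightarrow> f ` S \<subseteq> T \<Longrightarrow> smooth_on S f \<Longrightarrow> smooth_on T g \<Longrightarrow> smooth_on S (\<lambda>x. g (f x))"
  unfolding smooth_on_def by (blast intro: C_k_compose)

lemma smooth_on_local: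
  assumes "\<And>x. x \<in> S \<Longrightarrow> \<exists>T. open T \<and> x \<in> T \<and> smooth_on (S \<inter> T) f" "open S"
  shows "smooth_on S f"
proof -
  have "S = \<Union>{S \<inter> T |T. open T \<and> smooth_on (S \<inter> T) f}" using assms by blast
  moreover have "C_k k (\<Union>{S \<inter> T |T. open T \<and> smooth_on (S \<inter> T) f}) f" for k
    using assms(2) by (intro C_k_Union) (auto simp: smooth_on_def)
  ultimately show ?thesis unfolding smooth_on_def by metis
qed

lemma smooth_on_inverse:
  fixes f :: "'a::real_normed_vector \<Rightarrow> real"
  shows "open S \<Longrightarrow> (\<And>x. x \<in> S \<Longrightarrow> f x \<noteq> 0) \<Longrightarrow> smooth_on S f \<Longrightarrow> smooth_on S (\<lambda>x. inverse (f x))"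
  by (simp add: smooth_on_def C_k_inverse)

lemma smooth_on_continuous: "smooth_on S f \<Longrightarrow> continuous_on S f"
  unfolding smooth_on_def using C_k.simps(1) by blast

lemma smooth_on_derivative:
  "smooth_on S f \<Longrightarrow> x \<in> S \<Longrightarrow> (f has_derivative frechet_derivative f (at x)) (at x)"
  unfolding smooth_on_def using C_k_derivative by blast

lemma smooth_on_frechet_derivative:
  "smooth_on S f \<Longrightarrow> smooth_on S (\<lambda>x. frechet_derivative f (at x) v)"
  unfolding smooth_on_def using C_k.simps(2) by blast

lemma smooth_on_prod:
  fixes f :: "'i \<Rightarrow> 'a::real_normed_vector \<Rightarrow> real"
  shows "open S \<Longrightarrow> (\<And>i. i \<in> I \<Longrightarrow> smooth_on S (f i)) \<Longrightarrow> smooth_on S (\<lambda>x. \<Prod>i\<in>I. f i x)"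
  by (induction I rule: infinite_finite_induct) (auto intro!: smooth_on_mult)

lemma smooth_on_nth: "open S \<Longrightarrow> smooth_on S f \<Longrightarrow> smooth_on S (\<lambda>x. f x $ i)"
  by (rule smooth_on_linear_compose[OF bounded_linear_vec_nth])

lemma smooth_on_vec:
  fixes f :: "'a::real_normed_vector \<Rightarrow> real^'n"
  assumes "open S" "\<And>i. smooth_on S (\<lambda>x. f x $ i)"
  shows "smooth_on S f"
proof -
  have "f = (\<lambda>x. \<Sum>i\<in>UNIV. (f x $ i) *\<^sub>R axis i 1)"
    by (auto simp: vec_eq_iff axis_def if_distrib[of "\<lambda>y. _ * y"] cong: if_cong)
  moreover have "smooth_on S (\<lambda>x. \<Sum>i\<in>UNIV. (f x $ i) *\<^sub>R (axis i 1 :: real^'n))"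
    using assms by (intro smooth_on_sum smooth_on_scaleR) auto
  ultimately show ?thesis by simp
qed

lemma smooth_on_det:
  fixes M :: "'a::real_normed_vector \<Rightarrow> real^'n^'n"
  assumes "open S" "\<And>i j. smooth_on S (\<lambda>x. M x $ i $ j)"
  shows "smooth_on S (\<lambda>x. det (M x))"
  unfolding det_def using assms by (intro smooth_on_sum smooth_on_mult smooth_on_prod) auto

text \<open>The derivative of the local inverse is expressed by Cramer's rule.\<close>

lemma smooth_on_inverse_function:
  fixes f g :: "real^'n \<Rightarrow> real^'n"
  assumes S: "open S" "open (f ` S)" and f: "smooth_on S f"
    and det: "\<And>x. x \<in> S \<Longrightarrow> det (matrix (frechet_derivative f (at x))) \<noteq> 0"
    and g: "continuous_on (f ` S) g" "\<And>x. x \<in> S \<Longrightarrow> g (f x) = x"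
  shows "smooth_on (f ` S) g"
proof -
  let ?M = "\<lambda>x. matrix (frechet_derivative f (at x))"
  define h where "h = (\<lambda>x v. \<chi> k. det (\<chi> i j. if j = k then v $ i else ?M x $ i $ j) / det (?M x))"
  have h: "smooth_on S (\<lambda>x. h x v)" for v
  proof (rule smooth_on_vec[OF S(1)])
    fix k
    have M: "smooth_on S (\<lambda>x. ?M x $ i $ j)" for i j
      unfolding matrix_def by (simp add: smooth_on_nth smooth_on_frechet_derivative S f)
    show "smooth_on S (\<lambda>x. h x v $ k)"
      unfolding h_def divide_inverse vec_lambda_beta
    proof (intro smooth_on_mult smooth_on_inverse smooth_on_det S(1) det M)
      fix i j
      show "smooth_on S (\<lambda>x. (\<chi> i j. if j = k then v $ i else ?M x $ i $ j) $ i $ j)"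
        by (cases "j = k") (use M in \<open>auto simp: smooth_on_const\<close>)
    qed
  qed
  have inv: "frechet_derivative f (at x) u = v \<longleftrightarrow> u = h x v" if x: "x \<in> S" for x u v
  proof -
    have "linear (frechet_derivative f (at x))"
      using smooth_on_derivative[OF f x] has_derivative_linear by blast
    then have "frechet_derivative f (at x) u = ?M x *v u" by (simp add: matrix_works)
    then show ?thesis unfolding h_def using cramer[OF det[OF x]] by simp
  qed
  have d: "(g has_derivative h (g y)) (at y)" if "y \<in> f ` S" for y
  proof -
    obtain x where x: "x \<in> S" "y = f x" using \<open>y \<in> f ` S\<close> by blast
    have l: "linear (frechet_derivative f (at x))"
      using smooth_on_derivative[OF f x(1)] has_derivative_linear by blast
    have "linear (h x)"
      by (rule linearI) (metis inv[OF x(1)] linear_add[OF l], metis inv[OF x(1)] linear_scale[OF l])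
    then have bl: "bounded_linear (h x)" by (rule linear_linear[THEN iffD2])
    have "(g has_derivative h x) (at (f x))"
      by (rule has_derivative_inverse_dieudonne[OF S smooth_on_continuous[OF f] g x(1)
            smooth_on_derivative[OF f x(1)] bl]) (auto simp: fun_eq_iff inv[OF x(1), THEN iffD1, OF refl, symmetric])
    then show ?thesis using x g by simp
  qed
  \<comment> \<open>Bootstrap: the derivative of \<open>g\<close> is \<open>h (g y)\<close>, hence
    as smooth as \<open>g\<close> itself, so that each step gains one order.\<close>
  have "C_k k (f ` S) g" for k
  proof (induction k)
    case 0
    then show ?case using g by simp
  next
    case (Suc k)
    have "C_k k (f ` S) (\<lambda>y. h (g y) v)" for v
      by (rule C_k_compose[OF S(2) _ Suc, of S]) (use g h in \<open>auto simp: smooth_on_def\<close>)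
    with d show ?case by (rule C_k_Suc_I[OF S(2)])
  qed
  then show ?thesis by (simp add: smooth_on_def)
qed

section \<open>Smooth maps between manifolds\<close>

text \<open>The part of \<^term>\<open>smooth_manifold\<close> that composing smooth maps needs.\<close>

definition chart_atlas :: "('a, 'e::euclidean_space) manifold \<Rightarrow> bool" where
  "chart_atlas M \<longleftrightarrow> (case M of (T, A) \<Rightarrow>
     (\<Union>(U, \<phi>)\<in>A. U) = topspace T \<and>
     (\<forall>(U, \<phi>)\<in>A. openin T U \<and> inj_on \<phi> U \<and> (\<forall>W. openin T W \<longrightarrow> W \<subseteq> U \<longrightarrow> open (\<phi> ` W))))"

lemma chart_atlas_cover:
  "chart_atlas (T, A) \<Longrightarrow> x \<in> topspace T \<Longrightarrow> \<exists>U \<phi>. (U, \<phi>) \<in> A \<and> x \<in> U"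
proof -
  assume "chart_atlas (T, A)" "x \<in> topspace T"
  then have "x \<in> (\<Union>(U, \<phi>)\<in>A. U)" by (simp add: chart_atlas_def)
  then show ?thesis by auto
qed

lemma chart_atlasD:
  assumes "chart_atlas (T, A)" "(U, \<phi>) \<in> A"
  shows "openin T U" "inj_on \<phi> U" "\<And>W. openin T W \<Longrightarrow> W \<subseteq> U \<Longrightarrow> open (\<phi> ` W)"
    "U \<subseteq> topspace T"
proof -
  have "openin T U \<and> inj_on \<phi> U \<and> (\<forall>W. openin T W \<longrightarrow> W \<subseteq> U \<longrightarrow> open (\<phi> ` W))"
    using assms by (auto simp: chart_atlas_def)
  then show "openin T U" "inj_on \<phi> U" "\<And>W. openin T W \<Longrightarrow> W \<subseteq> U \<Longrightarrow> open (\<phi> ` W)"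
    "U \<subseteq> topspace T" using openin_subset by auto
qed

lemma smooth_manifold_chart_atlas:
  assumes "smooth_manifold M" shows "chart_atlas M"
proof -
  obtain T A where M: "M = (T, A)" by fastforce
  have 1: "openin T U" "open (\<phi> ` U)" "homeomorphic_map (subtopology T U) (top_of_set (\<phi> ` U)) \<phi>"
    if "(U, \<phi>) \<in> A" for U \<phi>
    using assms that unfolding M smooth_manifold_def by auto
  have "inj_on \<phi> U" "\<And>W. openin T W \<Longrightarrow> W \<subseteq> U \<Longrightarrow> open (\<phi> ` W)" if "(U, \<phi>) \<in> A" for U \<phi>
  proof -
    note h = 1[OF that]
    have "topspace (subtopology T U) = U" using openin_subset[OF h(1)] by auto
    then show "inj_on \<phi> U" using homeomorphic_imp_injective_map[OF h(3)] by simp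
    fix W assume "openin T W" "W \<subseteq> U"
    then have "openin (subtopology T U) W" using h(1) openin_open_subtopology by blast
    then have "openin (top_of_set (\<phi> ` U)) (\<phi> ` W)"
      using homeomorphic_imp_open_map[OF h(3)] by (simp add: open_map_def)
    then show "open (\<phi> ` W)" using h(2) openin_open_eq by blast
  qed
  then show ?thesis using assms 1 unfolding M chart_atlas_def smooth_manifold_def by auto
qed

lemma chart_atlas_euclidean: "chart_atlas euclidean_manifold"
  by (auto simp: chart_atlas_def euclidean_manifold_def)

text \<open>The image of a chart domain need not lie in a single chart of \<open>N\<close>. The
  argument is therefore local: near each point, a chart of \<open>N\<close> around its image is
  inserted between the two maps.\<close>

lemma smooth_map_compose:
  assumes f: "smooth_map M N f" and g: "smooth_map N K g"
    and at: "chart_atlas M" "chart_atlas N" "chart_atlas K"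
  shows "smooth_map M K (g \<circ> f)"
proof -
  obtain T1 A1 T2 A2 T3 A3 where M: "M = (T1, A1)" "N = (T2, A2)" "K = (T3, A3)"
    by (metis surj_pair)
  note at' = at[unfolded M]
  have fc: "continuous_map T1 T2 f"
    and fs: "(U, \<phi>) \<in> A1 \<Longrightarrow> (V, \<psi>) \<in> A2 \<Longrightarrow> smooth_on (\<phi> ` (U \<inter> f -` V)) (\<psi> \<circ> f \<circ> inv_into U \<phi>)"
    for U \<phi> V \<psi>
    using f unfolding M smooth_map_def by auto
  have gc: "continuous_map T2 T3 g"
    and gs: "(U, \<phi>) \<in> A2 \<Longrightarrow> (V, \<psi>) \<in> A3 \<Longrightarrow> smooth_on (\<phi> ` (U \<inter> g -` V)) (\<psi> \<circ> g \<circ> inv_into U \<phi>)"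
    for U \<phi> V \<psi>
    using g unfolding M smooth_map_def by auto
  have c: "continuous_map T1 T3 (g \<circ> f)" by (rule continuous_map_compose[OF fc gc])
  have pre: "openin T1 (U \<inter> h -` V)" if "continuous_map T1 T h" "openin T1 U" "openin T V"
    for T :: "'x topology" and h U V
  proof -
    have "U \<inter> h -` V = U \<inter> {x \<in> topspace T1. h x \<in> V}" using openin_subset[OF that(2)] by auto
    then show ?thesis
      using openin_Int[OF that(2) openin_continuous_map_preimage[OF that(1,3)]] by simp
  qed
  have "smooth_on (\<phi> ` (U \<inter> (g \<circ> f) -` W)) (\<eta> \<circ> (g \<circ> f) \<circ> inv_into U \<phi>)"
    if U: "(U, \<phi>) \<in> A1" and W: "(W, \<eta>) \<in> A3" for U \<phi> W \<eta>
  proof (rule smooth_on_local)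
    note u = chart_atlasD[OF at'(1) U] and w = chart_atlasD[OF at'(3) W]
    have oS: "openin T1 (U \<inter> (g \<circ> f) -` W)" by (rule pre[OF c u(1) w(1)])
    then show "open (\<phi> ` (U \<inter> (g \<circ> f) -` W))" using u(3) by blast
    fix y assume "y \<in> \<phi> ` (U \<inter> (g \<circ> f) -` W)"
    then obtain x where x: "x \<in> U" "g (f x) \<in> W" "y = \<phi> x" by auto
    have "f x \<in> topspace T2" using fc u(4) x(1) by (auto simp: continuous_map_def)
    then obtain V \<psi> where V: "(V, \<psi>) \<in> A2" "f x \<in> V" using chart_atlas_cover[OF at'(2)] by blast
    note v = chart_atlasD[OF at'(2) V(1)]
    let ?T = "\<phi> ` (U \<inter> f -` V)"
    have oT: "openin T1 (U \<inter> f -` V)" by (rule pre[OF fc u(1) v(1)])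
    have T: "open ?T" using u(3)[OF oT] by auto
    have eq: "\<phi> ` (U \<inter> (g \<circ> f) -` W) \<inter> ?T = \<phi> ` (U \<inter> (g \<circ> f) -` W \<inter> f -` V)"
      using u(2) by (auto simp: inj_on_def)
    have o: "open (\<phi> ` (U \<inter> (g \<circ> f) -` W) \<inter> ?T)"
      using T u(3)[OF oS] by auto
    have "smooth_on (\<phi> ` (U \<inter> (g \<circ> f) -` W) \<inter> ?T)
      (\<lambda>x. (\<eta> \<circ> g \<circ> inv_into V \<psi>) ((\<psi> \<circ> f \<circ> inv_into U \<phi>) x))"
    proof (rule smooth_on_compose[OF o, where f = "\<psi> \<circ> f \<circ> inv_into U \<phi>"
          and T = "\<psi> ` (V \<inter> g -` W)"])
      show "smooth_on (\<psi> ` (V \<inter> g -` W)) (\<eta> \<circ> g \<circ> inv_into V \<psi>)" by (rule gs[OF V(1) W])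
      show "smooth_on (\<phi> ` (U \<inter> (g \<circ> f) -` W) \<inter> ?T) (\<psi> \<circ> f \<circ> inv_into U \<phi>)"
        by (rule smooth_on_subset[OF fs[OF U V(1)]]) auto
      show "(\<psi> \<circ> f \<circ> inv_into U \<phi>) ` (\<phi> ` (U \<inter> (g \<circ> f) -` W) \<inter> ?T) \<subseteq> \<psi> ` (V \<inter> g -` W)"
        unfolding eq using u(2) by auto
    qed
    then have "smooth_on (\<phi> ` (U \<inter> (g \<circ> f) -` W) \<inter> ?T) (\<eta> \<circ> (g \<circ> f) \<circ> inv_into U \<phi>)"
      by (rule smooth_on_cong[OF o, rotated]) (use u(2) v(2) eq in auto)
    then show "\<exists>T. open T \<and> y \<in> T \<and> smooth_on (\<phi> ` (U \<inter> (g \<circ> f) -` W) \<inter> T) (\<eta> \<circ> (g \<circ> f) \<circ> inv_into U \<phi>)"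
      using T x V(2) by blast
  qed
  then show ?thesis using c unfolding M smooth_map_def by auto
qed

lemma smooth_map_cong:
  assumes "chart_atlas M" "chart_atlas N" "smooth_map M N f" "\<And>x. x \<in> topspace (fst M) \<Longrightarrow> f x = g x"
  shows "smooth_map M N g"
proof -
  obtain T1 A1 T2 A2 where M: "M = (T1, A1)" "N = (T2, A2)" by (metis surj_pair)
  have fc: "continuous_map T1 T2 f"
    and fs: "(U, \<phi>) \<in> A1 \<Longrightarrow> (V, \<psi>) \<in> A2 \<Longrightarrow> smooth_on (\<phi> ` (U \<inter> f -` V)) (\<psi> \<circ> f \<circ> inv_into U \<phi>)"
    for U \<phi> V \<psi>
    using assms(3) unfolding M smooth_map_def by auto
  have "smooth_on (\<phi> ` (U \<inter> g -` V)) (\<psi> \<circ> g \<circ> inv_into U \<phi>)"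
    if U: "(U, \<phi>) \<in> A1" and V: "(V, \<psi>) \<in> A2" for U \<phi> V \<psi>
  proof -
    note u = chart_atlasD[OF assms(1)[unfolded M] U] and v = chart_atlasD[OF assms(2)[unfolded M] V]
    have fg: "f x = g x" if "x \<in> U" for x using assms(4) u(4) that by (auto simp: M)
    then have eq: "U \<inter> g -` V = U \<inter> f -` V" by auto
    have "U \<inter> f -` V = U \<inter> {x \<in> topspace T1. f x \<in> V}" using u(4) by auto
    then have "openin T1 (U \<inter> f -` V)"
      using openin_Int[OF u(1) openin_continuous_map_preimage[OF fc v(1)]] by simp
    then have "open (\<phi> ` (U \<inter> f -` V))" using u(3) by blast
    then show ?thesis unfolding eq
      by (rule smooth_on_cong[OF _ _ fs[OF U V]]) (use fg u(2) in auto)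
  qed
  moreover have "continuous_map T1 T2 g"
    using fc by (rule continuous_map_eq) (use assms(4) M in auto)
  ultimately show ?thesis unfolding M smooth_map_def by auto
qed

lemma smooth_map_euclidean:
  "smooth_map M euclidean_manifold f \<longleftrightarrow> continuous_map (fst M) euclidean f \<and>
    (\<forall>(U, \<phi>)\<in>snd M. smooth_on (\<phi> ` U) (f \<circ> inv_into U \<phi>))"
  by (cases M) (auto simp: smooth_map_def euclidean_manifold_def comp_def)

lemma smooth_map_euclidean_euclidean:
  "smooth_map euclidean_manifold euclidean_manifold f \<longleftrightarrow> smooth_on UNIV f"
proof -
  have "inv_into UNIV (\<lambda>x::'a. x) = (\<lambda>x. x)" by (auto simp: inv_f_eq fun_eq_iff)
  then show ?thesis
    using smooth_on_continuous[of UNIV f]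
    by (auto simp: smooth_map_euclidean) (auto simp: euclidean_manifold_def comp_def)
qed

text \<open>Left translation is a slice of multiplication. After fixing one chart
  \<open>\<psi>\<close> at \<open>g\<close>, the slice is the affine map
  \<open>y \<mapsto> (\<psi> g, y)\<close> in product charts.\<close>

lemma smooth_map_section:
  fixes M :: "('a, 'e::euclidean_space) manifold" and N :: "('b, 'f::euclidean_space) manifold"
  assumes m: "smooth_map (prod_manifold M N) K (\<lambda>(x, y). m x y)"
    and at: "chart_atlas M" "chart_atlas N" "chart_atlas K" and g: "g \<in> topspace (fst M)"
  shows "smooth_map N K (m g)"
proof -
  obtain T1 A1 T2 A2 T3 A3 where M: "M = (T1, A1)" "N = (T2, A2)" "K = (T3, A3)"
    by (metis surj_pair)
  note at' = at[unfolded M]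
  have mc: "continuous_map (prod_topology T1 T2) T3 (\<lambda>(x, y). m x y)"
    using m unfolding M smooth_map_def prod_manifold_def by auto
  have "continuous_map T2 (prod_topology T1 T2) (\<lambda>y. (g, y))"
    using g M by (simp add: continuous_map_pairedI)
  from continuous_map_compose[OF this mc] have c: "continuous_map T2 T3 (m g)"
    by (simp add: comp_def)
  obtain V \<psi> where V: "(V, \<psi>) \<in> A1" "g \<in> V"
    using chart_atlas_cover[OF at'(1)] g M by (metis fst_conv)
  note v = chart_atlasD[OF at'(1) V(1)]
  have "smooth_on (\<phi> ` (U \<inter> m g -` W)) (\<eta> \<circ> m g \<circ> inv_into U \<phi>)"
    if U: "(U, \<phi>) \<in> A2" and W: "(W, \<eta>) \<in> A3" for U \<phi> W \<eta>
  proof -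
    note u = chart_atlasD[OF at'(2) U] and w = chart_atlasD[OF at'(3) W]
    have inj: "inj_on (map_prod \<psi> \<phi>) (V \<times> U)" using u(2) v(2) by (rule map_prod_inj_on[rotated])
    have "(V \<times> U, map_prod \<psi> \<phi>) \<in> snd (prod_manifold M N)"
      using U V by (auto simp: prod_manifold_def M)
    then have s: "smooth_on (map_prod \<psi> \<phi> ` (V \<times> U \<inter> (\<lambda>(x, y). m x y) -` W))
       (\<eta> \<circ> (\<lambda>(x, y). m x y) \<circ> inv_into (V \<times> U) (map_prod \<psi> \<phi>))" (is "smooth_on ?P ?F")
      using m W unfolding smooth_map_def M by (cases "prod_manifold (T1, A1) (T2, A2)") auto
    have "U \<inter> m g -` W = U \<inter> {x \<in> topspace T2. m g x \<in> W}" using u(4) by auto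
    then have "openin T2 (U \<inter> m g -` W)"
      using openin_Int[OF u(1) openin_continuous_map_preimage[OF c w(1)]] by simp
    then have o: "open (\<phi> ` (U \<inter> m g -` W))" using u(3) by blast
    have "bounded_linear (\<lambda>y::'f. (0::'e, y))"
      by (intro bounded_linear_Pair bounded_linear_zero bounded_linear_ident)
    then have "smooth_on (\<phi> ` (U \<inter> m g -` W)) (\<lambda>y. (\<psi> g, 0) + (0, y))"
      by (intro smooth_on_add o smooth_on_linear smooth_on_const)
    then have "smooth_on (\<phi> ` (U \<inter> m g -` W)) (\<lambda>y. ?F ((\<psi> g, 0) + (0, y)))"
      by (rule smooth_on_compose[OF o _ _ s, rotated]) (use V(2) in force)
    then show ?thesis
    proof (rule smooth_on_cong[OF o, rotated])
      fix y assume "y \<in> \<phi> ` (U \<inter> m g -` W)"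
      then obtain x where x: "x \<in> U" "y = \<phi> x" by auto
      have "inv_into (V \<times> U) (map_prod \<psi> \<phi>) (\<psi> g, \<phi> x) = (g, x)"
        using inv_into_f_f[OF inj, of "(g, x)"] x V(2) by simp
      then show "?F ((\<psi> g, 0) + (0, y)) = (\<eta> \<circ> m g \<circ> inv_into U \<phi>) y"
        using x u(2) by simp
    qed
  qed
  then show ?thesis using c unfolding M smooth_map_def by auto
qed

section \<open>The Heisenberg group\<close>

lemma h3_bracket: "lie_bracket h3 x y = (x$1 * y$2 - x$2 * y$1) *\<^sub>R e3"
  by (simp add: h3_def lie3_def bracket3_def)

lemma bounded_bilinear_h3_bracket: "bounded_bilinear (lie_bracket h3)"
  unfolding bilinear_conv_bounded_bilinear[symmetric]
  by (auto simp: bilinear_def h3_bracket linear_iff algebra_simps scaleR_add_left[symmetric]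
      simp flip: scaleR_diff_left)

lemma H3_simps [simp]: "carrier H3 = UNIV" "\<one>\<^bsub>H3\<^esub> = 0" "mfd H3 = euclidean_manifold"
  "x \<otimes>\<^bsub>H3\<^esub> y = x + y + (1/2) *\<^sub>R lie_bracket h3 x y"
  by (simp_all add: H3_def)

text \<open>On a line through the origin an automorphism is additive and differentiable, so it agrees there
  with its differential at the origin.\<close>

lemma lie_auto_H3:
  assumes "\<alpha> \<in> lie_auto H3"
  shows "linear \<alpha>" "\<alpha> (lie_bracket h3 x y) = lie_bracket h3 (\<alpha> x) (\<alpha> y)"
proof -
  let ?b = "lie_bracket h3"
  have hom: "\<alpha> (x + y + (1/2) *\<^sub>R ?b x y) = \<alpha> x + \<alpha> y + (1/2) *\<^sub>R ?b (\<alpha> x) (\<alpha> y)" for x y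
    using assms by (auto simp: lie_auto_def auto_def hom_def)
  have anti: "?b y x = - ?b x y" for x y by (simp add: h3_bracket algebra_simps flip: scaleR_minus_left)
  have add: "\<alpha> ((s + t) *\<^sub>R x) = \<alpha> (s *\<^sub>R x) + \<alpha> (t *\<^sub>R x)" for s t x
  proof -
    have "?b (s *\<^sub>R x) (t *\<^sub>R x) = 0" "?b (t *\<^sub>R x) (s *\<^sub>R x) = 0" by (auto simp: h3_bracket)
    then have "\<alpha> ((s + t) *\<^sub>R x) = \<alpha> (s *\<^sub>R x) + \<alpha> (t *\<^sub>R x) + (1/2) *\<^sub>R ?b (\<alpha> (s *\<^sub>R x)) (\<alpha> (t *\<^sub>R x))"
      "\<alpha> ((s + t) *\<^sub>R x) = \<alpha> (t *\<^sub>R x) + \<alpha> (s *\<^sub>R x) + (1/2) *\<^sub>R ?b (\<alpha> (t *\<^sub>R x)) (\<alpha> (s *\<^sub>R x))"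
      using hom[of "s *\<^sub>R x" "t *\<^sub>R x"] hom[of "t *\<^sub>R x" "s *\<^sub>R x"] by (simp_all add: algebra_simps)
    \<comment> \<open>Multiples of \<open>x\<close> commute, so both orders of multiplication give
      the same image; in their sum the brackets of the images cancel.\<close>
    then have "2 *\<^sub>R \<alpha> ((s + t) *\<^sub>R x) = 2 *\<^sub>R (\<alpha> (s *\<^sub>R x) + \<alpha> (t *\<^sub>R x))"
      using anti[of "\<alpha> (s *\<^sub>R x)" "\<alpha> (t *\<^sub>R x)"] by (simp add: scaleR_2)
    then show ?thesis by simp
  qed
  have "smooth_on UNIV \<alpha>"
    using assms by (simp add: lie_auto_def smooth_map_euclidean_euclidean)
  then have D: "(\<alpha> has_derivative frechet_derivative \<alpha> (at 0)) (at 0)" (is "(_ has_derivative ?D) _")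
    by (rule smooth_on_derivative) simp
  have lin: "linear ?D" using D has_derivative_linear by blast
  have "\<alpha> x = ?D x" for x
  proof -
    have 0: "((\<lambda>s. \<alpha> (s *\<^sub>R x)) has_derivative (\<lambda>s. ?D (s *\<^sub>R x))) (at 0)"
      by (rule has_derivative_compose[of "\<lambda>s. s *\<^sub>R x" "\<lambda>s. s *\<^sub>R x", simplified])
        (use D in \<open>auto intro!: derivative_eq_intros\<close>)
    \<comment> \<open>Additivity along the line carries the derivative at 0 to every
      \<open>t\<close>.\<close>
    have "((\<lambda>s. \<alpha> (s *\<^sub>R x) - s *\<^sub>R ?D x) has_derivative (\<lambda>s. 0)) (at t within UNIV)" for t
    proof -
      have "((\<lambda>s. \<alpha> ((s - t) *\<^sub>R x)) has_derivative (\<lambda>s. ?D (s *\<^sub>R x))) (at t)"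
        by (rule has_derivative_compose[of "\<lambda>s. s - t" "\<lambda>s. s", simplified])
          (use 0 in \<open>auto intro!: derivative_eq_intros\<close>)
      then have "((\<lambda>s. \<alpha> ((s - t) *\<^sub>R x) + \<alpha> (t *\<^sub>R x) - s *\<^sub>R ?D x) has_derivative (\<lambda>s. ?D (s *\<^sub>R x) + 0 - s *\<^sub>R ?D x)) (at t)"
        by (intro has_derivative_diff has_derivative_add has_derivative_const)
          (auto intro!: derivative_eq_intros)
      moreover have "\<alpha> ((s - t) *\<^sub>R x) + \<alpha> (t *\<^sub>R x) = \<alpha> (s *\<^sub>R x)" for s
        using add[of "s - t" t x] by simp
      ultimately show ?thesis by (simp add: linear_scale[OF lin])
    qed
    from has_derivative_zero_unique[OF convex_UNIV this, of 1 0]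
    have "\<alpha> x - ?D x = \<alpha> 0" by simp
    moreover have "\<alpha> 0 = 0" using add[of 0 0 x] by simp
    ultimately show ?thesis by simp
  qed
  then have "\<alpha> = ?D" by auto
  then show l: "linear \<alpha>" using lin by simp
  show "\<alpha> (?b x y) = ?b (\<alpha> x) (\<alpha> y)"
    using hom[of x y] by (simp add: linear_add[OF l] linear_scale[OF l])
qed

lemma Aff_H3_simps:
  "carrier Aff_H3 = UNIV \<times> lie_auto H3"
  "(h, \<alpha>) \<otimes>\<^bsub>Aff_H3\<^esub> (k, \<beta>) = (h + \<alpha> k + (1/2) *\<^sub>R lie_bracket h3 h (\<alpha> k), \<alpha> \<circ> \<beta>)"
  by (auto simp: Aff_H3_def aff_group_def monoid.defs compose_def comp_def)

lemma aff_act_H3: "aff_act H3 p x = fst p + snd p x + (1/2) *\<^sub>R lie_bracket h3 (fst p) (snd p x)"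
  by (cases p) (simp add: aff_act_def)

text \<open>The single global chart turns smoothness into \<open>Aff_H3\<close> into smoothness of
  one vector-valued map, whose components can be taken apart by linear projections.\<close>

lemma smooth_map_Aff_H3:
  assumes "smooth_map M (mfd Aff_H3) \<rho>" "chart_atlas M" "\<rho> ` topspace (fst M) \<subseteq> carrier Aff_H3"
  shows "smooth_map M euclidean_manifold (aff_H3_chart \<circ> \<rho>)"
proof -
  obtain T A where M: "M = (T, A)" by fastforce
  have m: "mfd Aff_H3 = (pullback_topology (carrier (aff_group H3)) aff_H3_chart euclidean,
             {(carrier (aff_group H3), aff_H3_chart)})"
    by (simp add: Aff_H3_def monoid.defs)
  have c: "carrier (aff_group H3) = carrier Aff_H3" by (simp add: Aff_H3_def monoid.defs)
  have "continuous_map T (pullback_topology (carrier (aff_group H3)) aff_H3_chart euclidean) \<rho>"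
    using assms(1) by (simp add: smooth_map_def M m)
  moreover have "continuous_map (pullback_topology (carrier (aff_group H3)) aff_H3_chart euclidean)
      euclidean (id \<circ> aff_H3_chart)"
    by (intro continuous_map_pullback continuous_map_id)
  ultimately have "continuous_map T euclidean (aff_H3_chart \<circ> \<rho>)"
    by (simp add: continuous_map_compose)
  moreover have "smooth_on (\<phi> ` U) (aff_H3_chart \<circ> \<rho> \<circ> inv_into U \<phi>)" if "(U, \<phi>) \<in> A" for U \<phi>
  proof -
    have "U \<inter> \<rho> -` carrier Aff_H3 = U"
      using assms(3) chart_atlasD(4)[OF assms(2)[unfolded M] that] by (auto simp: M)
    then show ?thesis using assms(1) that by (auto simp: smooth_map_def M m c)
  qed
  ultimately show ?thesis by (auto simp: smooth_map_euclidean M)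
qed

section \<open>Smooth bijections onto Euclidean space\<close>

text \<open>Second countability enters here: it leaves countably many chart domains. Euclidean space
  with the discrete topology, covered by its points as 0-dimensional charts, shows what would go
  wrong otherwise.\<close>

lemma smooth_manifold_null_cover:
  fixes f :: "'a \<Rightarrow> 'b::euclidean_space"
  assumes M: "smooth_manifold (T, A)" and null: "\<And>U \<phi>. (U, \<phi>) \<in> A \<Longrightarrow> negligible (f ` U)"
  shows "negligible (f ` topspace T)"
proof -
  note at = smooth_manifold_chart_atlas[OF M]
  have "Lindelof_space T"
    using M by (auto simp: smooth_manifold_def intro: second_countable_imp_Lindelof_space)
  moreover have "\<Union>(fst ` A) = topspace T"
    using at by (auto simp: chart_atlas_def case_prod_unfold)
  moreover have "openin T U" if "U \<in> fst ` A" for U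
    using that chart_atlasD(1)[OF at] by auto
  ultimately obtain \<V> where V: "countable \<V>" "\<V> \<subseteq> fst ` A" "\<Union>\<V> = topspace T"
    using Lindelof_spaceD[of T "fst ` A"] by metis
  have "negligible (\<Union>((`) f ` \<V>))"
    using V null by (intro negligible_countable_Union) auto
  moreover have "f ` topspace T = \<Union>((`) f ` \<V>)"
    unfolding V(3)[symmetric] by (simp add: image_Union)
  ultimately show ?thesis by simp
qed

lemma negligible_singular_image:
  fixes f :: "real^'n::{finite,wellorder} \<Rightarrow> real^'n::{finite,wellorder}"
  assumes "smooth_on S f" "\<And>x. x \<in> S \<Longrightarrow> det (matrix (frechet_derivative f (at x))) = 0"
  shows "negligible (f ` S)"
proof (rule baby_Sard)
  show "(f has_derivative frechet_derivative f (at x)) (at x within S)" if "x \<in> S" for x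
    using smooth_on_derivative[OF assms(1) that] has_derivative_at_withinI by blast
  show "rank (matrix (frechet_derivative f (at x))) < CARD('n)" if "x \<in> S" for x
    using assms(2)[OF that] by (simp add: det_eq_0_rank)
qed simp

text \<open>If the dimension of the manifold were smaller, every chart domain would have a
  negligible image; if it were larger, a single chart would contradict invariance of
  dimension.\<close>

lemma smooth_bijection_dim_eq:
  fixes f :: "'a \<Rightarrow> 'b::euclidean_space" and A :: "('a set \<times> ('a \<Rightarrow> 'e::euclidean_space)) set"
  assumes M: "smooth_manifold (T, A)"
    and f: "smooth_map (T, A) euclidean_manifold f" "bij_betw f (topspace T) UNIV"
  shows "DIM('e) = DIM('b)"
proof -
  note at = smooth_manifold_chart_atlas[OF M]
  have s: "smooth_on (\<phi> ` U) (f \<circ> inv_into U \<phi>)" if "(U, \<phi>) \<in> A" for U \<phi>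
    using f(1) that by (auto simp: smooth_map_euclidean)
  have im: "(f \<circ> inv_into U \<phi>) ` \<phi> ` U = f ` U" if "(U, \<phi>) \<in> A" for U \<phi>
    using chart_atlasD(2)[OF at that] by (force simp: image_comp)
  have "\<not> DIM('e) < DIM('b)"
  proof
    assume d: "DIM('e) < DIM('b)"
    have "negligible (f ` U)" if U: "(U, \<phi>) \<in> A" for U \<phi>
      unfolding im[OF U, symmetric]
      by (rule negligible_differentiable_image_lowdim[OF d])
        (use smooth_on_derivative[OF s[OF U]] in
          \<open>auto simp: differentiable_on_def differentiable_def intro: has_derivative_at_withinI\<close>)
    then have "negligible (f ` topspace T)" by (rule smooth_manifold_null_cover[OF M])
    then show False using f(2) by (simp add: bij_betw_def)
  qed
  moreover have "DIM('e) \<le> DIM('b)"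
  proof -
    obtain x where "x \<in> topspace T" using f(2) by (metis UNIV_I bij_betw_def imageE)
    then obtain U \<phi> where U: "(U, \<phi>) \<in> A" "x \<in> U" using chart_atlas_cover[OF at] by blast
    note u = chart_atlasD[OF at U(1)]
    have "inj_on f U" using f(2) u(4) by (meson bij_betw_def inj_on_subset)
    then have "inj_on (f \<circ> inv_into U \<phi>) (\<phi> ` U)" using u(2) by (auto simp: inj_on_def)
    then show ?thesis
      using invariance_of_dimension[OF smooth_on_continuous[OF s[OF U(1)]]] u(3)[OF u(1)] U(2) by auto
  qed
  ultimately show ?thesis by simp
qed

text \<open>The inverse need not be smooth everywhere (cf. \<open>x \<mapsto> x\<^sup>3\<close>), but Sard's theorem gives one point at
  which \<open>f\<close> has an invertible derivative.\<close>

lemma smooth_bijection_inverse: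
  fixes f :: "'a \<Rightarrow> real^'n::{finite,wellorder}"
    and A :: "('a set \<times> ('a \<Rightarrow> 'e::euclidean_space)) set"
  assumes M: "smooth_manifold (T, A)"
    and f: "smooth_map (T, A) euclidean_manifold f" "bij_betw f (topspace T) UNIV"
    and g: "\<And>x. x \<in> topspace T \<Longrightarrow> g (f x) = x"
  shows "continuous_map euclidean T g"
    and "\<exists>U \<phi> N y. (U, \<phi>) \<in> A \<and> open N \<and> y \<in> N \<and> g ` N \<subseteq> U \<and> smooth_on N (\<phi> \<circ> g)"
proof -
  note at = smooth_manifold_chart_atlas[OF M]
  \<comment> \<open>The model space of the manifold is an arbitrary Euclidean space;
    \<open>j\<close> and \<open>k\<close> identify it with \<open>real^'n\<close>, where
    determinants make sense.\<close>
  have "DIM(real^'n::_) = DIM('e)" using smooth_bijection_dim_eq[OF M f] by simp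
  from isomorphisms_UNIV_UNIV[OF this] obtain j :: "real^'n::_ \<Rightarrow> 'e" and k
    where jk: "linear j" "linear k" "\<And>x. k (j x) = x" "\<And>y. j (k y) = y"
    by metis
  have bj: "bounded_linear j" "bounded_linear k" using jk by (simp_all add: linear_linear)
  have s: "smooth_on (\<phi> ` U) (f \<circ> inv_into U \<phi>)" if "(U, \<phi>) \<in> A" for U \<phi>
    using f(1) that by (auto simp: smooth_map_euclidean)
  let ?F = "\<lambda>U \<phi> x. f (inv_into U \<phi> (j x))"
  have op: "open (k ` \<phi> ` W)" if "(U, \<phi>) \<in> A" "openin T W" "W \<subseteq> U" for U W \<phi>
  proof -
    have "y \<in> k ` Z \<longleftrightarrow> j y \<in> Z" for y Z using jk(3,4) by (metis image_iff)
    then have "k ` \<phi> ` W = j -` \<phi> ` W" by blast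
    moreover have "open (\<phi> ` W)" using chart_atlasD(3)[OF at that(1-3)] .
    ultimately show ?thesis
      using continuous_open_vimage[of "\<phi> ` W" j] linear_continuous_at[OF bj(1)] by simp
  qed
  have F: "smooth_on (k ` \<phi> ` U) (?F U \<phi>)" if U: "(U, \<phi>) \<in> A" for U \<phi>
    using smooth_on_compose[OF op[OF U chart_atlasD(1)[OF at U] order_refl] _ smooth_on_linear[OF bj(1)] s[OF U]] jk(4)
    by (auto simp: comp_def)
  have Fim: "?F U \<phi> ` k ` \<phi> ` W = f ` W" if "(U, \<phi>) \<in> A" "W \<subseteq> U" for U \<phi> W
    using chart_atlasD(2)[OF at that(1)] jk(4) that(2) by (force simp: image_comp subset_iff)
  have Finj: "inj_on (?F U \<phi>) (k ` \<phi> ` U)" if U: "(U, \<phi>) \<in> A" for U \<phi>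
  proof -
    have "inj_on f U" using f(2) chart_atlasD(4)[OF at U] by (meson bij_betw_def inj_on_subset)
    then show ?thesis using chart_atlasD(2)[OF at U] jk by (auto simp: inj_on_def)
  qed
  have fop: "open (f ` W)" if U: "(U, \<phi>) \<in> A" and W: "openin T W" "W \<subseteq> U" for U \<phi> W
  proof -
    have "k ` \<phi> ` W \<subseteq> k ` \<phi> ` U" using W by blast
    then have "open (?F U \<phi> ` k ` \<phi> ` W)"
      by (intro invariance_of_domain op[OF U W] continuous_on_subset[OF smooth_on_continuous[OF F[OF U]]]
            inj_on_subset[OF Finj[OF U]])
    then show ?thesis using Fim[OF U W(2)] by simp
  qed
  have gpre: "g -` W = f ` W" if "W \<subseteq> topspace T" for W
  proof -
    have "x = f (g x)" "g x \<in> topspace T" for x using f(2) g by (metis UNIV_I bij_betw_def imageE)+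
    then show ?thesis using g that by force
  qed
  show c: "continuous_map euclidean T g"
    unfolding continuous_map_def
  proof (intro conjI allI impI)
    have "g x \<in> topspace T" for x using f(2) g by (metis UNIV_I bij_betw_def imageE)
    then show "g \<in> topspace euclidean \<rightarrow> topspace T" by simp
    fix W assume W: "openin T W"
    have Wt: "W \<subseteq> topspace T" using W openin_subset by blast
    have "\<exists>p\<in>A. x \<in> fst p" if "x \<in> W" for x
      using chart_atlas_cover[OF at, of x] Wt that by force
    then have "f ` W = (\<Union>p\<in>A. f ` (W \<inter> fst p))" by blast
    moreover have "open (f ` (W \<inter> U))" if "(U, \<phi>) \<in> A" for U \<phi>
      using fop[OF that openin_Int[OF W chart_atlasD(1)[OF at that]]] by simp
    ultimately have "open (f ` W)" by (simp add: open_UN split_paired_all)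
    then show "openin euclidean {x \<in> topspace euclidean. g x \<in> W}"
      using gpre[OF Wt] by (simp add: vimage_def)
  qed
  let ?d = "\<lambda>U \<phi> x. det (matrix (frechet_derivative (?F U \<phi>) (at x)))"
  have "\<exists>U \<phi> x. (U, \<phi>) \<in> A \<and> x \<in> k ` \<phi> ` U \<and> ?d U \<phi> x \<noteq> 0"
  proof (rule ccontr)
    assume c: "\<not> ?thesis"
    have "negligible (f ` U)" if U: "(U, \<phi>) \<in> A" for U \<phi>
      using negligible_singular_image[OF F[OF U]] c U Fim[OF U order_refl] by auto
    then have "negligible (f ` topspace T)" by (rule smooth_manifold_null_cover[OF M])
    then show False using f(2) by (simp add: bij_betw_def)
  qed
  then obtain U \<phi> x where U: "(U, \<phi>) \<in> A" and x: "x \<in> k ` \<phi> ` U" "?d U \<phi> x \<noteq> 0" by blast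
  note u = chart_atlasD[OF at U]
  \<comment> \<open>\<open>?S'\<close> is the open set of regular points in this chart; its image is
    the neighborhood \<open>N\<close> of the conclusion.\<close>
  let ?S = "k ` \<phi> ` U" and ?S' = "{x \<in> k ` \<phi> ` U. ?d U \<phi> x \<noteq> 0}"
  have oS: "open ?S" by (rule op[OF U u(1) order_refl])
  have "smooth_on ?S (?d U \<phi>)"
    by (intro smooth_on_det oS) (simp add: matrix_def smooth_on_nth oS smooth_on_frechet_derivative F[OF U])
  then have "open (?d U \<phi> -` (- {0}) \<inter> ?S)"
    using continuous_on_open_vimage[OF oS, THEN iffD1, OF smooth_on_continuous] by blast
  moreover have "?d U \<phi> -` (- {0}) \<inter> ?S = ?S'" by auto
  ultimately have oS': "open ?S'" by simp
  have sub: "?S' \<subseteq> ?S" by blast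
  have oN: "open (?F U \<phi> ` ?S')"
    by (rule invariance_of_domain[OF continuous_on_subset[OF smooth_on_continuous[OF F[OF U]] sub] oS'
          inj_on_subset[OF Finj[OF U] sub]])
  have gF: "k (\<phi> (g (?F U \<phi> x))) = x" "g (?F U \<phi> x) \<in> U" if "x \<in> ?S" for x
    using that u(2,4) g jk by auto
  obtain h where h: "homeomorphism ?S' (?F U \<phi> ` ?S') (?F U \<phi>) h"
    by (rule invariance_of_domain_homeomorphism[OF oS' continuous_on_subset[OF smooth_on_continuous[OF F[OF U]] sub]
        order_refl inj_on_subset[OF Finj[OF U] sub]])
  have "continuous_on (?F U \<phi> ` ?S') (\<lambda>y. k (\<phi> (g y)))"
    using homeomorphism_cont2[OF h]
    by (rule continuous_on_eq) (use homeomorphism_apply1[OF h] gF in auto)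
  then have "smooth_on (?F U \<phi> ` ?S') (\<lambda>y. k (\<phi> (g y)))"
    by (intro smooth_on_inverse_function[OF oS' oN smooth_on_subset[OF F[OF U] sub]]) (use gF in auto)
  from smooth_on_linear_compose[OF bj(1) oN this]
  have "smooth_on (?F U \<phi> ` ?S') (\<phi> \<circ> g)" by (simp add: jk comp_def)
  moreover have "g ` ?F U \<phi> ` ?S' \<subseteq> U" using gF by auto
  ultimately show "\<exists>U \<phi> N y. (U, \<phi>) \<in> A \<and> open N \<and> y \<in> N \<and> g ` N \<subseteq> U \<and> smooth_on N (\<phi> \<circ> g)"
    using U x oN by blast
qed

section \<open>Hadamard's lemma\<close>

text \<open>By the chain rule, each differentiation under the integral produces a factor
  \<open>t\<close>. The weight \<open>t ^ m\<close> makes the family closed under this, so the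
  induction is over all \<open>m\<close> and \<open>H\<close>.\<close>

lemma smooth_on_integral_param:
  fixes H :: "'a::euclidean_space \<Rightarrow> real"
  assumes "smooth_on UNIV H"
  shows "smooth_on UNIV (\<lambda>y. integral {0..1} (\<lambda>t. t ^ m * H (t *\<^sub>R y)))"
proof -
  have cont: "continuous_on (UNIV \<times> {0..1}) (\<lambda>(y, t). t ^ m * H (t *\<^sub>R y))"
    if "smooth_on UNIV H" for H :: "'a \<Rightarrow> real" and m
  proof -
    have "continuous_on UNIV H" using that by (rule smooth_on_continuous)
    then have "continuous_on (UNIV \<times> {0..1}) (\<lambda>p. H (snd p *\<^sub>R fst p))"
      by (rule continuous_on_compose2) (auto intro!: continuous_intros)
    then show ?thesis by (auto simp: case_prod_unfold intro!: continuous_intros)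
  qed
  have "C_k k UNIV (\<lambda>y. integral {0..1} (\<lambda>t. t ^ m * H (t *\<^sub>R y)))"
    if "smooth_on UNIV H" for H :: "'a \<Rightarrow> real" and k m
    using that
  proof (induction k arbitrary: H m)
    case 0
    show ?case using integral_continuous_on_param[of UNIV 0 1 "\<lambda>y t. t ^ m * H (t *\<^sub>R y)"] cont[OF 0] by simp
  next
    case (Suc k)
    let ?H' = "\<lambda>y. frechet_derivative H (at y)"
    have D: "(H has_derivative ?H' y) (at y)" for y by (rule smooth_on_derivative[OF Suc.prems]) simp
    have bl: "bounded_linear (?H' y)" for y using D has_derivative_bounded_linear by blast
    \<comment> \<open>\<open>leibniz_rule\<close> asks for the derivative as a continuous family of
      bounded linear maps; continuity is then checked on basis vectors.\<close>
    define fx where "fx = (\<lambda>y t. t ^ Suc m *\<^sub>R Blinfun (?H' (t *\<^sub>R y)))"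
    have fx: "blinfun_apply (fx y t) v = t ^ Suc m * ?H' (t *\<^sub>R y) v" for y t v
      by (simp add: fx_def blinfun.scaleR_left bounded_linear_Blinfun_apply[OF bl])
    have d: "((\<lambda>y. t ^ m * H (t *\<^sub>R y)) has_derivative blinfun_apply (fx y t)) (at y within UNIV)" for y t
    proof -
      have "((\<lambda>y. H (t *\<^sub>R y)) has_derivative (\<lambda>v. ?H' (t *\<^sub>R y) (t *\<^sub>R v))) (at y)"
        by (rule has_derivative_compose[OF _ D]) (auto intro!: derivative_eq_intros)
      then have "((\<lambda>y. t ^ m * H (t *\<^sub>R y)) has_derivative (\<lambda>v. t ^ m * ?H' (t *\<^sub>R y) (t *\<^sub>R v))) (at y)"
        by (rule has_derivative_mult_right)
      moreover have "(\<lambda>v. t ^ m * ?H' (t *\<^sub>R y) (t *\<^sub>R v)) = blinfun_apply (fx y t)"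
        by (auto simp: fx fun_eq_iff linear_scale[OF bounded_linear.linear[OF bl]])
      ultimately show ?thesis by simp
    qed
    have cH: "continuous_on (UNIV \<times> {0..1}) (\<lambda>(y, t). t ^ Suc m * ?H' (t *\<^sub>R y) v)" for v
      by (rule cont[OF smooth_on_frechet_derivative[OF Suc.prems]])
    have cfx: "continuous_on (UNIV \<times> cbox 0 1) (\<lambda>(y, t). fx y t)"
    proof (rule continuous_on_blinfun_componentwise)
      fix i :: 'a
      show "continuous_on (UNIV \<times> cbox 0 1) (\<lambda>p. blinfun_apply (case p of (y, t) \<Rightarrow> fx y t) i)"
        using cH[of i] by (simp add: case_prod_unfold fx)
    qed
    have ifx: "blinfun_apply (integral {0..1} (fx y)) v = integral {0..1} (\<lambda>t. t ^ Suc m * ?H' (t *\<^sub>R y) v)" for y v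
    proof -
      have "continuous_on {0..1} (\<lambda>t. (\<lambda>(y, t). fx y t) (y, t))"
        by (rule continuous_on_compose2[OF cfx]) (auto intro!: continuous_intros)
      then have "fx y integrable_on {0..1}"
        by (intro integrable_continuous_real) simp
      then show ?thesis
        using integral_linear[of "fx y" "{0..1}" "\<lambda>b. blinfun_apply b v"]
        by (simp add: comp_def fx blinfun.bounded_linear_left)
    qed
    have int: "(\<lambda>t. t ^ m * H (t *\<^sub>R y)) integrable_on cbox 0 1" for y
    proof -
      have "continuous_on {0..1} (\<lambda>t. (\<lambda>(y, t). t ^ m * H (t *\<^sub>R y)) (y, t))"
        by (rule continuous_on_compose2[OF cont[OF Suc.prems]]) (auto intro!: continuous_intros)
      then show ?thesis by (auto intro: integrable_continuous_real)
    qed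
    have "((\<lambda>y. integral {0..1} (\<lambda>t. t ^ m * H (t *\<^sub>R y))) has_derivative
        (\<lambda>v. integral {0..1} (\<lambda>t. t ^ Suc m * ?H' (t *\<^sub>R y) v))) (at y)" for y
    proof -
      have "blinfun_apply (integral {0..1} (fx y)) = (\<lambda>v. integral {0..1} (\<lambda>t. t ^ Suc m * ?H' (t *\<^sub>R y) v))"
        using ifx by blast
      then show ?thesis
        using leibniz_rule[OF d int cfx, of y] by (simp only: cbox_interval UNIV_I convex_UNIV)
    qed
    moreover have "C_k k UNIV (\<lambda>y. integral {0..1} (\<lambda>t. t ^ Suc m * ?H' (t *\<^sub>R y) v))" for v
      by (rule Suc.IH[OF smooth_on_frechet_derivative[OF Suc.prems]])
    ultimately show ?case by (rule C_k_Suc_I[OF open_UNIV])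
  qed
  then show ?thesis using assms by (simp add: smooth_on_def)
qed

text \<open>The fundamental theorem of calculus along the segment from 0 to \<open>y\<close>. That
  the \<open>H b\<close> are smooth matters: a derivation of the algebra of smooth functions can
  then be applied to both sides.\<close>

lemma Hadamard_lemma:
  fixes F :: "'a::euclidean_space \<Rightarrow> real"
  assumes "smooth_on UNIV F"
  obtains H where "\<And>b. smooth_on UNIV (H b)" "\<And>b. H b 0 = frechet_derivative F (at 0) b"
    "\<And>y. F y = F 0 + (\<Sum>b\<in>Basis. (y \<bullet> b) * H b y)"
proof
  let ?F' = "\<lambda>y. frechet_derivative F (at y)"
  let ?H = "\<lambda>b y. integral {0..1} (\<lambda>t. ?F' (t *\<^sub>R y) b)"
  have D: "(F has_derivative ?F' y) (at y)" for y by (rule smooth_on_derivative[OF assms]) simp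
  have s: "smooth_on UNIV (\<lambda>y. ?F' y b)" for b by (rule smooth_on_frechet_derivative[OF assms])
  show "smooth_on UNIV (?H b)" for b
    using smooth_on_integral_param[OF s, of 0] by simp
  show "?H b 0 = ?F' 0 b" for b by simp
  show "F y = F 0 + (\<Sum>b\<in>Basis. (y \<bullet> b) * ?H b y)" for y
  proof -
    have d: "((\<lambda>t. F (t *\<^sub>R y)) has_vector_derivative ?F' (t *\<^sub>R y) y) (at t within {0..1})" for t
    proof -
      have "((\<lambda>t. F (t *\<^sub>R y)) has_derivative (\<lambda>s. ?F' (t *\<^sub>R y) (s *\<^sub>R y))) (at t within {0..1})"
        by (rule has_derivative_compose[OF _ D]) (auto intro!: derivative_eq_intros)
      then show ?thesis
        using linear_scale[OF has_derivative_linear[OF D]] by (simp add: has_vector_derivative_def)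
    qed
    have "((\<lambda>t. ?F' (t *\<^sub>R y) y) has_integral F (1 *\<^sub>R y) - F (0 *\<^sub>R y)) {0..1}"
      by (rule fundamental_theorem_of_calculus[OF _ d]) auto
    then have 1: "integral {0..1} (\<lambda>t. ?F' (t *\<^sub>R y) y) = F y - F 0" by (simp add: integral_unique)
    have "?F' x y = (\<Sum>b\<in>Basis. (y \<bullet> b) * ?F' x b)" for x
    proof -
      have l: "linear (?F' x)" using has_derivative_linear[OF D] .
      have "?F' x y = ?F' x (\<Sum>b\<in>Basis. (y \<bullet> b) *\<^sub>R b)" by (simp add: euclidean_representation)
      also have "\<dots> = (\<Sum>b\<in>Basis. (y \<bullet> b) * ?F' x b)"
        by (simp add: linear_sum[OF l] linear_scale[OF l])
      finally show ?thesis .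
    qed
    then have "F y - F 0 = integral {0..1} (\<lambda>t. \<Sum>b\<in>Basis. (y \<bullet> b) * ?F' (t *\<^sub>R y) b)"
      using 1 by simp
    also have "\<dots> = (\<Sum>b\<in>Basis. (y \<bullet> b) * ?H b y)"
    proof (subst integral_sum)
      show "(\<lambda>t. (y \<bullet> b) * ?F' (t *\<^sub>R y) b) integrable_on {0..1}" for b
        by (intro integrable_continuous_real continuous_intros
            continuous_on_compose2[OF smooth_on_continuous[OF s]]) auto
    qed auto
    finally show ?thesis by simp
  qed
qed

section \<open>Simply transitive affine groups on the Heisenberg group\<close>

text \<open>What is needed of \<open>G\<close>, in the coordinates of the orbit map:
  \<open>al x\<close> is the automorphism part of the affine map from the group that sends 0 to
  \<open>x\<close>. By \<open>al_mul\<close>, \<open>al\<close> is a homomorphism for the very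
  product \<open>mul\<close> that it defines.\<close>

locale simply_transitive_affine =
  fixes al :: "real^3 \<Rightarrow> real^3 \<Rightarrow> real^3" and iv :: "real^3 \<Rightarrow> real^3"
    and mul :: "real^3 \<Rightarrow> real^3 \<Rightarrow> real^3"
  assumes mul_def: "mul x y = x + al x y + (1/2) *\<^sub>R lie_bracket h3 x (al x y)"
    and linear_al: "linear (al x)"
    and al_bracket: "al x (lie_bracket h3 u w) = lie_bracket h3 (al x u) (al x w)"
    and al_zero: "al 0 u = u"
    and al_mul: "al (mul x y) u = al x (al y u)"
    and smooth_al: "smooth_on UNIV (\<lambda>x. al x u)"
    and smooth_iv: "smooth_on UNIV iv"
    and mul_iv: "mul x (iv x) = 0" "mul (iv x) x = 0"
begin

abbreviation hb :: "real^3 \<Rightarrow> real^3 \<Rightarrow> real^3" where "hb \<equiv> lie_bracket h3"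

lemmas hb_simps = bounded_bilinear.add_left[OF bounded_bilinear_h3_bracket]
  bounded_bilinear.add_right[OF bounded_bilinear_h3_bracket]
  bounded_bilinear.scaleR_left[OF bounded_bilinear_h3_bracket]
  bounded_bilinear.scaleR_right[OF bounded_bilinear_h3_bracket]
  bounded_bilinear.diff_left[OF bounded_bilinear_h3_bracket]
  bounded_bilinear.diff_right[OF bounded_bilinear_h3_bracket]
  bounded_bilinear.zero_left[OF bounded_bilinear_h3_bracket]
  bounded_bilinear.zero_right[OF bounded_bilinear_h3_bracket]

lemma hb_hb: "hb x (hb u w) = 0" "hb (hb u w) x = 0"
  by (auto simp: h3_bracket axis_def)

definition A :: "real^3 \<Rightarrow> real^3 \<Rightarrow> real^3" where
  "A x y = al x y + (1/2) *\<^sub>R hb x (al x y)"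

lemma mul_A: "mul x y = x + A x y" by (simp add: mul_def A_def)

lemma linear_A: "linear (A x)"
  by (rule linearI)
    (simp_all add: A_def linear_add[OF linear_al] linear_scale[OF linear_al] hb_simps scaleR_add_right)

lemma A_zero [simp]: "A x 0 = 0" "A 0 x = x"
  using linear_0[OF linear_A] by (auto simp: A_def al_zero hb_simps)

lemma mul_zero [simp]: "mul x 0 = x" "mul 0 x = x"
  by (simp_all add: mul_A)

text \<open>Both sides agree because brackets with brackets vanish (\<open>hb_hb\<close>).
  Associativity of \<open>mul\<close> is deduced from this.\<close>

lemma A_mul: "A (mul x y) z = A x (A y z)"
proof -
  have "A (mul x y) z = al x (al y z) + (1/2) *\<^sub>R hb (mul x y) (al x (al y z))"
    by (simp add: A_def al_mul)
  then show ?thesis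
    by (simp add: mul_def A_def hb_simps hb_hb linear_add[OF linear_al] linear_scale[OF linear_al]
      al_bracket scaleR_add_right)
qed

lemma mul_assoc: "mul (mul x y) z = mul x (mul y z)"
proof -
  have "mul (mul x y) z = mul x y + A x (A y z)" by (simp only: mul_A[of "mul x y"] A_mul)
  moreover have "mul x (mul y z) = x + (A x y + A x (A y z))"
    by (simp only: mul_A linear_add[OF linear_A])
  ultimately show ?thesis by (simp add: mul_A)
qed

lemma smooth_A: "smooth_on UNIV (\<lambda>x. A x u)"
  unfolding A_def
  by (intro smooth_on_add smooth_on_linear_compose[OF bounded_linear_scaleR_right]
      smooth_on_bilinear[OF bounded_bilinear_h3_bracket] smooth_al open_UNIV
      smooth_on_linear bounded_linear_ident)

definition \<delta> :: "real^3 \<Rightarrow> real^3 \<Rightarrow> real^3" where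
  "\<delta> v u = frechet_derivative (\<lambda>x. al x u) (at 0) v"

lemma al_derivative_0: "((\<lambda>x. al x u) has_derivative (\<lambda>v. \<delta> v u)) (at 0)"
  using smooth_on_derivative[OF smooth_al, of 0] by (simp add: \<delta>_def)

lemma linear_\<delta>1: "linear (\<lambda>v. \<delta> v u)"
  by (rule has_derivative_linear[OF al_derivative_0])

lemma \<delta>_eqI:
  "((\<lambda>x. al x u) has_derivative D) (at 0) \<Longrightarrow> \<delta> v u = D v"
  using has_derivative_unique[OF al_derivative_0] by metis

lemma linear_\<delta>2: "linear (\<delta> v)"
proof (rule linearI)
  show "\<delta> v (u + w) = \<delta> v u + \<delta> v w" for u w
    by (rule \<delta>_eqI[of _ "\<lambda>v. \<delta> v u + \<delta> v w"])
      (simp add: linear_add[OF linear_al] has_derivative_add al_derivative_0)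
  show "\<delta> v (c *\<^sub>R u) = c *\<^sub>R \<delta> v u" for c u
    by (rule \<delta>_eqI[of _ "\<lambda>v. c *\<^sub>R \<delta> v u"])
      (simp add: linear_scale[OF linear_al] has_derivative_scaleR_right al_derivative_0)
qed

lemma \<delta>_derivation: "\<delta> v (hb u w) = hb (\<delta> v u) w + hb u (\<delta> v w)"
proof (rule \<delta>_eqI[of _ "\<lambda>v. hb (\<delta> v u) w + hb u (\<delta> v w)"])
  show "((\<lambda>x. al x (hb u w)) has_derivative (\<lambda>v. hb (\<delta> v u) w + hb u (\<delta> v w))) (at 0)"
    unfolding al_bracket
    using bounded_bilinear.FDERIV[OF bounded_bilinear_h3_bracket al_derivative_0[of u] al_derivative_0[of w]]
    by (simp add: al_zero add.commute)
qed

definition L :: "real^3 \<Rightarrow> real^3 \<Rightarrow> real^3" where "L v u = \<delta> v u + (1/2) *\<^sub>R hb v u"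

lemma linear_L: "linear (\<lambda>v. L v u)" "linear (L v)"
  by (auto intro!: linearI simp: L_def hb_simps scaleR_add_right linear_add[OF linear_\<delta>1] linear_add[OF linear_\<delta>2]
      linear_scale[OF linear_\<delta>1] linear_scale[OF linear_\<delta>2])

lemma A_derivative_0: "((\<lambda>x. A x u) has_derivative (\<lambda>v. L v u)) (at 0)"
proof -
  have "((\<lambda>x. al x u + (1/2) *\<^sub>R hb x (al x u)) has_derivative
     (\<lambda>v. \<delta> v u + (1/2) *\<^sub>R (hb 0 (\<delta> v u) + hb v (al 0 u)))) (at 0)"
    by (intro has_derivative_add al_derivative_0 has_derivative_scaleR_right
        bounded_bilinear.FDERIV[OF bounded_bilinear_h3_bracket] has_derivative_ident)
  then show ?thesis by (simp add: A_def L_def al_zero hb_simps)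
qed

text \<open>\<open>L\<close> contains half of the Heisenberg bracket. Antisymmetrizing restores the
  whole: this is \<open>hb v w + \<delta> v w - \<delta> w v\<close>.\<close>

definition br :: "real^3 \<Rightarrow> real^3 \<Rightarrow> real^3" where "br v w = L v w - L w v"

lemma mul_right_derivative_0: "((\<lambda>x. mul x w) has_derivative (\<lambda>v. v + L v w)) (at 0)"
  unfolding mul_A by (intro has_derivative_add has_derivative_ident A_derivative_0)

lemma mul_left_derivative: "((\<lambda>y. mul a y) has_derivative A a) (at y)"
  unfolding mul_A
  using linear_imp_has_derivative[OF linear_A] by (auto intro!: derivative_eq_intros)

text \<open>Right translation by \<open>iv w\<close> undoes right translation by \<open>w\<close>,
  so its differential at \<open>w\<close> is a left inverse of
  \<open>v \<mapsto> v + L v w\<close>.\<close>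

lemma right_mult_injective:
  assumes "v + L v w = 0" shows "v = 0"
proof -
  have s: "smooth_on UNIV (\<lambda>x. mul x (iv w))"
    unfolding mul_A by (intro smooth_on_add smooth_A smooth_on_linear bounded_linear_ident open_UNIV)
  then obtain D where D: "((\<lambda>x. mul x (iv w)) has_derivative D) (at w)"
    using smooth_on_derivative by blast
  then have "((\<lambda>x. mul x (iv w)) has_derivative D) (at (mul 0 w))" by simp
  from has_derivative_compose[OF mul_right_derivative_0 this]
  have "((\<lambda>x. x) has_derivative (\<lambda>v. D (v + L v w))) (at 0)"
    by (simp add: mul_assoc mul_iv)
  then have "(\<lambda>v. D (v + L v w)) = (\<lambda>v. v)"
    using has_derivative_unique has_derivative_ident by blast
  then have "D (v + L v w) = v" by metis
  then show ?thesis using assms linear_0[OF has_derivative_linear[OF D]] by simp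
qed

definition X :: "real^3 \<Rightarrow> (real^3 \<Rightarrow> 'b::real_normed_vector) \<Rightarrow> real^3 \<Rightarrow> 'b" where
  "X v F a = frechet_derivative F (at a) (A a v)"

text \<open>A field is evaluated at \<open>a\<close> by differentiating at 0 after left translation
  by \<open>a\<close>. Identities for \<open>mul\<close> and \<open>al\<close> thus give values of
  \<open>X\<close> from derivatives at 0 alone.\<close>

lemma X_eqI:
  assumes "smooth_on UNIV F" "((\<lambda>y. F (mul a y)) has_derivative D) (at 0)"
  shows "X v F a = D v"
proof -
  have "(F has_derivative frechet_derivative F (at a)) (at (mul a 0))"
    using smooth_on_derivative[OF assms(1), of a] by simp
  from has_derivative_compose[OF mul_left_derivative this]
  show ?thesis using has_derivative_unique[OF assms(2)] by (simp add: X_def)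
qed

lemma X_smooth:
  fixes F :: "real^3 \<Rightarrow> real"
  assumes "smooth_on UNIV F" shows "smooth_on UNIV (X v F)"
proof -
  have "X v F = (\<lambda>a. \<Sum>b\<in>Basis. (A a v \<bullet> b) * frechet_derivative F (at a) b)"
  proof
    fix a
    have l: "linear (frechet_derivative F (at a))"
      using smooth_on_derivative[OF assms] has_derivative_linear by blast
    have "X v F a = frechet_derivative F (at a) (\<Sum>b\<in>Basis. (A a v \<bullet> b) *\<^sub>R b)"
      by (simp add: euclidean_representation X_def)
    also have "\<dots> = (\<Sum>b\<in>Basis. (A a v \<bullet> b) * frechet_derivative F (at a) b)"
      by (simp add: linear_sum[OF l] linear_scale[OF l])
    finally show "X v F a = (\<Sum>b\<in>Basis. (A a v \<bullet> b) * frechet_derivative F (at a) b)" .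
  qed
  then show ?thesis
    by (auto intro!: smooth_on_sum smooth_on_mult smooth_on_frechet_derivative assms
        smooth_on_linear_compose[OF bounded_linear_inner_left] smooth_A)
qed

lemma smooth_mul_left: "smooth_on UNIV (mul a)"
proof -
  have "bounded_linear (A a)" using linear_A by (rule linear_linear[THEN iffD2])
  then have "smooth_on UNIV (\<lambda>x. a + A a x)"
    by (intro smooth_on_add smooth_on_const smooth_on_linear open_UNIV)
  then show ?thesis by (simp add: mul_A[abs_def])
qed

lemma smooth_translate:
  "smooth_on UNIV F \<Longrightarrow> smooth_on UNIV (\<lambda>x. F (mul a x))"
  by (rule smooth_on_compose[OF open_UNIV _ smooth_mul_left]) auto

lemma smooth_coord: "smooth_on UNIV (\<lambda>x::real^3. x $ i)"
  by (rule smooth_on_linear) (rule bounded_linear_vec_nth)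

lemma X_coord: "X v (\<lambda>x. x $ i) a = A a v $ i"
  by (rule X_eqI[OF smooth_coord, where D = "\<lambda>v. A a v $ i"])
    (use mul_left_derivative bounded_linear.has_derivative[OF bounded_linear_vec_nth] in blast)

text \<open>Only values on smooth functions are constrained. That \<open>D F\<close> is again smooth
  is a consequence, by \<open>left_inv_derivation_eq_X\<close> and \<open>X_smooth\<close>.\<close>

definition left_inv_derivation :: "((real^3 \<Rightarrow> real) \<Rightarrow> (real^3 \<Rightarrow> real)) \<Rightarrow> bool" where
  "left_inv_derivation D \<longleftrightarrow>
    (\<forall>F H b c. smooth_on UNIV F \<longrightarrow> smooth_on UNIV H \<longrightarrow>
      D (\<lambda>x. b * F x + c * H x) = (\<lambda>x. b * D F x + c * D H x)) \<and>
    (\<forall>F H. smooth_on UNIV F \<longrightarrow> smooth_on UNIV H \<longrightarrow>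
      D (\<lambda>x. F x * H x) = (\<lambda>x. D F x * H x + F x * D H x)) \<and>
    (\<forall>F a. smooth_on UNIV F \<longrightarrow> D (\<lambda>x. F (mul a x)) = (\<lambda>x. D F (mul a x)))"

lemma left_inv_derivation_X: "left_inv_derivation (X v)"
proof -
  have d: "((\<lambda>y. F (mul a y)) has_derivative (\<lambda>v. X v F a)) (at 0)"
    if "smooth_on UNIV F" for F :: "real^3 \<Rightarrow> real" and a
  proof -
    have "(F has_derivative frechet_derivative F (at a)) (at (mul a 0))"
      using smooth_on_derivative[OF that, of a] by simp
    from has_derivative_compose[OF mul_left_derivative this] show ?thesis by (simp add: X_def)
  qed
  show ?thesis
    unfolding left_inv_derivation_def
  proof (intro conjI allI impI ext)
    fix F H :: "real^3 \<Rightarrow> real" and a b c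
    assume F: "smooth_on UNIV F" and H: "smooth_on UNIV H"
    show "X v (\<lambda>x. b * F x + c * H x) a = b * X v F a + c * X v H a"
      by (rule X_eqI[of _ _ "\<lambda>v. b * X v F a + c * X v H a"])
        (auto intro!: smooth_on_add smooth_on_mult F H has_derivative_add has_derivative_mult_right d)
    show "X v (\<lambda>x. F x * H x) a = X v F a * H a + F a * X v H a"
      using has_derivative_mult[OF d[OF F, of a] d[OF H, of a]]
      by (intro X_eqI[of _ _ "\<lambda>v. X v F a * H a + F a * X v H a"])
        (auto intro!: smooth_on_mult F H simp: algebra_simps)
  next
    fix F :: "real^3 \<Rightarrow> real" and a x
    assume F: "smooth_on UNIV F"
    show "X v (\<lambda>x. F (mul a x)) x = X v F (mul a x)"
      by (rule X_eqI[of _ _ "\<lambda>v. X v F (mul a x)"])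
        (use smooth_translate[OF F] d[OF F, of "mul a x"] in \<open>auto simp: mul_assoc\<close>)
  qed
qed

text \<open>Invariance reduces the claim to the point 0. There Hadamard's lemma and the Leibniz rule
  leave a directional derivative, whose direction is found by applying \<open>D\<close> to the
  coordinate functions.\<close>

lemma left_inv_derivation_eq_X:
  assumes D: "left_inv_derivation D" and F: "smooth_on UNIV F"
  shows "D F = X (\<chi> i. D (\<lambda>x. x $ i) 0) F"
proof -
  have lin: "D (\<lambda>x. b * F x + c * H x) = (\<lambda>x. b * D F x + c * D H x)"
    if "smooth_on UNIV F" "smooth_on UNIV H" for F H b c
    using D that by (simp add: left_inv_derivation_def)
  have leib: "D (\<lambda>x. F x * H x) = (\<lambda>x. D F x * H x + F x * D H x)"
    if "smooth_on UNIV F" "smooth_on UNIV H" for F H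
    using D that by (simp add: left_inv_derivation_def)
  let ?v = "(\<chi> i. D (\<lambda>x. x $ i) 0) :: real^3"
  have D1: "D (\<lambda>x. 1) 0 = 0"
    using leib[of "\<lambda>x. 1" "\<lambda>x. 1"] by (auto simp: smooth_on_const fun_eq_iff)
  have D0: "D (\<lambda>x. c) 0 = 0" for c
    using lin[of "\<lambda>x. 1" "\<lambda>x. 1" c 0] D1 by (simp add: smooth_on_const fun_eq_iff)
  have add: "D (\<lambda>x. F x + H x) 0 = D F 0 + D H 0" if "smooth_on UNIV F" "smooth_on UNIV H" for F H
    using lin[OF that, of 1 1] by (simp add: fun_eq_iff)
  have sum: "D (\<lambda>x. \<Sum>i\<in>I. f i x) 0 = (\<Sum>i\<in>I. D (f i) 0)"
    if "finite I" "\<And>i. smooth_on UNIV (f i)" for f :: "'i \<Rightarrow> real^3 \<Rightarrow> real" and I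
    using that(1)
  proof induction
    case empty
    show ?case using D0[of 0] by simp
  next
    case (insert j I)
    have "D (\<lambda>x. f j x + (\<Sum>i\<in>I. f i x)) 0 = D (f j) 0 + D (\<lambda>x. \<Sum>i\<in>I. f i x) 0"
      by (intro add smooth_on_sum that(2) open_UNIV)
    then show ?case using insert by simp
  qed
  have at0: "D F 0 = frechet_derivative F (at 0) ?v" if F: "smooth_on UNIV F" for F
  proof -
    obtain H where H: "\<And>b. smooth_on UNIV (H b)" "\<And>b. H b 0 = frechet_derivative F (at 0) b"
      "\<And>y. F y = F 0 + (\<Sum>b\<in>Basis. (y \<bullet> b) * H b y)"
      by (rule Hadamard_lemma[OF F, where thesis = thesis]) (rule that)
    have sb: "smooth_on UNIV (\<lambda>y. (y \<bullet> b) * H b y)" for b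
      by (intro smooth_on_mult H smooth_on_linear bounded_linear_inner_left open_UNIV)
    have "F = (\<lambda>y. F 0 + (\<Sum>b\<in>Basis. (y \<bullet> b) * H b y))" by (rule ext) (rule H(3))
    then have "D F 0 = D (\<lambda>y. F 0 + (\<Sum>b\<in>Basis. (y \<bullet> b) * H b y)) 0"
      by (rule arg_cong[of _ _ "\<lambda>F. D F 0"])
    also have "\<dots> = D (\<lambda>y. F 0) 0 + D (\<lambda>y. \<Sum>b\<in>Basis. (y \<bullet> b) * H b y) 0"
      by (intro add smooth_on_sum smooth_on_const sb open_UNIV)
    also have "\<dots> = (\<Sum>b\<in>Basis. D (\<lambda>y. (y \<bullet> b) * H b y) 0)"
      using sum[of Basis "\<lambda>b y. (y \<bullet> b) * H b y"] sb D0 by simp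
    \<comment> \<open>\<open>y \<bullet> b\<close> vanishes at 0, so only one of the two Leibniz
      terms survives.\<close>
    also have "\<dots> = (\<Sum>b\<in>Basis. D (\<lambda>y. y \<bullet> b) 0 * frechet_derivative F (at 0) b)"
      by (subst leib) (auto simp: H smooth_on_linear bounded_linear_inner_left)
    also have "\<dots> = (\<Sum>b\<in>Basis. (?v \<bullet> b) * frechet_derivative F (at 0) b)"
      by (intro sum.cong refl) (auto simp: Basis_vec_def inner_axis)
    also have "\<dots> = frechet_derivative F (at 0) (\<Sum>b\<in>Basis. (?v \<bullet> b) *\<^sub>R b)"
    proof -
      have l: "linear (frechet_derivative F (at 0))"
        using smooth_on_derivative[OF F] has_derivative_linear by blast
      show ?thesis by (simp add: linear_sum[OF l] linear_scale[OF l])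
    qed
    finally show ?thesis by (simp only: euclidean_representation)
  qed
  show ?thesis
  proof
    fix a
    have "D F a = D (\<lambda>x. F (mul a x)) 0"
      using D F by (simp add: left_inv_derivation_def)
    also have "\<dots> = X ?v (\<lambda>x. F (mul a x)) 0" by (simp add: at0 smooth_translate F X_def)
    also have "\<dots> = X ?v F a" using left_inv_derivation_X[of ?v] F by (simp add: left_inv_derivation_def)
    finally show "D F a = X ?v F a" .
  qed
qed

text \<open>The bracket is again a left-invariant derivation, so it suffices to evaluate it on the coordinate
  functions, whose second derivatives vanish.\<close>

lemma X_bracket:
  fixes F :: "real^3 \<Rightarrow> real"
  assumes F: "smooth_on UNIV F"
  shows "X v (X w F) a - X w (X v F) a = X (br v w) F a"
proof -
  let ?D = "\<lambda>F a. X v (X w F) a - X w (X v F) a"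
  have lin: "X u (\<lambda>x. b * F x + c * H x) = (\<lambda>x. b * X u F x + c * X u H x)"
    and leib: "X u (\<lambda>x. F x * H x) = (\<lambda>x. X u F x * H x + F x * X u H x)"
    and tr: "X u (\<lambda>x. F (mul a x)) = (\<lambda>x. X u F (mul a x))"
    if "smooth_on UNIV F" "smooth_on UNIV H" for F H :: "real^3 \<Rightarrow> real" and a b c u
    using left_inv_derivation_X[of u] that by (simp_all add: left_inv_derivation_def)
  have add: "X u (\<lambda>x. F x + H x) = (\<lambda>x. X u F x + X u H x)"
    if "smooth_on UNIV F" "smooth_on UNIV H" for F H :: "real^3 \<Rightarrow> real" and u
    using lin[OF that, of u 1 1] by simp
  have li: "left_inv_derivation ?D"
    unfolding left_inv_derivation_def
  proof (intro conjI allI impI)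
    fix F H :: "real^3 \<Rightarrow> real" and b c
    assume F: "smooth_on UNIV F" "smooth_on UNIV H"
    show "?D (\<lambda>x. b * F x + c * H x) = (\<lambda>x. b * ?D F x + c * ?D H x)"
      by (simp add: lin F X_smooth fun_eq_iff) (simp add: algebra_simps)
    show "?D (\<lambda>x. F x * H x) = (\<lambda>x. ?D F x * H x + F x * ?D H x)"
      by (simp add: leib add F X_smooth smooth_on_mult fun_eq_iff) (simp add: algebra_simps)
  next
    fix F :: "real^3 \<Rightarrow> real" and a
    assume F: "smooth_on UNIV F"
    show "?D (\<lambda>x. F (mul a x)) = (\<lambda>x. ?D F (mul a x))"
      by (simp add: tr[OF F F] tr[OF X_smooth[OF F] X_smooth[OF F]])
  qed
  have e: "?D (\<lambda>x. x $ i) 0 = br v w $ i" for i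
  proof -
    have "X v (X w (\<lambda>x. x $ i)) 0 = L v w $ i" for v w
    proof -
      have e: "X w (\<lambda>x. x $ i) = (\<lambda>a. A a w $ i)" by (auto simp: X_coord)
      show ?thesis unfolding e
        by (rule X_eqI[of _ _ "\<lambda>v. L v w $ i"])
          (auto intro!: smooth_on_nth smooth_A bounded_linear.has_derivative[OF bounded_linear_vec_nth] A_derivative_0)
    qed
    then show ?thesis by (simp add: br_def)
  qed
  show ?thesis using left_inv_derivation_eq_X[OF li F] by (simp add: e fun_eq_iff)
qed

lemma X_al:
  "X w (\<lambda>x. al x u $ i) a = al a (\<delta> w u) $ i"
proof (rule X_eqI[of _ _ "\<lambda>w. al a (\<delta> w u) $ i"])
  show "smooth_on UNIV (\<lambda>x. al x u $ i)" by (intro smooth_on_nth smooth_al open_UNIV)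
  have "bounded_linear (\<lambda>z. al a z $ i)"
    using bounded_linear_compose[OF bounded_linear_vec_nth] linear_linear[THEN iffD2, OF linear_al] by blast
  from bounded_linear.has_derivative[OF this al_derivative_0]
  show "((\<lambda>y. al (mul a y) u $ i) has_derivative (\<lambda>w. al a (\<delta> w u) $ i)) (at 0)"
    by (simp add: al_mul)
qed

text \<open>The fields act on the matrix coefficients of \<open>al\<close> through
  \<open>\<delta>\<close> (\<open>X_al\<close>). Evaluating \<open>X_bracket\<close> for these
  functions at 0 avoids second derivatives of \<open>al\<close>.\<close>

lemma \<delta>_br: "\<delta> (br v w) u = \<delta> v (\<delta> w u) - \<delta> w (\<delta> v u)"
proof (rule vec_eq_iff[THEN iffD2], rule allI)
  fix i
  have e: "X w (\<lambda>x. al x u $ i) = (\<lambda>a. al a (\<delta> w u) $ i)" for w u by (auto simp: X_al)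
  have "smooth_on UNIV (\<lambda>x. al x u $ i)" by (intro smooth_on_nth smooth_al open_UNIV)
  from X_bracket[OF this, of v w 0]
  show "\<delta> (br v w) u $ i = (\<delta> v (\<delta> w u) - \<delta> w (\<delta> v u)) $ i"
    unfolding e X_al by (simp add: al_zero)
qed

end

section \<open>The adjoint representation and the centrality of commutators\<close>

context simply_transitive_affine
begin

lemma iv_unique: "mul x y = 0 \<Longrightarrow> y = iv x"
  by (metis mul_assoc mul_iv(2) mul_zero)

lemma iv_mul: "iv (mul a b) = mul (iv b) (iv a)"
  by (rule iv_unique[symmetric]) (metis mul_assoc mul_iv(1) mul_zero(1))

lemma iv_zero [simp]: "iv 0 = 0"
  using iv_unique[of 0 0] by simp

text \<open>The derivative of \<open>A\<close> at 0 is known for a fixed argument only. Expanding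
  the moving argument \<open>g x\<close> in \<open>Basis\<close> reduces the claim to the product
  rule.\<close>

lemma A_compose_derivative:
  assumes "(g has_derivative g') (at 0)"
  shows "((\<lambda>x. A x (g x)) has_derivative (\<lambda>v. g' v + L v (g 0))) (at 0)"
proof -
  have exp: "f z = (\<Sum>b\<in>Basis. (z \<bullet> b) *\<^sub>R f b)" if "linear f" for f :: "real^3 \<Rightarrow> real^3" and z
  proof -
    have "f z = f (\<Sum>b\<in>Basis. (z \<bullet> b) *\<^sub>R b)" by (simp add: euclidean_representation)
    then show ?thesis by (simp add: linear_sum[OF that] linear_scale[OF that])
  qed
  have "((\<lambda>x. (g x \<bullet> b) *\<^sub>R A x b) has_derivative (\<lambda>v. (g 0 \<bullet> b) *\<^sub>R L v b + (g' v \<bullet> b) *\<^sub>R A 0 b)) (at 0)" for b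
    by (rule has_derivative_scaleR[OF has_derivative_inner_left[OF assms] A_derivative_0])
  then have "((\<lambda>x. \<Sum>b\<in>Basis. (g x \<bullet> b) *\<^sub>R A x b) has_derivative
     (\<lambda>v. \<Sum>b\<in>Basis. (g 0 \<bullet> b) *\<^sub>R L v b + (g' v \<bullet> b) *\<^sub>R A 0 b)) (at 0)"
    by (rule has_derivative_sum)
  moreover have "(\<Sum>b\<in>Basis. (g 0 \<bullet> b) *\<^sub>R L v b + (g' v \<bullet> b) *\<^sub>R A 0 b) = g' v + L v (g 0)" for v
    by (simp add: sum.distrib exp[OF linear_L(2), of v "g 0", symmetric] euclidean_representation)
  moreover have "(\<lambda>x. \<Sum>b\<in>Basis. (g x \<bullet> b) *\<^sub>R A x b) = (\<lambda>x. A x (g x))"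
    by (rule ext) (rule exp[OF linear_A, symmetric])
  ultimately show ?thesis by simp
qed

lemma iv_derivative_0: "(iv has_derivative (\<lambda>v. - v)) (at 0)"
proof -
  obtain D where D: "(iv has_derivative D) (at 0)"
    using smooth_on_derivative[OF smooth_iv, of 0] by blast
  have "((\<lambda>x. mul x (iv x)) has_derivative (\<lambda>v. v + (D v + L v (iv 0)))) (at 0)"
    unfolding mul_A by (intro has_derivative_add has_derivative_ident A_compose_derivative D)
  then have "((\<lambda>x. 0) has_derivative (\<lambda>v. v + (D v + L v (iv 0)))) (at 0)" by (simp add: mul_iv)
  then have "(\<lambda>v. v + (D v + L v (iv 0))) = (\<lambda>v. 0)"
    using has_derivative_unique[OF _ has_derivative_const] by blast
  then have "v + D v = 0" for v using linear_0[OF linear_L(2)] by (simp add: fun_eq_iff)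
  then have "D = (\<lambda>v. - v)" by (auto simp: eq_neg_iff_add_eq_0 add.commute)
  then show ?thesis using D by simp
qed

text \<open>The differential at 0 of conjugation by \<open>a\<close>: \<open>w + L w (iv a)\<close>
  comes from right translation by \<open>iv a\<close>, and \<open>A a\<close> from left translation
  by \<open>a\<close>, whose differential is the same at all points.\<close>

definition Ad :: "real^3 \<Rightarrow> real^3 \<Rightarrow> real^3" where "Ad a w = A a (w + L w (iv a))"

lemma conj_derivative_0: "((\<lambda>y. mul a (mul y (iv a))) has_derivative Ad a) (at 0)"
  using has_derivative_compose[OF mul_right_derivative_0[of "iv a"] mul_left_derivative[of a]]
  by (simp add: Ad_def[abs_def])

lemma linear_Ad: "linear (Ad a)"
  by (rule has_derivative_linear[OF conj_derivative_0])

lemma Ad_zero: "Ad 0 w = w"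
  using linear_0[OF linear_L(2)] by (simp add: Ad_def)

lemma Ad_mul: "Ad (mul a b) w = Ad a (Ad b w)"
proof -
  have "((\<lambda>y. mul a (mul y (iv a))) has_derivative Ad a) (at (mul b (mul 0 (iv b))))"
    using conj_derivative_0 by (simp add: mul_iv)
  from has_derivative_compose[OF conj_derivative_0 this]
  have "((\<lambda>y. mul (mul a b) (mul y (iv (mul a b)))) has_derivative (\<lambda>w. Ad a (Ad b w))) (at 0)"
    by (simp add: iv_mul mul_assoc)
  then show ?thesis using has_derivative_unique[OF conj_derivative_0] by metis
qed

lemma Ad_derivative_0: "((\<lambda>y. Ad y w) has_derivative (\<lambda>v. br v w)) (at 0)"
proof -
  have bl: "bounded_linear (L w)" using linear_L(2) by (rule linear_linear[THEN iffD2])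
  have "((\<lambda>y. w + L w (iv y)) has_derivative (\<lambda>v. 0 + L w (- v))) (at 0)"
    by (intro has_derivative_add has_derivative_const bounded_linear.has_derivative[OF bl] iv_derivative_0)
  from A_compose_derivative[OF this]
  show ?thesis
    by (simp add: Ad_def[abs_def] br_def linear_0[OF linear_L(2)] linear_neg[OF linear_L(2)])
qed

text \<open>This takes the place of the exponential map: infinitesimal identities at 0, spread by
  left translation, become identities on the whole group because \<real>^3 is connected.\<close>

lemma left_translation_constant:
  fixes F :: "real^3 \<Rightarrow> 'b::real_normed_vector"
  assumes "\<And>a. ((\<lambda>y. F (mul a y)) has_derivative (\<lambda>v. 0)) (at 0)"
  shows "F x = F 0"
proof -
  have "(F has_derivative (\<lambda>v. 0)) (at a within UNIV)" for a
  proof -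
    have "((\<lambda>y. F (mul a y)) has_derivative (\<lambda>v. 0)) (at (mul (iv a) a))"
      using assms by (simp add: mul_iv)
    from has_derivative_compose[OF mul_left_derivative this]
    show ?thesis by (simp add: mul_assoc[symmetric] mul_iv)
  qed
  from has_derivative_zero_unique[OF convex_UNIV this] show ?thesis by blast
qed

lemma linear_br: "linear (br u)"
  unfolding br_def by (intro linear_compose_sub linear_L)

text \<open>As double brackets vanish, \<open>Ad\<close> fixes every bracket, and
  \<open>br u\<close> does not distinguish \<open>Ad a w\<close> from \<open>w\<close>. Hence
  \<open>Ad a\<close> and \<open>Ad b\<close> commute, \<open>Ad\<close> is trivial on commutators,
  and elements with trivial \<open>Ad\<close> are central.\<close>

lemma commutator_central:
  assumes nil: "\<And>u v w. br u (br v w) = 0"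
  defines "k \<equiv> \<lambda>a b. mul (mul (mul a b) (iv a)) (iv b)"
  shows "mul x (k a b) = mul (k a b) x"
proof -
  have bl: "bounded_linear (Ad a)" "bounded_linear (br a)" for a
    using linear_Ad linear_br by (auto simp: linear_linear)
  have dAd: "((\<lambda>y. Ad (mul a y) w) has_derivative (\<lambda>v. Ad a (br v w))) (at 0)" for a w
    unfolding Ad_mul by (rule bounded_linear.has_derivative[OF bl(1) Ad_derivative_0])
  have Ad_br: "Ad a (br u w) = br u w" for a u w
  proof -
    have "Ad a (br u w) = Ad 0 (br u w)"
      by (rule left_translation_constant) (use dAd[of _ "br u w"] in \<open>simp add: nil linear_0[OF linear_Ad]\<close>)
    then show ?thesis by (simp add: Ad_zero)
  qed
  have brAd: "br u (Ad a w) = br u w" for a u w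
  proof -
    have "br u (Ad a w) = br u (Ad 0 w)"
    proof (rule left_translation_constant)
      show "((\<lambda>y. br u (Ad (mul a y) w)) has_derivative (\<lambda>v. 0)) (at 0)" for a
        using bounded_linear.has_derivative[OF bl(2) dAd[of a w], of u] by (simp add: Ad_br nil)
    qed
    then show ?thesis by (simp add: Ad_zero)
  qed
  have comm: "Ad a (Ad b w) = Ad b (Ad a w)" for a b w
  proof -
    have "Ad a (Ad b w) - Ad b (Ad a w) = Ad 0 (Ad b w) - Ad b (Ad 0 w)"
    proof (rule left_translation_constant)
      show "((\<lambda>y. Ad (mul a y) (Ad b w) - Ad b (Ad (mul a y) w)) has_derivative (\<lambda>v. 0)) (at 0)" for a
        using has_derivative_diff[OF dAd[of a "Ad b w"] bounded_linear.has_derivative[OF bl(1) dAd[of a w], of b]]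
        by (simp add: Ad_br brAd)
    qed
    then show ?thesis by (simp add: Ad_zero)
  qed
  have central: "mul x c = mul c x" if c: "\<And>w. Ad c w = w" for c x
  proof -
    \<comment> \<open>\<open>mul y (?g y)\<close> is the commutator of \<open>y\<close> and
      \<open>c\<close>. Its differential at 0 is the identity minus \<open>Ad c\<close>, which is
      0.\<close>
    let ?g = "\<lambda>y. mul c (mul (iv y) (iv c))"
    have "((\<lambda>y. mul c (mul y (iv c))) has_derivative (\<lambda>w. w)) (at (iv 0))"
      using conj_derivative_0[of c] c by (simp add: fun_eq_iff[of "Ad c" "\<lambda>w. w", THEN iffD2])
    from has_derivative_compose[OF iv_derivative_0 this]
    have g: "(?g has_derivative (\<lambda>v. - v)) (at 0)" .
    have "((\<lambda>y. mul y (?g y)) has_derivative (\<lambda>v. v + (- v + L v (?g 0)))) (at 0)"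
      unfolding mul_A[of _ "?g _"] by (intro has_derivative_add has_derivative_ident A_compose_derivative g)
    then have 1: "((\<lambda>y. mul y (?g y)) has_derivative (\<lambda>v. 0)) (at 0)"
      using linear_0[OF linear_L(2)] by (simp add: mul_iv)
    have "mul x (mul c (iv x)) = mul 0 (mul c (iv 0))"
    proof (rule left_translation_constant)
      fix a
      let ?H = "\<lambda>x. mul a (mul (mul x c) (iv a))"
      have "smooth_on UNIV (\<lambda>x. mul x w)" for w
        unfolding mul_A by (intro smooth_on_add smooth_A smooth_on_linear bounded_linear_ident open_UNIV)
      from this[of "mul c (iv a)"] obtain D where "((\<lambda>x. mul x (mul c (iv a))) has_derivative D) (at (mul 0 (?g 0)))"
        using smooth_on_derivative by blast
      from has_derivative_compose[OF has_derivative_compose[OF 1 this] mul_left_derivative[of a]]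
      have "((\<lambda>y. mul a (mul (mul y (?g y)) (mul c (iv a)))) has_derivative (\<lambda>v. A a (D 0))) (at 0)" .
      moreover have "D 0 = 0"
        using \<open>(_ has_derivative D) _\<close> has_derivative_linear linear_0 by blast
      \<comment> \<open>Cancelling \<open>iv c\<close> against \<open>c\<close> expresses the
        conjugate of \<open>c\<close> by \<open>mul a y\<close> through that commutator.\<close>
      moreover have "mul (mul y (?g y)) (mul c (iv a)) = mul y (mul c (mul (iv y) (iv a)))" for y
        by (simp add: mul_assoc) (simp add: mul_assoc[symmetric, of "iv c" c] mul_iv)
      ultimately show "((\<lambda>y. mul (mul a y) (mul c (iv (mul a y)))) has_derivative (\<lambda>v. 0)) (at 0)"
        by (simp add: mul_assoc iv_mul)
    qed
    then have "mul (mul x (mul c (iv x))) x = mul c x" by simp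
    then show ?thesis by (simp add: mul_assoc mul_iv)
  qed
  have "Ad (k a b) w = w" for w
  proof -
    have inv: "Ad a (Ad (iv a) w) = w" for a w by (simp add: Ad_mul[symmetric] mul_iv Ad_zero)
    have k: "mul (k a b) (mul b a) = mul a b"
      unfolding k_def
      by (simp add: mul_assoc) (simp add: mul_assoc[symmetric, of "iv b" b] mul_iv)
    define u where "u = Ad (iv a) (Ad (iv b) w)"
    have w: "w = Ad b (Ad a u)" by (simp add: u_def inv)
    have "Ad (k a b) (Ad b (Ad a u)) = Ad a (Ad b u)"
      using k by (metis Ad_mul)
    also have "\<dots> = Ad b (Ad a u)" by (rule comm)
    finally show ?thesis using w by simp
  qed
  then show ?thesis by (rule central)
qed

end

section \<open>Transport to \<open>\<real>\<^sup>3\<close>\<close>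

lemma smooth_map_post:
  assumes "smooth_map M euclidean_manifold f" "smooth_on UNIV h" "chart_atlas M"
  shows "smooth_map M euclidean_manifold (\<lambda>x. h (f x))"
  using smooth_map_compose[OF assms(1) _ assms(3) chart_atlas_euclidean chart_atlas_euclidean, of h] assms(2)
  by (simp add: smooth_map_euclidean_euclidean comp_def)

locale affine_action =
  fixes G :: "('g, 'e::euclidean_space) lie_group" (structure) and \<rho> :: "'g \<Rightarrow> (real^3) \<times> (real^3 \<Rightarrow> real^3)"
  assumes lie_group: "is_lie_group G"
    and rho: "\<rho> \<in> lie_group_hom G Aff_H3"
    and simply_transitive: "\<forall>x\<in>carrier H3. \<forall>y\<in>carrier H3. \<exists>!g. g \<in> carrier G \<and> aff_act H3 (\<rho> g) x = y"
begin

sublocale group G using lie_group by (simp add: is_lie_group_def)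

lemma manifold: "smooth_manifold (mfd G)" "topspace (fst (mfd G)) = carrier G"
  using lie_group by (simp_all add: is_lie_group_def)

lemmas atlas = smooth_manifold_chart_atlas[OF manifold(1)]

text \<open>Automorphisms fix 0, so \<open>fst (\<rho> g)\<close> is the image of 0 under
  \<open>g\<close>.\<close>

definition \<theta> where "\<theta> g = fst (\<rho> g)"
definition \<beta> where "\<beta> g = snd (\<rho> g)"

lemma beta: "g \<in> carrier G \<Longrightarrow> \<beta> g \<in> lie_auto H3"
  using rho by (auto simp: lie_group_hom_def hom_def Pi_def Aff_H3_simps \<beta>_def mem_Times_iff)

lemmas linear_beta = lie_auto_H3(1)[OF beta]
lemmas beta_bracket = lie_auto_H3(2)[OF beta]

lemma rho_mult:
  assumes "g \<in> carrier G" "h \<in> carrier G"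
  shows "\<theta> (g \<otimes> h) = \<theta> g + \<beta> g (\<theta> h) + (1/2) *\<^sub>R lie_bracket h3 (\<theta> g) (\<beta> g (\<theta> h))"
    and "\<beta> (g \<otimes> h) = \<beta> g \<circ> \<beta> h"
proof -
  have r: "\<rho> x = (\<theta> x, \<beta> x)" for x by (simp add: \<theta>_def \<beta>_def)
  have "\<rho> (g \<otimes> h) = \<rho> g \<otimes>\<^bsub>Aff_H3\<^esub> \<rho> h"
    using rho assms by (simp add: lie_group_hom_def hom_def)
  then have "(\<theta> (g \<otimes> h), \<beta> (g \<otimes> h)) =
      (\<theta> g + \<beta> g (\<theta> h) + (1/2) *\<^sub>R lie_bracket h3 (\<theta> g) (\<beta> g (\<theta> h)), \<beta> g \<circ> \<beta> h)"
    by (simp only: r[of "g \<otimes> h"] r[of g] r[of h] Aff_H3_simps)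
  then show "\<theta> (g \<otimes> h) = \<theta> g + \<beta> g (\<theta> h) + (1/2) *\<^sub>R lie_bracket h3 (\<theta> g) (\<beta> g (\<theta> h))"
    and "\<beta> (g \<otimes> h) = \<beta> g \<circ> \<beta> h" by (rule Pair_inject, simp)+
qed

lemma beta_one: "\<beta> \<one> = id"
proof -
  have "bij (\<beta> \<one>)" using beta[OF one_closed] by (auto simp: lie_auto_def auto_def Bij_def)
  moreover have "\<beta> \<one> \<circ> \<beta> \<one> = \<beta> \<one>" using rho_mult(2)[of \<one> \<one>] by simp
  ultimately show ?thesis by (metis bij_is_inj comp_assoc comp_id inv_o_cancel id_comp)
qed

lemma theta_one: "\<theta> \<one> = 0"
  using rho_mult(1)[of \<one> \<one>] by (simp add: beta_one h3_bracket)

lemma bij_theta: "bij_betw \<theta> (carrier G) UNIV"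
proof -
  have "aff_act H3 (\<rho> g) 0 = \<theta> g" if "g \<in> carrier G" for g
    using linear_0[OF linear_beta[OF that]] by (simp add: aff_act_H3 \<theta>_def \<beta>_def h3_bracket)
  then have "\<exists>!g. g \<in> carrier G \<and> \<theta> g = y" for y
    using simply_transitive[rule_format, of 0 y] by (simp cong: conj_cong)
  then show ?thesis
    unfolding bij_betw_def inj_on_def by (metis UNIV_eq_I imageI)
qed

definition \<sigma> where "\<sigma> = inv_into (carrier G) \<theta>"

lemma sigma [simp]: "\<sigma> x \<in> carrier G" "\<theta> (\<sigma> x) = x" "g \<in> carrier G \<Longrightarrow> \<sigma> (\<theta> g) = g"
proof -
  have i: "inj_on \<theta> (carrier G)" "x \<in> \<theta> ` carrier G" using bij_theta by (auto simp: bij_betw_def)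
  show "\<sigma> x \<in> carrier G" "\<theta> (\<sigma> x) = x" "g \<in> carrier G \<Longrightarrow> \<sigma> (\<theta> g) = g"
    unfolding \<sigma>_def using i by (simp_all add: inv_into_into f_inv_into_f)
qed

lemma smooth_theta: "smooth_map (mfd G) euclidean_manifold \<theta>"
  and smooth_beta: "smooth_map (mfd G) euclidean_manifold (\<lambda>g. \<beta> g e1)"
    "smooth_map (mfd G) euclidean_manifold (\<lambda>g. \<beta> g e2)"
proof -
  have "\<rho> ` topspace (fst (mfd G)) \<subseteq> carrier Aff_H3"
    using rho manifold by (auto simp: lie_group_hom_def hom_def)
  moreover have "smooth_map (mfd G) (mfd Aff_H3) \<rho>" using rho by (simp add: lie_group_hom_def)
  ultimately have s: "smooth_map (mfd G) euclidean_manifold (aff_H3_chart \<circ> \<rho>)"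
    by (intro smooth_map_Aff_H3 atlas)
  have e: "(aff_H3_chart \<circ> \<rho>) g = (\<theta> g, \<beta> g e1, \<beta> g e2)" for g
    by (simp add: aff_H3_chart_def \<theta>_def \<beta>_def case_prod_unfold)
  note post = smooth_map_post[OF s smooth_on_linear atlas, unfolded e]
  show "smooth_map (mfd G) euclidean_manifold \<theta>"
    using post[OF bounded_linear_fst] by simp
  show "smooth_map (mfd G) euclidean_manifold (\<lambda>g. \<beta> g e1)"
    using post[OF bounded_linear_fst_comp[OF bounded_linear_snd]] by simp
  show "smooth_map (mfd G) euclidean_manifold (\<lambda>g. \<beta> g e2)"
    using post[OF bounded_linear_snd_comp[OF bounded_linear_snd]] by simp
qed

definition al where "al x = \<beta> (\<sigma> x)"
definition iv where "iv x = \<theta> (inv (\<sigma> x))"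
definition mul where "mul x y = \<theta> (\<sigma> x \<otimes> \<sigma> y)"

lemma mul_eq: "mul x y = x + al x y + (1/2) *\<^sub>R lie_bracket h3 x (al x y)"
  by (simp add: mul_def al_def rho_mult)

text \<open>The name \<open>mul_def\<close> is hidden by the sublocale below.\<close>

lemma mul_theta: "mul x y = \<theta> (\<sigma> x \<otimes> \<sigma> y)"
  by (rule mul_def)

lemma sigma_mul: "\<sigma> (mul x y) = \<sigma> x \<otimes> \<sigma> y"
  by (simp add: mul_def)

lemma smooth_left_translation:
  assumes "g \<in> carrier G" shows "smooth_map (mfd G) (mfd G) (\<lambda>x. g \<otimes> x)"
  by (rule smooth_map_section[where m = "\<lambda>x y. x \<otimes> y", OF _ atlas atlas atlas])
    (use lie_group assms manifold in \<open>simp_all add: is_lie_group_def\<close>)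

text \<open>Equivariance of \<open>\<theta>\<close> spreads the smoothness of \<open>\<sigma>\<close> from one point to all others.\<close>

lemma smooth_sigma: "smooth_map euclidean_manifold (mfd G) \<sigma>"
proof -
  obtain T A where M: "mfd G = (T, A)" by fastforce
  have man: "smooth_manifold (T, A)" "topspace T = carrier G" using manifold by (simp_all add: M)
  note at = smooth_manifold_chart_atlas[OF man(1)]
  have f: "smooth_map (T, A) euclidean_manifold \<theta>" "bij_betw \<theta> (topspace T) UNIV"
    using smooth_theta bij_theta by (simp_all add: M man)
  have g: "x \<in> topspace T \<Longrightarrow> \<sigma> (\<theta> x) = x" for x by (simp add: man)
  have c: "continuous_map euclidean T \<sigma>" by (rule smooth_bijection_inverse(1)[OF man(1) f g])
  obtain U \<phi> N y where U: "(U, \<phi>) \<in> A" "open N" "y \<in> N" "\<sigma> ` N \<subseteq> U" "smooth_on N (\<phi> \<circ> \<sigma>)"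
    using smooth_bijection_inverse(2)[OF man(1) f g] by blast
  have pre: "open (\<sigma> -` W)" if "openin T W" for W
    using openin_continuous_map_preimage[OF c that] by (simp add: vimage_def)
  have "smooth_on (\<sigma> -` V) (\<psi> \<circ> \<sigma>)" if V: "(V, \<psi>) \<in> A" for V \<psi>
  proof (rule smooth_on_local)
    note u = chart_atlasD[OF at U(1)] and v = chart_atlasD[OF at V]
    show oV: "open (\<sigma> -` V)" by (rule pre[OF v(1)])
    fix x assume x: "x \<in> \<sigma> -` V"
    \<comment> \<open>Left translation by \<open>h\<close> takes \<open>\<sigma> x\<close> to
      \<open>\<sigma> y\<close>, and in \<real>^3 it is the affine map \<open>l\<close>. So near
      \<open>x\<close>, \<open>\<sigma>\<close> is its restriction to \<open>N\<close> composed with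
      smooth maps on both sides.\<close>
    define h where "h = \<sigma> y \<otimes> inv (\<sigma> x)"
    have h: "h \<in> carrier G" by (simp add: h_def)
    define l where "l z = \<theta> (h \<otimes> \<sigma> z)" for z
    have "l = (\<lambda>z. \<theta> h + \<beta> h z + (1/2) *\<^sub>R lie_bracket h3 (\<theta> h) (\<beta> h z))"
      by (auto simp: l_def rho_mult h)
    moreover have b: "smooth_on S (\<beta> h)" for S
      using linear_beta[OF h] by (intro smooth_on_linear) (simp add: linear_linear)
    have "smooth_on S (\<lambda>z. \<theta> h + \<beta> h z + (1/2) *\<^sub>R lie_bracket h3 (\<theta> h) (\<beta> h z))" if "open S" for S
      by (intro smooth_on_add smooth_on_const smooth_on_linear_compose[OF bounded_linear_scaleR_right]
          smooth_on_bilinear[OF bounded_bilinear_h3_bracket] b that)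
    ultimately have l: "smooth_on S l" if "open S" for S using that by simp
    have lx: "l x = y" by (simp add: l_def h_def m_assoc)
    have hl: "inv h \<otimes> \<sigma> (l z) = \<sigma> z" for z using h by (simp add: l_def m_assoc[symmetric])
    let ?T = "l -` N"
    have T: "open ?T"
      by (rule continuous_open_vimage[OF U(2)])
        (use smooth_on_continuous[OF l[OF open_UNIV]] in \<open>simp add: continuous_on_eq_continuous_at\<close>)
    have o: "open (\<sigma> -` V \<inter> ?T)" using oV T by blast
    have "smooth_map (T, A) (T, A) (\<lambda>x. inv h \<otimes> x)"
      using smooth_left_translation[of "inv h"] h by (simp add: M)
    then have s: "smooth_on (\<phi> ` (U \<inter> (\<lambda>x. inv h \<otimes> x) -` V)) (\<psi> \<circ> (\<lambda>x. inv h \<otimes> x) \<circ> inv_into U \<phi>)"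
      (is "smooth_on ?P ?F") using U(1) V by (auto simp: smooth_map_def)
    have "smooth_on (\<sigma> -` V \<inter> ?T) (\<lambda>z. (\<phi> \<circ> \<sigma>) (l z))"
      by (rule smooth_on_compose[OF o _ l[OF o] U(5)]) auto
    then have "smooth_on (\<sigma> -` V \<inter> ?T) (\<lambda>z. ?F ((\<phi> \<circ> \<sigma>) (l z)))"
      by (rule smooth_on_compose[OF o _ _ s, rotated]) (use hl U(4) in force)
    then have "smooth_on (\<sigma> -` V \<inter> ?T) (\<psi> \<circ> \<sigma>)"
      by (rule smooth_on_cong[OF o, rotated]) (use hl U(4) u(2) in \<open>auto simp: image_subset_iff\<close>)
    then show "\<exists>T. open T \<and> x \<in> T \<and> smooth_on (\<sigma> -` V \<inter> T) (\<psi> \<circ> \<sigma>)"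
      using T lx U(3) by blast
  qed
  moreover have "inv_into UNIV (\<lambda>x::real^3. x) = (\<lambda>x. x)" by (auto simp: inv_f_eq fun_eq_iff)
  ultimately show ?thesis
    using c unfolding M by (auto simp: smooth_map_def euclidean_manifold_def comp_def)
qed

lemma smooth_pull_sigma:
  assumes "smooth_map (mfd G) euclidean_manifold f" shows "smooth_on UNIV (\<lambda>x. f (\<sigma> x))"
  using smooth_map_compose[OF smooth_sigma assms chart_atlas_euclidean atlas chart_atlas_euclidean]
  by (simp add: smooth_map_euclidean_euclidean comp_def)

sublocale simply_transitive_affine al iv mul
proof (rule simply_transitive_affine.intro)
  show "mul x y = x + al x y + (1/2) *\<^sub>R lie_bracket h3 x (al x y)" for x y by (rule mul_eq)
  show "linear (al x)" for x by (simp add: al_def linear_beta)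
  show "al x (lie_bracket h3 u w) = lie_bracket h3 (al x u) (al x w)" for x u w
    by (simp add: al_def beta_bracket)
  show "al 0 u = u" for u
    using sigma(3)[OF one_closed] by (simp add: al_def theta_one beta_one)
  show "al (mul x y) u = al x (al y u)" for x y u by (simp add: al_def sigma_mul rho_mult)
  show "mul x (iv x) = 0" "mul (iv x) x = 0" for x by (simp_all add: mul_def iv_def theta_one)
  have "smooth_map (mfd G) (mfd G) (\<lambda>x. inv x)" using lie_group by (simp add: is_lie_group_def)
  from smooth_map_compose[OF this smooth_theta atlas atlas chart_atlas_euclidean]
  show "smooth_on UNIV iv" using smooth_pull_sigma by (force simp: iv_def[abs_def] comp_def)
  show "smooth_on UNIV (\<lambda>x. al x u)" for u
  proof -
    have b: "smooth_on UNIV (\<lambda>x. al x e1)" "smooth_on UNIV (\<lambda>x. al x e2)"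
      using smooth_beta smooth_pull_sigma by (auto simp: al_def)
    \<comment> \<open>The chart of \<open>Aff_H3\<close> records only the images of
      \<open>e1\<close> and \<open>e2\<close>; the image of \<open>e3\<close> is their
      bracket.\<close>
    have e3: "lie_bracket h3 e1 e2 = e3" by (simp add: h3_bracket axis_def)
    have u: "u = u $ 1 *\<^sub>R e1 + u $ 2 *\<^sub>R e2 + u $ 3 *\<^sub>R lie_bracket h3 e1 e2"
      unfolding e3 by (simp add: vec_eq_iff forall_3 axis_def)
    have "al x u = u $ 1 *\<^sub>R al x e1 + u $ 2 *\<^sub>R al x e2 + u $ 3 *\<^sub>R lie_bracket h3 (al x e1) (al x e2)" for x
    proof -
      have l: "linear (al x)" by (simp add: al_def linear_beta)
      have "al x (lie_bracket h3 e1 e2) = lie_bracket h3 (al x e1) (al x e2)"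
        by (simp add: al_def beta_bracket)
      then show ?thesis by (subst u) (simp only: linear_add[OF l] linear_scale[OF l])
    qed
    then show ?thesis
      by (auto intro!: smooth_on_add smooth_on_linear_compose[OF bounded_linear_scaleR_right] b
          smooth_on_bilinear[OF bounded_bilinear_h3_bracket])
  qed
qed

text \<open>By \<open>commutator_central\<close>, \<open>lower_central G 1\<close> lies in the
  center, so the next term of the series is trivial.\<close>

lemma nilpotent:
  assumes nil: "\<And>u v w. br u (br v w) = 0"
  shows "nilpotent_group G"
proof -
  let ?k = "\<lambda>x y. x \<otimes> y \<otimes> inv x \<otimes> inv y"
  have central: "z \<otimes> ?k x y = ?k x y \<otimes> z" if "x \<in> carrier G" "y \<in> carrier G" "z \<in> carrier G" for x y z
  proof -
    have iv: "\<sigma> (iv (\<theta> x)) = inv x" if "x \<in> carrier G" for x using that by (simp add: iv_def)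
    have "\<sigma> (mul (\<theta> z) (mul (mul (mul (\<theta> x) (\<theta> y)) (iv (\<theta> x))) (iv (\<theta> y)))) =
      \<sigma> (mul (mul (mul (mul (\<theta> x) (\<theta> y)) (iv (\<theta> x))) (iv (\<theta> y))) (\<theta> z))"
      using commutator_central[OF nil] by metis
    then show ?thesis using that by (simp add: sigma_mul iv)
  qed
  let ?Z = "{c \<in> carrier G. \<forall>x\<in>carrier G. x \<otimes> c = c \<otimes> x}"
  have "subgroup ?Z G"
  proof (rule subgroupI)
    show "?Z \<noteq> {}" by force
    show "inv a \<in> ?Z" if a: "a \<in> ?Z" for a
    proof -
      have "x \<otimes> inv a = inv a \<otimes> x" if x: "x \<in> carrier G" for x
      proof -
        have ac: "a \<in> carrier G" "x \<otimes> a = a \<otimes> x" using a x by auto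
        have "x \<otimes> inv a = inv a \<otimes> (a \<otimes> x) \<otimes> inv a" using ac(1) x by (simp add: m_assoc[symmetric])
        also have "\<dots> = inv a \<otimes> (x \<otimes> a) \<otimes> inv a" by (simp only: ac(2))
        finally show ?thesis using ac(1) x by (simp add: m_assoc)
      qed
      then show ?thesis using a by simp
    qed
    show "a \<otimes> b \<in> ?Z" if ab: "a \<in> ?Z" "b \<in> ?Z" for a b
    proof -
      have "x \<otimes> (a \<otimes> b) = a \<otimes> b \<otimes> x" if x: "x \<in> carrier G" for x
      proof -
        have c: "a \<in> carrier G" "b \<in> carrier G" "x \<otimes> a = a \<otimes> x" "x \<otimes> b = b \<otimes> x"
          using ab x by auto
        have "x \<otimes> (a \<otimes> b) = (x \<otimes> a) \<otimes> b" using c(1,2) x by (simp add: m_assoc)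
        also have "\<dots> = a \<otimes> (x \<otimes> b)" unfolding c(3) using c(1,2) x by (simp add: m_assoc)
        finally show ?thesis unfolding c(4) using c(1,2) x by (simp add: m_assoc)
      qed
      moreover have "a \<otimes> b \<in> carrier G" using ab by (intro m_closed) blast+
      ultimately show ?thesis by blast
    qed
  qed auto
  moreover have "{?k x y |x y. x \<in> carrier G \<and> y \<in> carrier G} \<subseteq> ?Z"
    using central by auto
  ultimately have 1: "lower_central G 1 \<subseteq> ?Z"
    by (simp add: generate_subgroup_incl)
  have "\<one> \<in> lower_central G 1" by (simp add: generate.one)
  have "{?k x y |x y. x \<in> carrier G \<and> y \<in> lower_central G 1} = {\<one>}"
  proof -
    have "?k x y = \<one>" if "x \<in> carrier G" "y \<in> lower_central G 1" for x y
    proof -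
      have y: "y \<in> carrier G" "x \<otimes> y = y \<otimes> x" using 1 that by blast+
      show ?thesis using that(1) y by (simp add: m_assoc)
    qed
    moreover have "{?k x y |x y. x \<in> carrier G \<and> y \<in> Q} = {\<one>}"
      if k: "\<And>x y. x \<in> carrier G \<Longrightarrow> y \<in> Q \<Longrightarrow> ?k x y = \<one>" and Q: "\<one> \<in> Q" for Q
    proof (rule equalityI)
      show "{?k x y |x y. x \<in> carrier G \<and> y \<in> Q} \<subseteq> {\<one>}" using k by blast
      have "\<one> = ?k \<one> \<one>" by simp
      then show "{\<one>} \<subseteq> {?k x y |x y. x \<in> carrier G \<and> y \<in> Q}" using Q one_closed by blast
    qed
    ultimately show ?thesis using \<open>\<one> \<in> lower_central G 1\<close> by blast
  qed
  then have "lower_central G 2 = generate G {\<one>}" by (simp add: numeral_2_eq_2)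
  then have "lower_central G 2 = {\<one>}" by (simp add: generate_one)
  then show ?thesis unfolding nilpotent_group_def by blast
qed

section \<open>Left-invariant fields on \<open>G\<close> and the bracket on \<real>^3\<close>

lemma smooth_functions_push: "f \<in> smooth_functions G \<Longrightarrow> smooth_on UNIV (\<lambda>x. f (\<sigma> x))"
  by (rule smooth_pull_sigma) (simp add: smooth_functions_def)

text \<open>Restriction to the carrier makes the result extensional, as
  \<open>smooth_functions\<close> demands; so \<open>pull\<close> is inverse to composition with
  \<open>\<sigma>\<close>.\<close>

definition pull :: "(real^3 \<Rightarrow> real) \<Rightarrow> ('g \<Rightarrow> real)" where
  "pull F = (\<lambda>x\<in>carrier G. F (\<theta> x))"

lemma pull_smooth: "smooth_on UNIV F \<Longrightarrow> pull F \<in> smooth_functions G"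
  using smooth_map_cong[OF atlas chart_atlas_euclidean smooth_map_post[OF smooth_theta _ atlas], of F "pull F"]
  by (simp add: smooth_functions_def pull_def manifold)

lemma pull_push: "f \<in> smooth_functions G \<Longrightarrow> pull (\<lambda>x. f (\<sigma> x)) = f"
  by (auto simp: pull_def smooth_functions_def extensional_def)

lemma push_pull [simp]: "pull F (\<sigma> x) = F x"
  by (simp add: pull_def)

definition \<Phi> :: "real^3 \<Rightarrow> (('g \<Rightarrow> real) \<Rightarrow> ('g \<Rightarrow> real))" where
  "\<Phi> v = (\<lambda>f\<in>smooth_functions G. pull (X v (\<lambda>x. f (\<sigma> x))))"

lemma Phi_pull: "smooth_on UNIV F \<Longrightarrow> \<Phi> v (pull F) = pull (X v F)"
  by (simp add: \<Phi>_def pull_smooth)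

lemma Phi_fields: "\<Phi> v \<in> left_invariant_fields G"
proof -
  have li: "left_inv_derivation (X v)" by (rule left_inv_derivation_X)
  have smooth: "\<Phi> v f \<in> smooth_functions G" if "f \<in> smooth_functions G" for f
    using that by (simp add: \<Phi>_def pull_smooth X_smooth smooth_functions_push)
  show ?thesis
    unfolding left_invariant_fields_def
  proof (intro CollectI conjI ballI allI)
    show "\<Phi> v \<in> smooth_functions G \<rightarrow>\<^sub>E smooth_functions G"
      using smooth by (auto simp: \<Phi>_def PiE_def extensional_def)
    fix f g b c assume f: "f \<in> smooth_functions G" and g: "g \<in> smooth_functions G"
    note s = smooth_functions_push[OF f] smooth_functions_push[OF g]
    have "(\<lambda>x\<in>carrier G. b * f x + c * g x) = pull (\<lambda>x. b * f (\<sigma> x) + c * g (\<sigma> x))"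
      by (auto simp: pull_def)
    then show "\<Phi> v (\<lambda>x\<in>carrier G. b * f x + c * g x) = (\<lambda>x\<in>carrier G. b * \<Phi> v f x + c * \<Phi> v g x)"
      using li s f g
      by (simp add: Phi_pull smooth_on_add smooth_on_mult smooth_on_const left_inv_derivation_def)
        (auto simp: pull_def \<Phi>_def)
    have "(\<lambda>x\<in>carrier G. f x * g x) = pull (\<lambda>x. f (\<sigma> x) * g (\<sigma> x))"
      by (auto simp: pull_def)
    then show "\<Phi> v (\<lambda>x\<in>carrier G. f x * g x) = (\<lambda>x\<in>carrier G. \<Phi> v f x * g x + f x * \<Phi> v g x)"
      using li s f g
      by (simp add: Phi_pull smooth_on_mult left_inv_derivation_def) (auto simp: pull_def \<Phi>_def)
  next
    fix a f assume a: "a \<in> carrier G" and f: "f \<in> smooth_functions G"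
    have "(\<lambda>x\<in>carrier G. f (a \<otimes> x)) = pull (\<lambda>x. f (\<sigma> (mul (\<theta> a) x)))"
      using a by (auto simp: pull_def sigma_mul)
    moreover have "X v (\<lambda>x. f (\<sigma> (mul (\<theta> a) x))) = (\<lambda>x. X v (\<lambda>x. f (\<sigma> x)) (mul (\<theta> a) x))"
      using li[unfolded left_inv_derivation_def] smooth_functions_push[OF f] by blast
    moreover have "smooth_on UNIV (\<lambda>x. f (\<sigma> (mul (\<theta> a) x)))"
      by (rule smooth_translate[OF smooth_functions_push[OF f]])
    moreover have "mul (\<theta> a) (\<theta> x) = \<theta> (a \<otimes> x)" if "x \<in> carrier G" for x using a that by (simp add: mul_theta)
    ultimately show "\<Phi> v (\<lambda>x\<in>carrier G. f (a \<otimes> x)) = (\<lambda>x\<in>carrier G. \<Phi> v f (a \<otimes> x))"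
      using f a by (simp add: Phi_pull) (auto simp: pull_def \<Phi>_def)
  qed
qed

lemma fields_Phi:
  assumes D: "D \<in> left_invariant_fields G" shows "\<exists>v. D = \<Phi> v"
proof -
  have D1: "D \<in> smooth_functions G \<rightarrow>\<^sub>E smooth_functions G"
    and lin: "\<And>f g b c. f \<in> smooth_functions G \<Longrightarrow> g \<in> smooth_functions G \<Longrightarrow>
      D (\<lambda>x\<in>carrier G. b * f x + c * g x) = (\<lambda>x\<in>carrier G. b * D f x + c * D g x)"
    and leib: "\<And>f g. f \<in> smooth_functions G \<Longrightarrow> g \<in> smooth_functions G \<Longrightarrow>
      D (\<lambda>x\<in>carrier G. f x * g x) = (\<lambda>x\<in>carrier G. D f x * g x + f x * D g x)"
    and inv: "\<And>a f. a \<in> carrier G \<Longrightarrow> f \<in> smooth_functions G \<Longrightarrow>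
      D (\<lambda>x\<in>carrier G. f (a \<otimes> x)) = (\<lambda>x\<in>carrier G. D f (a \<otimes> x))"
    using D by (simp_all add: left_invariant_fields_def)
  let ?D = "\<lambda>F x. D (pull F) (\<sigma> x)"
  have "left_inv_derivation ?D"
    unfolding left_inv_derivation_def
  proof (intro conjI allI impI)
    fix F H :: "real^3 \<Rightarrow> real" and b c
    assume F: "smooth_on UNIV F" and H: "smooth_on UNIV H"
    have "pull (\<lambda>x. b * F x + c * H x) = (\<lambda>x\<in>carrier G. b * pull F x + c * pull H x)"
      by (auto simp: pull_def)
    then show "?D (\<lambda>x. b * F x + c * H x) = (\<lambda>x. b * ?D F x + c * ?D H x)"
      using lin[OF pull_smooth[OF F] pull_smooth[OF H]] by simp
    have "pull (\<lambda>x. F x * H x) = (\<lambda>x\<in>carrier G. pull F x * pull H x)"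
      by (auto simp: pull_def)
    then show "?D (\<lambda>x. F x * H x) = (\<lambda>x. ?D F x * H x + F x * ?D H x)"
      using leib[OF pull_smooth[OF F] pull_smooth[OF H]] by simp
  next
    fix F :: "real^3 \<Rightarrow> real" and a
    assume F: "smooth_on UNIV F"
    have "pull (\<lambda>x. F (mul a x)) = (\<lambda>x\<in>carrier G. pull F (\<sigma> a \<otimes> x))"
      by (auto simp: pull_def mul_theta)
    then show "?D (\<lambda>x. F (mul a x)) = (\<lambda>x. ?D F (mul a x))"
      using inv[OF _ pull_smooth[OF F], of "\<sigma> a"] by (simp add: sigma_mul)
  qed
  then obtain v where v: "\<And>F. smooth_on UNIV F \<Longrightarrow> ?D F = X v F"
    using left_inv_derivation_eq_X by blast
  have "D f = \<Phi> v f" if f: "f \<in> smooth_functions G" for f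
  proof -
    have "D f = pull (\<lambda>x. D f (\<sigma> x))" by (rule pull_push[OF PiE_mem[OF D1 f], symmetric])
    also have "\<dots> = pull (X v (\<lambda>x. f (\<sigma> x)))"
      using v[OF smooth_functions_push[OF f]] pull_push[OF f] by simp
    finally show ?thesis using f by (simp add: \<Phi>_def)
  qed
  moreover have "D f = \<Phi> v f" if "f \<notin> smooth_functions G" for f
    using that D1 by (auto simp: \<Phi>_def PiE_def extensional_def)
  ultimately have "D f = \<Phi> v f" for f by (cases "f \<in> smooth_functions G") simp_all
  then have "D = \<Phi> v" by (rule ext)
  then show ?thesis ..
qed

lemma Phi_inj: "\<Phi> v = \<Phi> w \<Longrightarrow> v = w"
proof -
  assume "\<Phi> v = \<Phi> w"
  then have "\<Phi> v (pull (\<lambda>x. x $ i)) (\<sigma> 0) = \<Phi> w (pull (\<lambda>x. x $ i)) (\<sigma> 0)" for i by simp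
  then show "v = w" by (simp add: Phi_pull smooth_coord X_coord vec_eq_iff)
qed

lemma X_linear:
  assumes "smooth_on UNIV F"
  shows "X (v + w) F a = X v F a + X w F a" "X (c *\<^sub>R v) F a = c *\<^sub>R X v F a"
proof -
  have l: "linear (frechet_derivative F (at a))"
    using smooth_on_derivative[OF assms] has_derivative_linear by blast
  show "X (v + w) F a = X v F a + X w F a" "X (c *\<^sub>R v) F a = c *\<^sub>R X v F a"
    by (simp_all add: X_def linear_add[OF linear_A] linear_scale[OF linear_A] linear_add[OF l] linear_scale[OF l])
qed

text \<open>From here on only the bracket \<open>br\<close> on \<real>^3 matters: isomorphisms are
  composed with the inverse of \<open>\<Phi>\<close>.\<close>

lemma lie_algebra_iso:
  assumes F: "bij_betw F UNIV (lie_carrier M)"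
    and add: "\<And>x y. F (x + y) = lie_add M (F x) (F y)"
    and scale: "\<And>c x. F (c *\<^sub>R x) = lie_scale M c (F x)"
    and bracket: "\<And>x y. F (br x y) = lie_bracket M (F x) (F y)"
  shows "lie_algebra_isomorphic (lie_algebra_of G) M"
proof -
  let ?L = "lie_algebra_of G"
  have c: "lie_carrier ?L = left_invariant_fields G" by (simp add: lie_algebra_of_def)
  have bij: "bij_betw \<Phi> UNIV (lie_carrier ?L)"
    unfolding bij_betw_def c by (auto simp: inj_on_def intro: Phi_inj Phi_fields dest: fields_Phi)
  have Padd: "\<Phi> (v + w) = lie_add ?L (\<Phi> v) (\<Phi> w)" for v w
    by (auto simp: lie_algebra_of_def \<Phi>_def pull_def X_linear smooth_functions_push restrict_def fun_eq_iff)
  have Pscale: "\<Phi> (c *\<^sub>R v) = lie_scale ?L c (\<Phi> v)" for c v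
    by (auto simp: lie_algebra_of_def \<Phi>_def pull_def X_linear smooth_functions_push restrict_def fun_eq_iff)
  have Pbr: "\<Phi> (br v w) = lie_bracket ?L (\<Phi> v) (\<Phi> w)" for v w
  proof -
    have "\<Phi> (br v w) f = lie_bracket ?L (\<Phi> v) (\<Phi> w) f" for f
    proof (cases "f \<in> smooth_functions G")
      case True
      note s = smooth_functions_push[OF True]
      have "\<Phi> v (\<Phi> w f) = pull (X v (X w (\<lambda>x. f (\<sigma> x))))" for v w
        using Phi_pull[OF X_smooth[OF s]] True by (simp add: \<Phi>_def[of w])
      then show ?thesis using True
        by (auto simp: lie_algebra_of_def pull_def X_bracket[OF s, symmetric] \<Phi>_def[of "br v w"])
    qed (simp add: lie_algebra_of_def \<Phi>_def)
    then show ?thesis by blast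
  qed
  define P where "P = inv_into UNIV \<Phi>"
  have P: "\<Phi> (P D) = D" if "D \<in> lie_carrier ?L" for D
    using that bij unfolding P_def by (metis bij_betw_inv_into_right)
  have P': "P (\<Phi> v) = v" for v using bij unfolding P_def by (simp add: bij_betw_inv_into_left)
  have "bij_betw P (lie_carrier ?L) UNIV" unfolding P_def by (rule bij_betw_inv_into[OF bij])
  then have "bij_betw (F \<circ> P) (lie_carrier ?L) (lie_carrier M)" using F by (rule bij_betw_trans)
  moreover have "P (lie_add ?L D E) = P D + P E" "P (lie_bracket ?L D E) = br (P D) (P E)"
    "P (lie_scale ?L c D) = c *\<^sub>R P D"
    if "D \<in> lie_carrier ?L" "E \<in> lie_carrier ?L" for D E c
    using P[OF that(1)] P[OF that(2)] Padd[of "P D" "P E"] Pbr[of "P D" "P E"] Pscale[of c "P D"] P' by metis+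
  ultimately show ?thesis
    unfolding lie_algebra_isomorphic_def
    by (intro exI[of _ "F \<circ> P"]) (simp add: add scale bracket)
qed

end

section \<open>Classification of the Lie algebras\<close>

text \<open>The linear map taking \<open>e1\<close>, \<open>e2\<close>, \<open>e3\<close> to
  \<open>X\<close>, \<open>Y\<close>, \<open>Z\<close>. Its injectivity serves as linear
  independence, and its inverse will be the isomorphism onto the normal form.\<close>

definition comb3 :: "real^3 \<Rightarrow> real^3 \<Rightarrow> real^3 \<Rightarrow> real^3 \<Rightarrow> real^3" where
  "comb3 X Y Z x = x $ 1 *\<^sub>R X + x $ 2 *\<^sub>R Y + x $ 3 *\<^sub>R Z"

lemma linear_comb3: "linear (comb3 X Y Z)"
proof (rule linearI)
  show "comb3 X Y Z (x + y) = comb3 X Y Z x + comb3 X Y Z y" for x y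
    by (simp add: comb3_def scaleR_add_left)
  show "comb3 X Y Z (c *\<^sub>R x) = c *\<^sub>R comb3 X Y Z x" for c x
    by (simp add: comb3_def scaleR_add_right)
qed

lemma inj_comb3I:
  assumes "\<And>a b c. a *\<^sub>R X + b *\<^sub>R Y + c *\<^sub>R Z = 0 \<Longrightarrow> a = 0 \<and> b = 0 \<and> c = 0"
  shows "inj (comb3 X Y Z)"
  unfolding linear_injective_0[OF linear_comb3]
proof (intro allI impI)
  fix x assume "comb3 X Y Z x = 0"
  then have "x $ 1 = 0 \<and> x $ 2 = 0 \<and> x $ 3 = 0" unfolding comb3_def by (rule assms)
  then show "x = 0" by (simp add: vec_eq_iff forall_3)
qed

lemma inj_comb3D:
  assumes "inj (comb3 X Y Z)" "a *\<^sub>R X + b *\<^sub>R Y + c *\<^sub>R Z = 0"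
  shows "a = 0 \<and> b = 0 \<and> c = 0"
proof -
  have "comb3 X Y Z (vector [a, b, c]) = 0" using assms(2) by (simp add: comb3_def)
  then have "vector [a, b, c] = (0 :: real^3)"
    using assms(1) unfolding linear_injective_0[OF linear_comb3] by blast
  then show ?thesis by (simp add: vec_eq_iff forall_3)
qed

text \<open>The three alternatives say that \<open>X, Y, Z\<close> satisfy the bracket relations of \<open>r3\<close>, of \<open>r3_par l\<close>
  or of \<open>r3'_par 0\<close>.\<close>

definition classified :: "(real^3 \<Rightarrow> real^3 \<Rightarrow> real^3) \<Rightarrow> bool" where
  "classified br \<longleftrightarrow> (\<exists>X Y Z. inj (comb3 X Y Z) \<and> br Y Z = 0 \<and>
     (br X Y = Y \<and> br X Z = Y + Z \<or>
      (\<exists>l\<in>{1, -1}. br X Y = Y \<and> br X Z = l *\<^sub>R Z) \<or>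
      br X Y = - Z \<and> br X Z = Y))"

section \<open>Normal forms for a vector acting on an abelian plane\<close>

locale alternating_bracket =
  fixes br :: "real^3 \<Rightarrow> real^3 \<Rightarrow> real^3"
  assumes br_linear: "linear (br u)" and br_alt: "br u v = - br v u"
begin

lemma br_simps:
  "br u (v + w) = br u v + br u w" "br u (v - w) = br u v - br u w" "br u (s *\<^sub>R v) = s *\<^sub>R br u v"
  "br (v + w) u = br v u + br w u" "br (v - w) u = br v u - br w u" "br (s *\<^sub>R v) u = s *\<^sub>R br v u"
  "br u 0 = 0" "br u (- v) = - br u v" "br 0 u = 0" "br (- v) u = - br v u"
  using br_alt[of _ u]
  by (simp_all add: linear_add[OF br_linear] linear_diff[OF br_linear] linear_scale[OF br_linear]
      linear_0[OF br_linear] linear_neg[OF br_linear])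

lemma br_self [simp]: "br u u = 0"
proof -
  have "2 *\<^sub>R br u u = 0" unfolding scaleR_2 using br_alt[of u u] by (metis add.right_inverse)
  then show ?thesis by simp
qed

text \<open>\<open>Y\<close> and \<open>Z\<close> span an abelian ideal on which \<open>X\<close>
  acts by the matrix with columns \<open>(m11, m21)\<close> and \<open>(m12, m22)\<close>. Rescaling
  \<open>X\<close> scales this matrix; a new basis of the plane conjugates it.\<close>

context
  fixes X Y Z :: "real^3" and m11 m12 m21 m22 :: real
  assumes inj: "inj (comb3 X Y Z)" and YZ: "br Y Z = 0"
    and XY: "br X Y = m11 *\<^sub>R Y + m21 *\<^sub>R Z" and XZ: "br X Z = m12 *\<^sub>R Y + m22 *\<^sub>R Z"
begin

lemma inj_change:
  assumes "s \<noteq> 0" "y1 * z2 - y2 * z1 \<noteq> 0"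
  shows "inj (comb3 (s *\<^sub>R X) (y1 *\<^sub>R Y + y2 *\<^sub>R Z) (z1 *\<^sub>R Y + z2 *\<^sub>R Z))"
proof (rule inj_comb3I)
  fix a b c assume "a *\<^sub>R s *\<^sub>R X + b *\<^sub>R (y1 *\<^sub>R Y + y2 *\<^sub>R Z) + c *\<^sub>R (z1 *\<^sub>R Y + z2 *\<^sub>R Z) = 0"
  then have "(a * s) *\<^sub>R X + (b * y1 + c * z1) *\<^sub>R Y + (b * y2 + c * z2) *\<^sub>R Z = 0"
    by (simp add: algebra_simps)
  from inj_comb3D[OF inj this] have *: "a * s = 0" "b * y1 + c * z1 = 0" "b * y2 + c * z2 = 0" by auto
  have "b * (y1 * z2 - y2 * z1) = (b * y1 + c * z1) * z2 - (b * y2 + c * z2) * z1"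
    "c * (y1 * z2 - y2 * z1) = (b * y2 + c * z2) * y1 - (b * y1 + c * z1) * y2"
    by (simp_all add: algebra_simps)
  then have "b * (y1 * z2 - y2 * z1) = 0" "c * (y1 * z2 - y2 * z1) = 0"
    unfolding *(2,3) by simp_all
  then show "a = 0 \<and> b = 0 \<and> c = 0" using *(1) assms by (metis mult_eq_0_iff)
qed

lemma br_change_YZ: "br (y1 *\<^sub>R Y + y2 *\<^sub>R Z) (z1 *\<^sub>R Y + z2 *\<^sub>R Z) = 0"
  using YZ br_alt[of Z Y] by (simp add: br_simps)

lemma br_change_X:
  "br (s *\<^sub>R X) (y1 *\<^sub>R Y + y2 *\<^sub>R Z) =
    (s * (m11 * y1 + m12 * y2)) *\<^sub>R Y + (s * (m21 * y1 + m22 * y2)) *\<^sub>R Z"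
  by (simp add: br_simps XY XZ algebra_simps)

text \<open>The double eigenvalue is half the trace, so with \<open>s = 2 / (m11 + m22)\<close> the
  matrix of \<open>s X\<close> is \<open>1 + n\<close> with \<open>n\<close> of square zero. If
  \<open>n = 0\<close> the algebra is \<open>r3_par 1\<close>, otherwise \<open>r3\<close>.\<close>

lemma classified_double_eigenvalue:
  assumes tr: "m11 + m22 \<noteq> 0" and disc: "(m11 + m22)\<^sup>2 = 4 * (m11 * m22 - m12 * m21)"
  shows "classified br"
proof -
  define s where "s = 2 / (m11 + m22)"
  have s: "s \<noteq> 0" "s * (m11 + m22) = 2" using tr nonzero_eq_divide_eq[OF tr, of s 2] by (simp_all add: s_def)
  define n11 n12 n21 n22 where n: "n11 = s * m11 - 1" "n12 = s * m12" "n21 = s * m21" "n22 = s * m22 - 1"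
  have n22: "n22 = - n11" using s(2) by (simp add: n algebra_simps)
  have nn: "n11 * n11 + n12 * n21 = 0"
  proof -
    have e: "s * m22 = 2 - s * m11" using s(2) by (simp add: algebra_simps)
    have "s\<^sup>2 * (m11 + m22)\<^sup>2 = 4 * ((s * m11) * (s * m22) - s * m12 * (s * m21))"
      unfolding disc by (simp add: algebra_simps power2_eq_square)
    then have "4 = 4 * ((s * m11) * (2 - s * m11) - s * m12 * (s * m21))"
      unfolding e power_mult_distrib[symmetric] s(2) by simp
    then show ?thesis by (simp add: n algebra_simps)
  qed
  have m: "s * m11 = n11 + 1" "s * m12 = n12" "s * m21 = n21" "s * m22 = - n11 + 1"
    using n22 by (simp_all add: n)
  have act: "br (s *\<^sub>R X) (y1 *\<^sub>R Y + y2 *\<^sub>R Z) =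
     (n11 * y1 + n12 * y2 + y1) *\<^sub>R Y + (n21 * y1 - n11 * y2 + y2) *\<^sub>R Z" for y1 y2
  proof -
    have "s * (m11 * y1 + m12 * y2) = (s * m11) * y1 + (s * m12) * y2"
      "s * (m21 * y1 + m22 * y2) = (s * m21) * y1 + (s * m22) * y2" by (simp_all add: algebra_simps)
    then have "s * (m11 * y1 + m12 * y2) = n11 * y1 + n12 * y2 + y1"
      "s * (m21 * y1 + m22 * y2) = n21 * y1 - n11 * y2 + y2" unfolding m by (simp_all add: algebra_simps)
    then show ?thesis unfolding br_change_X by (simp only:)
  qed
  show ?thesis
  proof (cases "n11 = 0 \<and> n12 = 0 \<and> n21 = 0")
    case True
    have "br (s *\<^sub>R X) (1 *\<^sub>R Y + 0 *\<^sub>R Z) = 1 *\<^sub>R Y + 0 *\<^sub>R Z" "br (s *\<^sub>R X) (0 *\<^sub>R Y + 1 *\<^sub>R Z) = 1 *\<^sub>R (0 *\<^sub>R Y + 1 *\<^sub>R Z)"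
      unfolding act using True by simp_all
    then show ?thesis
      unfolding classified_def using inj_change[of s 1 1 0 0] br_change_YZ[of 1 0 0 1] s(1)
      by (intro exI[of _ "s *\<^sub>R X"] exI[of _ "1 *\<^sub>R Y + 0 *\<^sub>R Z"] exI[of _ "0 *\<^sub>R Y + 1 *\<^sub>R Z"]) auto
  next
    case False
    \<comment> \<open>\<open>z\<close> is chosen such that \<open>n z\<close> and \<open>z\<close>
      are independent; they form a Jordan basis.\<close>
    obtain z1 z2 where z: "(n11 * z1 + n12 * z2) * z2 - (n21 * z1 - n11 * z2) * z1 \<noteq> 0"
    proof (cases "n12 = 0 \<and> n21 = 0")
      case True
      then show ?thesis using False nn that[of 1 1] by auto
    next
      case nz: False
      show ?thesis using nz that[of 1 0] that[of 0 1] by auto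
    qed
    define y1 y2 where y: "y1 = n11 * z1 + n12 * z2" "y2 = n21 * z1 - n11 * z2"
    have "br (s *\<^sub>R X) (z1 *\<^sub>R Y + z2 *\<^sub>R Z) = (y1 *\<^sub>R Y + y2 *\<^sub>R Z) + (z1 *\<^sub>R Y + z2 *\<^sub>R Z)"
      unfolding act y by (simp add: algebra_simps)
    moreover have "n11 * y1 + n12 * y2 = (n11 * n11 + n12 * n21) * z1"
      "n21 * y1 - n11 * y2 = (n11 * n11 + n12 * n21) * z2"
      unfolding y by (simp_all add: algebra_simps)
    then have "br (s *\<^sub>R X) (y1 *\<^sub>R Y + y2 *\<^sub>R Z) = y1 *\<^sub>R Y + y2 *\<^sub>R Z" unfolding act nn by simp
    ultimately show ?thesis
      unfolding classified_def using inj_change[OF s(1) z[folded y]] br_change_YZ by blast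
  qed
qed

text \<open>By Cayley-Hamilton the square of the matrix is the scalar \<open>D\<close>, the negative
  of its determinant. Scaled by \<open>1 / sqrt \<bar>D\<bar>\<close>, the matrix has square 1 or
  -1, which gives \<open>r3_par (- 1)\<close> or \<open>r3'_par 0\<close>.\<close>

lemma classified_trace_zero:
  assumes tr: "m11 + m22 = 0" and det: "m11 * m22 - m12 * m21 \<noteq> 0"
  shows "classified br"
proof -
  have m22: "m22 = - m11" using tr by simp
  define D where "D = m11 * m11 + m12 * m21"
  have D: "D \<noteq> 0" using det by (simp add: m22 D_def)
  define s where "s = 1 / sqrt \<bar>D\<bar>"
  have s: "s \<noteq> 0" "s * s * \<bar>D\<bar> = 1" using D by (simp_all add: s_def)
  define a b c where m: "a = s * m11" "b = s * m12" "c = s * m21"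
  have abc: "a * a + b * c = s * s * D" by (simp add: m D_def algebra_simps)
  have act: "br (s *\<^sub>R X) (y1 *\<^sub>R Y + y2 *\<^sub>R Z) = (a * y1 + b * y2) *\<^sub>R Y + (c * y1 - a * y2) *\<^sub>R Z" for y1 y2
    unfolding br_change_X by (simp add: m m22 algebra_simps)
  show ?thesis
  proof (cases "D > 0")
    case False
    then have abc: "a * a + b * c = - 1" using s(2) D abc by simp
    have c: "c \<noteq> 0"
    proof
      assume "c = 0"
      then have "a * a = -1" using abc by simp
      then show False using zero_le_square[of a] by linarith
    qed
    \<comment> \<open>The new basis of the plane is \<open>Y\<close> and minus its image under the
      scaled \<open>X\<close>; \<open>c \<noteq> 0\<close> makes them independent.\<close>
    have "br (s *\<^sub>R X) (1 *\<^sub>R Y + 0 *\<^sub>R Z) = - ((- a) *\<^sub>R Y + (- c) *\<^sub>R Z)" unfolding act by simp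
    moreover have "br (s *\<^sub>R X) ((- a) *\<^sub>R Y + (- c) *\<^sub>R Z) = 1 *\<^sub>R Y + 0 *\<^sub>R Z"
    proof -
      have "a * - a + b * - c = 1" "c * - a - a * - c = 0" using abc by (simp_all add: algebra_simps)
      then show ?thesis unfolding act by simp
    qed
    moreover have "1 * - c - 0 * - a \<noteq> 0" using c by simp
    ultimately show ?thesis
      unfolding classified_def using inj_change[OF s(1)] br_change_YZ by blast
  next
    case True
    then have abc: "a * a + b * c = 1" using s(2) abc by simp
    obtain y1 y2 z1 z2 where yz: "y1 * z2 - y2 * z1 \<noteq> 0"
      "a * y1 + b * y2 = y1" "c * y1 - a * y2 = y2" "a * z1 + b * z2 = - z1" "c * z1 - a * z2 = - z2"
    proof (cases "c = 0")
      case False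
      \<comment> \<open>As the square of the matrix is 1, the columns of the matrix plus 1 and minus
        1 are eigenvectors for 1 and -1. Here the first columns are taken.\<close>
      have "a * (1 + a) + b * c = 1 + a" "c * (1 + a) - a * c = c" "a * (a - 1) + b * c = - (a - 1)"
        "c * (a - 1) - a * c = - c" using abc by (simp_all add: algebra_simps)
      moreover have "(1 + a) * c - c * (a - 1) \<noteq> 0" using False by (simp add: algebra_simps)
      ultimately show ?thesis using that by blast
    next
      case c: True
      then have "a = 1 \<or> a = -1" using abc by (simp add: square_eq_1_iff)
      then show ?thesis
      proof
        assume a: "a = 1" show ?thesis by (rule that[of 1 "-2" 0 b]) (simp_all add: a c)
      next
        assume a: "a = -1" show ?thesis by (rule that[of b 0 2 1]) (simp_all add: a c)
      qed
    qed
    have "br (s *\<^sub>R X) (y1 *\<^sub>R Y + y2 *\<^sub>R Z) = y1 *\<^sub>R Y + y2 *\<^sub>R Z"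
      "br (s *\<^sub>R X) (z1 *\<^sub>R Y + z2 *\<^sub>R Z) = (-1) *\<^sub>R (z1 *\<^sub>R Y + z2 *\<^sub>R Z)"
      unfolding act yz by (simp_all add: algebra_simps)
    then show ?thesis
      unfolding classified_def using inj_change[OF s(1) yz(1)] br_change_YZ by blast
  qed
qed

end

end

section \<open>Left-symmetric products on the plane and traceless 2 x 2 matrices\<close>

text \<open>A two-dimensional left-symmetric algebra with left multiplications \<open>(a, b; c, d)\<close> and \<open>(e, f; g, h)\<close>
  whose right multiplications \<open>R\<^sub>w\<close> have no nonzero real eigenvalue. The form \<open>\<tau>(u w)\<close>, where \<open>\<tau>(w)\<close> is the
  trace of \<open>R\<^sub>w\<close>, is symmetric with matrix \<open>(s11, s12; s12, s22)\<close>; if \<open>\<tau>(u w) = \<tau>(u)\<close> for some \<open>w\<close> and all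
  \<open>u\<close>, then \<open>\<tau> = 0\<close>, since otherwise \<open>R\<^sub>w\<close> has the eigenvalue \<open>1\<close>.\<close>

lemma two_dim_trace_zero:
  fixes a b c d e f g h :: real
  assumes nz: "\<And>x y. (1 + a*x + b*y) * (1 + g*x + h*y) - (e*x + f*y) * (c*x + d*y) \<noteq> 0"
    and eq1: "(b - e) * a + (d - g) * e = b*g - f*c"
    and eq4: "(b - e) * d + (d - g) * h = c*f - g*b"
  shows "a + g = 0" "b + h = 0"
proof -
  define S T where "S = a + g" and "T = b + h"
  define s11 s12 s22 where s: "s11 = S*a + T*c" "s12 = S*b + T*d" "s22 = S*f + T*h"
  \<comment> \<open>The sum of \<open>eq1\<close> and \<open>eq4\<close> says that left
    multiplication by the commutator of the basis vectors has trace 0. Left and right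
    multiplications differ by the adjoint map, which is traceless there too.\<close>
  have sym: "s12 = S*e + T*g"
  proof -
    have "S*b + T*d - (S*e + T*g) = ((b - e) * a + (d - g) * e) + ((b - e) * d + (d - g) * h)"
      by (simp add: S_def T_def algebra_simps)
    also have "\<dots> = 0" unfolding eq1 eq4 by simp
    finally show ?thesis by (simp add: s)
  qed
  have left: "S = 0 \<and> T = 0" if "s11*x + s12*y = S" "s12*x + s22*y = T" for x y
  proof -
    let ?p = "1 - (a*x + b*y)" and ?q = "- (e*x + f*y)" and ?r = "- (c*x + d*y)" and ?t = "1 - (g*x + h*y)"
    have "S * ?p + T * ?r = S - (s11*x + s12*y)" "S * ?q + T * ?t = T - ((S*e + T*g)*x + s22*y)"
      by (simp_all add: s algebra_simps)
    then have l: "S * ?p + T * ?r = 0" "S * ?q + T * ?t = 0"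
      unfolding sym[symmetric] that by simp_all
    have "S * (?p * ?t - ?q * ?r) = (S * ?p + T * ?r) * ?t - (S * ?q + T * ?t) * ?r"
      "T * (?p * ?t - ?q * ?r) = (S * ?q + T * ?t) * ?p - (S * ?p + T * ?r) * ?q"
      by (simp_all add: algebra_simps)
    then have "S * (?p * ?t - ?q * ?r) = 0" "T * (?p * ?t - ?q * ?r) = 0" unfolding l by simp_all
    moreover have "?p * ?t - ?q * ?r \<noteq> 0" using nz[of "- x" "- y"] by (simp add: algebra_simps)
    ultimately show ?thesis by simp
  qed
  \<comment> \<open>For \<open>w = (x, y)\<close> in the radical, \<open>\<tau>\<close> vanishes on
    the image of \<open>R\<^sub>w\<close>. If \<open>\<tau>(w)\<close> were nonzero,
    \<open>R\<^sub>w\<close> would be singular, and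
    \<open>det (1 + k R\<^sub>w) = 1 + k \<tau>(w)\<close> would have a zero.\<close>
  have null: "S*x + T*y = 0" if "s11*x + s12*y = 0" "s12*x + s22*y = 0" for x y
  proof (rule ccontr)
    assume n: "S*x + T*y \<noteq> 0"
    let ?p = "a*x + b*y" and ?q = "e*x + f*y" and ?r = "c*x + d*y" and ?t = "g*x + h*y"
    have "S * ?p + T * ?r = s11*x + s12*y" "S * ?q + T * ?t = (S*e + T*g)*x + s22*y"
      by (simp_all add: s algebra_simps)
    then have l: "S * ?p + T * ?r = 0" "S * ?q + T * ?t = 0"
      unfolding sym[symmetric] that by simp_all
    have "S * (?p * ?t - ?q * ?r) = (S * ?p + T * ?r) * ?t - (S * ?q + T * ?t) * ?r"
      "T * (?p * ?t - ?q * ?r) = (S * ?q + T * ?t) * ?p - (S * ?p + T * ?r) * ?q"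
      by (simp_all add: algebra_simps)
    then have "S * (?p * ?t - ?q * ?r) = 0" "T * (?p * ?t - ?q * ?r) = 0" unfolding l by simp_all
    then have det: "?p * ?t - ?q * ?r = 0" using n by auto
    define k where "k = - 1 / (S*x + T*y)"
    have k: "k * (S*x + T*y) = -1" using n by (simp add: k_def)
    have "(1 + a*(k*x) + b*(k*y)) * (1 + g*(k*x) + h*(k*y)) - (e*(k*x) + f*(k*y)) * (c*(k*x) + d*(k*y)) =
      1 + k * (S*x + T*y) + k * k * (?p * ?t - ?q * ?r)"
      by (simp add: S_def T_def algebra_simps)
    then show False using nz[of "k*x" "k*y"] unfolding det k by simp
  qed
  have "S = 0 \<and> T = 0"
  proof (cases "s11 * s22 - s12 * s12 = 0")
    case False
    let ?D = "s11 * s22 - s12 * s12"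
    show ?thesis
    proof (rule left[of "(S * s22 - T * s12) / ?D" "(T * s11 - S * s12) / ?D"])
      have "s11 * (S * s22 - T * s12) + s12 * (T * s11 - S * s12) = S * ?D"
        "s12 * (S * s22 - T * s12) + s22 * (T * s11 - S * s12) = T * ?D" by (simp_all add: algebra_simps)
      then show "s11 * ((S * s22 - T * s12) / ?D) + s12 * ((T * s11 - S * s12) / ?D) = S"
        "s12 * ((S * s22 - T * s12) / ?D) + s22 * ((T * s11 - S * s12) / ?D) = T"
        using False by (simp_all add: add_divide_distrib[symmetric])
    qed
  next
    case True
    \<comment> \<open>The radical of the degenerate form contains \<open>(s12, - s11)\<close> and
      \<open>(s22, - s12)\<close>. So \<open>\<tau>\<close> is a multiple of any nonzero row, and a
      nonzero diagonal entry solves \<open>\<tau>(u w) = \<tau>(u)\<close>.\<close>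
    have 1: "S * s12 = T * s11"
      using null[of "s12" "- s11"] True by (simp add: algebra_simps)
    have 2: "S * s22 = T * s12"
      using null[of "s22" "- s12"] True by (simp add: algebra_simps)
    consider "s11 \<noteq> 0" | "s22 \<noteq> 0" | "s11 = 0" "s22 = 0" by blast
    then show ?thesis
    proof cases
      case 1
      show ?thesis by (rule left[of "S / s11" 0]) (use 1 \<open>S * s12 = T * s11\<close> in \<open>simp_all add: field_simps\<close>)
    next
      case 2
      show ?thesis by (rule left[of 0 "T / s22"]) (use 2 \<open>S * s22 = T * s12\<close> in \<open>simp_all add: field_simps\<close>)
    next
      case 3
      then have "s12 = 0" using True by simp
      then show ?thesis using null[of 1 0] null[of 0 1] 3 by simp
    qed
  qed
  then show "a + g = 0" "b + h = 0" by (simp_all add: S_def T_def)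
qed

text \<open>For \<open>M = (k, l; m, -k)\<close> and \<open>N = (x1, x2; x3, -x1)\<close> the
  hypotheses say \<open>[M, [M, N]] = D N\<close>. Since
  \<open>[M, [M, N]] = 4 D N - 2 \<tau> M\<close> with \<open>\<tau> = tr (M N)\<close>,
  \<open>N\<close> is a multiple of \<open>M\<close>; then the double commutator is 0, and so is
  \<open>N\<close>.\<close>

lemma traceless_double_commutator_zero:
  fixes x1 x2 x3 k l m :: real
  assumes D: "k*k + l*m \<noteq> 0"
    and 1: "(k*k + l*m) * x1 = 4*l*m*x1 - 2*k*(m*x2 + l*x3)"
    and 2: "(k*k + l*m) * x2 = 2*l*(m*x2 - l*x3) - 4*k*(l*x1 - k*x2)"
    and 3: "(k*k + l*m) * x3 = 4*k*(k*x3 - m*x1) - 2*m*(m*x2 - l*x3)"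
  shows "x1 = 0 \<and> x2 = 0 \<and> x3 = 0"
proof -
  define D \<tau> where d: "D = k*k + l*m" "\<tau> = 2*k*x1 + m*x2 + l*x3"
  have e: "3 * D * x1 = 2*\<tau>*k" "3 * D * x2 = 2*\<tau>*l" "3 * D * x3 = 2*\<tau>*m"
    using 1 2 3 by (simp_all add: d algebra_simps)
  have "3 * D * (m*x2 - l*x3) = m * (3 * D * x2) - l * (3 * D * x3)"
    "3 * D * (l*x1 - k*x2) = l * (3 * D * x1) - k * (3 * D * x2)"
    "3 * D * (k*x3 - m*x1) = k * (3 * D * x3) - m * (3 * D * x1)"
    by (simp_all add: algebra_simps)
  then have "3 * D * (m*x2 - l*x3) = 0" "3 * D * (l*x1 - k*x2) = 0" "3 * D * (k*x3 - m*x1) = 0"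
    unfolding e by (simp_all add: algebra_simps)
  then have z: "m*x2 - l*x3 = 0" "l*x1 - k*x2 = 0" "k*x3 - m*x1 = 0" using D by (simp_all add: d)
  have "D * x1 = 2*m*(l*x1 - k*x2) - 2*l*(k*x3 - m*x1)" using 1 by (simp add: d algebra_simps)
  then show ?thesis using D 2 3 unfolding z by (simp add: d)
qed

text \<open>With \<open>M\<close> the traceless matrix \<open>(k, l; m, -k)\<close>, the hypotheses say \<open>k B + m B' + p M = [M, B]\<close> and
  \<open>l B - k B' + q M = [M, B']\<close> for the traceless matrices \<open>B = (a, b; c, -a)\<close> and \<open>B' = (e, f; g, -e)\<close>.
  After subtracting the multiples of \<open>M\<close>, both are fixed by \<open>[M, [M, _]] / D\<close> where \<open>D = - det M\<close>, but
  this operator has the eigenvalues \<open>0\<close> and \<open>4\<close> only.\<close>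

lemma traceless_commutant:
  fixes a b c e f g k l m p q :: real
  assumes D: "k*k + l*m \<noteq> 0"
    and eqs: "- k*a - m*e - p*k = b*m - l*c" "- k*b - m*f - p*l = 2*a*l - 2*k*b" "- k*c - m*g - p*m = 2*c*k - 2*a*m"
      "- l*a + k*e - q*k = f*m - l*g" "- l*b + k*f - q*l = 2*e*l - 2*k*f" "- l*c + k*g - q*m = 2*g*k - 2*e*m"
  obtains \<beta> \<gamma> where "a = \<beta> * k" "b = \<beta> * l" "c = \<beta> * m" "e = \<gamma> * k" "f = \<gamma> * l" "g = \<gamma> * m"
    "p = - (k*\<beta> + m*\<gamma>)" "q = - (l*\<beta> - k*\<gamma>)"
proof -
  \<comment> \<open>The last two conclusions are linear equations for \<open>\<beta>\<close> and
    \<open>\<gamma>\<close> with the transpose of \<open>M\<close> as matrix. It squares to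
    \<open>k*k + l*m\<close>, so it is its own inverse up to this factor.\<close>
  define \<beta> \<gamma> where \<beta>: "\<beta> = - (k*p + m*q) / (k*k + l*m)" "\<gamma> = - (l*p - k*q) / (k*k + l*m)"
  have DB: "(k*k + l*m) * \<beta> = - (k*p + m*q)" "(k*k + l*m) * \<gamma> = - (l*p - k*q)"
    using D by (simp_all add: \<beta>)
  have "(k*k + l*m) * (k*\<beta> + m*\<gamma>) = k * ((k*k + l*m) * \<beta>) + m * ((k*k + l*m) * \<gamma>)"
    "(k*k + l*m) * (l*\<beta> - k*\<gamma>) = l * ((k*k + l*m) * \<beta>) - k * ((k*k + l*m) * \<gamma>)"
    by (simp_all add: algebra_simps)
  then have "(k*k + l*m) * (k*\<beta> + m*\<gamma>) = (k*k + l*m) * (- p)" "(k*k + l*m) * (l*\<beta> - k*\<gamma>) = (k*k + l*m) * (- q)"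
    unfolding DB by (simp_all add: algebra_simps)
  then have "k*\<beta> + m*\<gamma> = - p" "l*\<beta> - k*\<gamma> = - q" unfolding mult_left_cancel[OF D] by simp_all
  then have pq: "p = - (k*\<beta> + m*\<gamma>)" "q = - (l*\<beta> - k*\<gamma>)" by simp_all
  define x1 x2 x3 y1 y2 y3 where x: "x1 = a - \<beta>*k" "x2 = b - \<beta>*l" "x3 = c - \<beta>*m"
    "y1 = e - \<gamma>*k" "y2 = f - \<gamma>*l" "y3 = g - \<gamma>*m"
  have H: "k*x1 + m*y1 = l*x3 - m*x2" "k*x2 + m*y2 = 2*k*x2 - 2*l*x1" "k*x3 + m*y3 = 2*m*x1 - 2*k*x3"
    "l*x1 - k*y1 = l*y3 - m*y2" "l*x2 - k*y2 = 2*k*y2 - 2*l*y1" "l*x3 - k*y3 = 2*m*y1 - 2*k*y3"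
    using eqs by (simp_all add: x pq algebra_simps)
  \<comment> \<open>With \<open>N\<close> and \<open>N'\<close> for the matrices of the
    \<open>x\<close> and the \<open>y\<close>, \<open>H\<close> reads
    \<open>k N + m N' = [M, N]\<close> and \<open>l N - k N' = [M, N']\<close>. Hence
    \<open>D N = k [M, N] + m [M, N'] = [M, [M, N]]\<close>, and similarly for
    \<open>N'\<close>.\<close>
  have "x1 = 0 \<and> x2 = 0 \<and> x3 = 0"
  proof (rule traceless_double_commutator_zero[OF D])
    have "(k*k + l*m) * x1 = k*(k*x1 + m*y1) + m*(l*x1 - k*y1)" by (simp add: algebra_simps)
    also have "\<dots> = l*(k*x3 + m*y3) - m*(k*x2 + m*y2)" unfolding H(1,4) by (simp add: algebra_simps)
    finally show "(k*k + l*m) * x1 = 4*l*m*x1 - 2*k*(m*x2 + l*x3)" unfolding H by (simp add: algebra_simps)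
    have "(k*k + l*m) * x2 = k*(k*x2 + m*y2) + m*(l*x2 - k*y2)" by (simp add: algebra_simps)
    also have "\<dots> = k*(2*k*x2 - 2*l*x1) + m*(2*k*y2 - 2*l*y1)" by (simp only: H(2,5))
    also have "\<dots> = 2*k*(k*x2 + m*y2) - 2*l*(k*x1 + m*y1)" by (simp add: algebra_simps)
    finally show "(k*k + l*m) * x2 = 2*l*(m*x2 - l*x3) - 4*k*(l*x1 - k*x2)" unfolding H by (simp add: algebra_simps)
    have "(k*k + l*m) * x3 = k*(k*x3 + m*y3) + m*(l*x3 - k*y3)" by (simp add: algebra_simps)
    also have "\<dots> = k*(2*m*x1 - 2*k*x3) + m*(2*m*y1 - 2*k*y3)" by (simp only: H(3,6))
    also have "\<dots> = 2*m*(k*x1 + m*y1) - 2*k*(k*x3 + m*y3)" by (simp add: algebra_simps)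
    finally show "(k*k + l*m) * x3 = 4*k*(k*x3 - m*x1) - 2*m*(m*x2 - l*x3)" unfolding H by (simp add: algebra_simps)
  qed
  moreover have "y1 = 0 \<and> y2 = 0 \<and> y3 = 0"
  proof (rule traceless_double_commutator_zero[OF D])
    have "(k*k + l*m) * y1 = l*(k*x1 + m*y1) - k*(l*x1 - k*y1)" by (simp add: algebra_simps)
    also have "\<dots> = l*(l*x3 - k*y3) - m*(l*x2 - k*y2)" unfolding H(1,4) by (simp add: algebra_simps)
    finally show "(k*k + l*m) * y1 = 4*l*m*y1 - 2*k*(m*y2 + l*y3)" unfolding H by (simp add: algebra_simps)
    have "(k*k + l*m) * y2 = l*(k*x2 + m*y2) - k*(l*x2 - k*y2)" by (simp add: algebra_simps)
    also have "\<dots> = l*(2*k*x2 - 2*l*x1) - k*(2*k*y2 - 2*l*y1)" by (simp only: H(2,5))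
    also have "\<dots> = 2*k*(l*x2 - k*y2) - 2*l*(l*x1 - k*y1)" by (simp add: algebra_simps)
    finally show "(k*k + l*m) * y2 = 2*l*(m*y2 - l*y3) - 4*k*(l*y1 - k*y2)" unfolding H by (simp add: algebra_simps)
    have "(k*k + l*m) * y3 = l*(k*x3 + m*y3) - k*(l*x3 - k*y3)" by (simp add: algebra_simps)
    also have "\<dots> = l*(2*m*x1 - 2*k*x3) - k*(2*m*y1 - 2*k*y3)" by (simp only: H(3,6))
    also have "\<dots> = 2*m*(l*x1 - k*y1) - 2*k*(l*x3 - k*y3)" by (simp add: algebra_simps)
    finally show "(k*k + l*m) * y3 = 4*k*(k*y3 - m*y1) - 2*m*(m*y2 - l*y3)" unfolding H by (simp add: algebra_simps)
  qed
  ultimately show ?thesis using that[of \<beta> \<gamma>] pq by (simp add: x)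
qed

section \<open>The coefficients of \<open>\<delta>\<close> and the determinant without zeros\<close>

lemma affine_nonvanishing:
  fixes P Q :: real
  assumes "\<And>z. P + z * Q \<noteq> 0" shows "Q = 0"
proof (rule ccontr)
  assume "Q \<noteq> 0"
  then have "P + (- P / Q) * Q = 0" by simp
  then show False using assms by blast
qed

lemma axis3_nth [simp]:
  "e1 $ 1 = 1" "e1 $ 2 = 0" "e1 $ 3 = 0" "e2 $ 1 = 0" "e2 $ 2 = 1" "e2 $ 3 = 0"
  "e3 $ 1 = 0" "e3 $ 2 = 0" "e3 $ 3 = (1::real)"
  by (simp_all add: axis_def)

lemma vec3_expand: "(x::real^3) = x $ 1 *\<^sub>R e1 + x $ 2 *\<^sub>R e2 + x $ 3 *\<^sub>R e3"
  by (simp add: vec_eq_iff forall_3)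

lemma vec3_eqI: "(x::real^3) $ 1 = y $ 1 \<Longrightarrow> x $ 2 = y $ 2 \<Longrightarrow> x $ 3 = y $ 3 \<Longrightarrow> x = y"
  by (simp add: vec_eq_iff forall_3)

lemma h3_bracket_nth [simp]:
  "lie_bracket h3 x y $ 1 = 0" "lie_bracket h3 x y $ 2 = 0"
  "lie_bracket h3 x y $ 3 = x$1 * y$2 - x$2 * y$1"
  by (simp_all add: h3_bracket)

text \<open>\<open>v \<mapsto> v + \<delta> v w + [v,w]/2\<close> is the differential of right translation by \<open>w\<close>.\<close>

locale post_lie =
  fixes \<delta> :: "real^3 \<Rightarrow> real^3 \<Rightarrow> real^3"
  assumes lin1: "linear (\<lambda>v. \<delta> v u)" and lin2: "linear (\<delta> v)"
    and derivation: "\<delta> v (lie_bracket h3 u w) = lie_bracket h3 (\<delta> v u) w + lie_bracket h3 u (\<delta> v w)"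
    and hom: "\<delta> ((\<delta> v w + (1/2) *\<^sub>R lie_bracket h3 v w) - (\<delta> w v + (1/2) *\<^sub>R lie_bracket h3 w v)) u =
        \<delta> v (\<delta> w u) - \<delta> w (\<delta> v u)"
    and right_inj: "v + (\<delta> v w + (1/2) *\<^sub>R lie_bracket h3 v w) = 0 \<Longrightarrow> v = 0"
begin

definition pbr :: "real^3 \<Rightarrow> real^3 \<Rightarrow> real^3" where
  "pbr v w = (\<delta> v w + (1/2) *\<^sub>R lie_bracket h3 v w) - (\<delta> w v + (1/2) *\<^sub>R lie_bracket h3 w v)"

sublocale alternating_bracket pbr
proof (rule alternating_bracket.intro)
  show "linear (pbr u)" for u
    unfolding pbr_def
    by (intro linear_compose_sub linear_compose_add lin1 lin2 linear_compose_scale_right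
        bounded_linear.linear[OF bounded_bilinear.bounded_linear_right[OF bounded_bilinear_h3_bracket]]
        bounded_linear.linear[OF bounded_bilinear.bounded_linear_left[OF bounded_bilinear_h3_bracket]])
  show "pbr u v = - pbr v u" for u v by (simp add: pbr_def)
qed

definition a where "a v = \<delta> v e1 $ 1"
definition b where "b v = \<delta> v e2 $ 1"
definition c where "c v = \<delta> v e1 $ 2"
definition d where "d v = \<delta> v e2 $ 2"
definition p where "p v = \<delta> v e1 $ 3"
definition q where "q v = \<delta> v e2 $ 3"

text \<open>The derivation rule for \<open>e3 = [e1, e2]\<close> makes \<open>e3\<close> an
  eigenvector of \<open>\<delta> v\<close>, with the trace of the block \<open>(a, b; c, d)\<close>
  as eigenvalue.\<close>

lemma \<delta>_nth:
  "\<delta> v u $ 1 = a v * u$1 + b v * u$2" "\<delta> v u $ 2 = c v * u$1 + d v * u$2"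
  "\<delta> v u $ 3 = p v * u$1 + q v * u$2 + (a v + d v) * u$3"
proof -
  have "lie_bracket h3 e1 e2 = e3" by (rule vec3_eqI) simp_all
  then have "\<delta> v e3 = lie_bracket h3 (\<delta> v e1) e2 + lie_bracket h3 e1 (\<delta> v e2)"
    using derivation[of v e1 e2] by simp
  then have e3: "\<delta> v e3 $ 1 = 0" "\<delta> v e3 $ 2 = 0" "\<delta> v e3 $ 3 = a v + d v"
    by (simp_all add: a_def d_def)
  have "\<delta> v u = \<delta> v (u $ 1 *\<^sub>R e1 + u $ 2 *\<^sub>R e2 + u $ 3 *\<^sub>R e3)" using vec3_expand[of u] by simp
  then have "\<delta> v u = u $ 1 *\<^sub>R \<delta> v e1 + u $ 2 *\<^sub>R \<delta> v e2 + u $ 3 *\<^sub>R \<delta> v e3"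
    by (simp only: linear_add[OF lin2] linear_scale[OF lin2])
  then show "\<delta> v u $ 1 = a v * u$1 + b v * u$2" "\<delta> v u $ 2 = c v * u$1 + d v * u$2"
    "\<delta> v u $ 3 = p v * u$1 + q v * u$2 + (a v + d v) * u$3"
    by (simp_all add: e3 a_def b_def c_def d_def p_def q_def)
qed

text \<open>In the basis \<open>e1, e2, e3\<close>, \<open>\<delta> v\<close> has the rows \<open>(a, b, 0)\<close>, \<open>(c, d, 0)\<close> and \<open>(p, q, a + d)\<close>.\<close>

lemma coeff_expand:
  "f v = v$1 * f e1 + v$2 * f e2 + v$3 * f e3" if "f \<in> {a, b, c, d}"
proof -
  have "\<delta> v u = \<delta> (v $ 1 *\<^sub>R e1 + v $ 2 *\<^sub>R e2 + v $ 3 *\<^sub>R e3) u" for u using vec3_expand[of v] by simp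
  then have "\<delta> v u = v $ 1 *\<^sub>R \<delta> e1 u + v $ 2 *\<^sub>R \<delta> e2 u + v $ 3 *\<^sub>R \<delta> e3 u" for u
    by (simp only: linear_add[OF lin1] linear_scale[OF lin1])
  then show ?thesis using that by (auto simp: a_def b_def c_def d_def)
qed

text \<open>The entries of \<open>B (pbr v w) = [B v, B w]\<close> for the block
  \<open>B = (a, b; c, d)\<close>, that is, for the action modulo the center.\<close>

lemma hom_coeff:
  "a (pbr v w) = b v * c w - b w * c v"
  "b (pbr v w) = a v * b w + b v * d w - a w * b v - b w * d v"
  "c (pbr v w) = c v * a w + d v * c w - c w * a v - d w * c v"
  "d (pbr v w) = c v * b w - c w * b v"
proof -
  have h: "\<delta> (pbr v w) u = \<delta> v (\<delta> w u) - \<delta> w (\<delta> v u)" for u using hom by (simp add: pbr_def)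
  show "a (pbr v w) = b v * c w - b w * c v"
    "b (pbr v w) = a v * b w + b v * d w - a w * b v - b w * d v"
    "c (pbr v w) = c v * a w + d v * c w - c w * a v - d w * c v"
    "d (pbr v w) = c v * b w - c w * b v"
    unfolding a_def[of "pbr v w"] b_def[of "pbr v w"] c_def[of "pbr v w"] d_def[of "pbr v w"] h
    by (simp_all add: \<delta>_nth algebra_simps)
qed

lemma pbr_nth:
  "pbr e1 e2 $ 1 = b e1 - a e2" "pbr e1 e2 $ 2 = d e1 - c e2" "pbr e1 e2 $ 3 = q e1 - p e2 + 1"
  "pbr e1 e3 $ 1 = - a e3" "pbr e1 e3 $ 2 = - c e3" "pbr e1 e3 $ 3 = a e1 + d e1 - p e3"
  "pbr e2 e3 $ 1 = - b e3" "pbr e2 e3 $ 2 = - d e3" "pbr e2 e3 $ 3 = a e2 + d e2 - q e3"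
  by (simp_all add: pbr_def \<delta>_nth)

lemma pbr_expand:
  "pbr v w = (v$1 * w$2 - v$2 * w$1) *\<^sub>R pbr e1 e2 + (v$1 * w$3 - v$3 * w$1) *\<^sub>R pbr e1 e3 +
    (v$2 * w$3 - v$3 * w$2) *\<^sub>R pbr e2 e3"
proof -
  have "pbr v w = pbr (v$1 *\<^sub>R e1 + v$2 *\<^sub>R e2 + v$3 *\<^sub>R e3) (w$1 *\<^sub>R e1 + w$2 *\<^sub>R e2 + w$3 *\<^sub>R e3)"
    using vec3_expand[of v] vec3_expand[of w] by simp
  then show ?thesis
    using br_alt[of e2 e1] br_alt[of e3 e1] br_alt[of e3 e2]
    by (simp add: br_simps) (simp add: algebra_simps)
qed

lemma det_nonzero:
  fixes x y z :: real
  defines "m11 \<equiv> 1 + a e1 * x + b e1 * y" and "m12 \<equiv> a e2 * x + b e2 * y" and "m13 \<equiv> a e3 * x + b e3 * y"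
    and "m21 \<equiv> c e1 * x + d e1 * y" and "m22 \<equiv> 1 + c e2 * x + d e2 * y" and "m23 \<equiv> c e3 * x + d e3 * y"
    and "m31 \<equiv> p e1 * x + q e1 * y + (a e1 + d e1) * z + y / 2"
    and "m32 \<equiv> p e2 * x + q e2 * y + (a e2 + d e2) * z - x / 2"
    and "m33 \<equiv> 1 + p e3 * x + q e3 * y + (a e3 + d e3) * z"
  shows "m11 * (m22 * m33 - m23 * m32) - m12 * (m21 * m33 - m23 * m31) + m13 * (m21 * m32 - m22 * m31) \<noteq> 0"
proof -
  define w :: "real^3" where "w = vector [x, y, z]"
  have w: "w $ 1 = x" "w $ 2 = y" "w $ 3 = z" by (simp_all add: w_def)
  define f where "f = (\<lambda>v. v + (\<delta> v w + (1/2) *\<^sub>R lie_bracket h3 v w))"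
  have "linear f"
    unfolding f_def
    by (intro linear_compose_add linear_ident lin1 linear_compose_scale_right
        bounded_linear.linear[OF bounded_bilinear.bounded_linear_left[OF bounded_bilinear_h3_bracket]])
  moreover have "inj f"
    unfolding linear_injective_0[OF \<open>linear f\<close>]
  proof (intro allI impI)
    fix v assume "f v = 0"
    then show "v = 0" unfolding f_def by (rule right_inj)
  qed
  ultimately have "det (matrix f) \<noteq> 0" using det_nz_iff_inj by blast
  moreover have "matrix f $ i $ j = f (axis j 1) $ i" for i j by (simp add: matrix_def)
  ultimately have "f e1 $ 1 * f e2 $ 2 * f e3 $ 3 + f e2 $ 1 * f e3 $ 2 * f e1 $ 3 + f e3 $ 1 * f e1 $ 2 * f e2 $ 3 -
    f e1 $ 1 * f e3 $ 2 * f e2 $ 3 - f e2 $ 1 * f e1 $ 2 * f e3 $ 3 - f e3 $ 1 * f e2 $ 2 * f e1 $ 3 \<noteq> 0"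
    by (simp add: det_3)
  moreover have "f e1 $ 1 = m11" "f e2 $ 1 = m12" "f e3 $ 1 = m13" "f e1 $ 2 = m21" "f e2 $ 2 = m22"
    "f e3 $ 2 = m23" "f e1 $ 3 = m31" "f e2 $ 3 = m32" "f e3 $ 3 = m33"
    by (simp_all add: f_def \<delta>_nth w m11_def m12_def m13_def m21_def m22_def m23_def m31_def m32_def m33_def)
  ultimately have "m11 * m22 * m33 + m12 * m23 * m31 + m13 * m21 * m32 -
    m11 * m23 * m32 - m12 * m21 * m33 - m13 * m22 * m31 \<noteq> 0" by simp
  then show ?thesis by (simp add: algebra_simps)
qed

text \<open>At \<open>x = y = 0\<close> the determinant is
  \<open>1 + z * (a e3 + d e3)\<close>.\<close>

lemma trace_e3: "a e3 + d e3 = 0"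
  by (rule affine_nonvanishing[of 1]) (use det_nonzero[of 0 0] in \<open>simp add: algebra_simps\<close>)

text \<open>The row of the traces at \<open>e1\<close>, \<open>e2\<close> annihilates the block at
  \<open>e3\<close>. Up to sign, this product is the linear part in \<open>x\<close>,
  \<open>y\<close> of the coefficient of \<open>z\<close> in the determinant.\<close>

lemma trace_B3: "(a e1 + d e1) * a e3 + (a e2 + d e2) * c e3 = 0"
  "(a e1 + d e1) * b e3 + (a e2 + d e2) * d e3 = 0"
proof -
  let ?t1 = "a e1 + d e1" and ?t2 = "a e2 + d e2"
  let ?m11 = "\<lambda>x y. 1 + a e1 * x + b e1 * y" and ?m12 = "\<lambda>x y. a e2 * x + b e2 * y" and ?m13 = "\<lambda>x y. a e3 * x + b e3 * y"
  let ?m21 = "\<lambda>x y. c e1 * x + d e1 * y" and ?m22 = "\<lambda>x y. 1 + c e2 * x + d e2 * y" and ?m23 = "\<lambda>x y. c e3 * x + d e3 * y"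
  let ?n1 = "\<lambda>x y. p e1 * x + q e1 * y + y / 2" and ?n2 = "\<lambda>x y. p e2 * x + q e2 * y - x / 2"
  let ?m33 = "\<lambda>x y. 1 + p e3 * x + q e3 * y"
  have Q: "?m13 x y * (?m21 x y * ?t2 - ?m22 x y * ?t1) - ?m23 x y * (?m11 x y * ?t2 - ?m12 x y * ?t1) = 0" for x y
  proof (rule affine_nonvanishing)
    fix z
    let ?P = "?m11 x y * (?m22 x y * ?m33 x y - ?m23 x y * ?n2 x y) - ?m12 x y * (?m21 x y * ?m33 x y - ?m23 x y * ?n1 x y) +
      ?m13 x y * (?m21 x y * ?n2 x y - ?m22 x y * ?n1 x y)"
    have e: "A * (B * C - D * (N2 + T2 * z)) - E * (F * C - D * (N1 + T1 * z)) + H * (F * (N2 + T2 * z) - B * (N1 + T1 * z)) =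
      (A * (B * C - D * N2) - E * (F * C - D * N1) + H * (F * N2 - B * N1)) + z * (H * (F * T2 - B * T1) - D * (A * T2 - E * T1))"
      for A B C D E F H N1 N2 T1 T2 :: real by (simp add: algebra_simps)
    have "?m11 x y * (?m22 x y * ?m33 x y - ?m23 x y * (?n2 x y + ?t2 * z)) -
      ?m12 x y * (?m21 x y * ?m33 x y - ?m23 x y * (?n1 x y + ?t1 * z)) +
      ?m13 x y * (?m21 x y * (?n2 x y + ?t2 * z) - ?m22 x y * (?n1 x y + ?t1 * z)) \<noteq> 0"
      using det_nonzero[of x y z] by (simp add: trace_e3 add.commute add.left_commute diff_add_eq add_diff_eq)
    then show "?P + z * (?m13 x y * (?m21 x y * ?t2 - ?m22 x y * ?t1) - ?m23 x y * (?m11 x y * ?t2 - ?m12 x y * ?t1)) \<noteq> 0"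
      unfolding e .
  qed
  \<comment> \<open>Opposite arguments cancel the quadratic part of \<open>Q\<close>.\<close>
  show "?t1 * a e3 + ?t2 * c e3 = 0" using Q[of 1 0] Q[of "-1" 0] by (simp add: algebra_simps)
  show "?t1 * b e3 + ?t2 * d e3 = 0" using Q[of 0 1] Q[of 0 "-1"] by (simp add: algebra_simps)
qed

text \<open>All brackets lie in the span of \<open>e2\<close> and \<open>e3\<close>, on which
  \<open>e1\<close> acts by a traceless matrix of square zero.\<close>

lemma two_step:
  assumes "pbr e1 e2 = x1 *\<^sub>R e2 + x2 *\<^sub>R e3" "pbr e1 e3 = y1 *\<^sub>R e2 - x1 *\<^sub>R e3" "pbr e2 e3 = 0"
    and "x1 * x1 + x2 * y1 = 0"
  shows "pbr u (pbr v w) = 0"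
proof -
  have n: "pbr v w $ 1 = 0" "pbr v w $ 2 = (v$1 * w$2 - v$2 * w$1) * x1 + (v$1 * w$3 - v$3 * w$1) * y1"
    "pbr v w $ 3 = (v$1 * w$2 - v$2 * w$1) * x2 - (v$1 * w$3 - v$3 * w$1) * x1" for v w
    unfolding pbr_expand[of v w] assms by simp_all
  have z: "x1 * ((s * x1) + t * y1) + y1 * (s * x2 - t * x1) = s * (x1 * x1 + x2 * y1)"
    "x2 * ((s * x1) + t * y1) - x1 * (s * x2 - t * x1) = t * (x1 * x1 + x2 * y1)" for s t :: real
    by (simp_all add: algebra_simps)
  show ?thesis
  proof (rule vec3_eqI)
    let ?s = "v$1 * w$2 - v$2 * w$1" and ?t = "v$1 * w$3 - v$3 * w$1"
    have "pbr u (pbr v w) $ 2 = u$1 * (x1 * (?s * x1 + ?t * y1) + y1 * (?s * x2 - ?t * x1))"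
      unfolding n(2)[of u] n by (simp add: algebra_simps)
    then show "pbr u (pbr v w) $ 2 = 0 $ 2" unfolding z assms by simp
    have "pbr u (pbr v w) $ 3 = u$1 * (x2 * (?s * x1 + ?t * y1) - x1 * (?s * x2 - ?t * x1))"
      unfolding n(3)[of u] n by (simp add: algebra_simps)
    then show "pbr u (pbr v w) $ 3 = 0 $ 3" unfolding z assms by simp
  qed (simp add: n)
qed

text \<open>The blocks at \<open>e1\<close> and \<open>e2\<close> define a left-symmetric product on
  the plane modulo the center, and the determinant factors, so \<open>two_dim_trace_zero\<close>
  applies. It expresses the brackets through the traces \<open>t1\<close>, \<open>t2\<close> of the
  two blocks; the algebra is two-step nilpotent if both are 0.\<close>

lemma case_B3_zero:
  assumes B3: "a e3 = 0" "b e3 = 0" "c e3 = 0" "d e3 = 0"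
  shows "classified pbr \<or> (\<forall>u v w. pbr u (pbr v w) = 0)"
proof -
  have det: "((1 + a e1 * x + b e1 * y) * (1 + c e2 * x + d e2 * y) - (a e2 * x + b e2 * y) * (c e1 * x + d e1 * y)) *
      (1 + p e3 * x + q e3 * y) \<noteq> 0" for x y
    using det_nonzero[of x y 0] unfolding B3 by (simp add: algebra_simps)
  have pq: "p e3 = 0" "q e3 = 0"
  proof -
    \<comment> \<open>The linear factor of the determinant is restricted to the line through
      \<open>(p e3, q e3)\<close>.\<close>
    have "p e3 * p e3 + q e3 * q e3 = 0"
    proof (rule affine_nonvanishing[of 1])
      fix z
      have "1 + p e3 * (z * p e3) + q e3 * (z * q e3) \<noteq> 0"
        using det[of "z * p e3" "z * q e3"] by (metis mult_zero_right)
      then show "1 + z * (p e3 * p e3 + q e3 * q e3) \<noteq> 0" by (simp add: algebra_simps)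
    qed
    then show "p e3 = 0" "q e3 = 0" by (simp_all add: sum_squares_eq_zero_iff)
  qed
  have T: "a e1 + c e2 = 0" "b e1 + d e2 = 0"
  proof -
    have nz: "(1 + a e1 * x + b e1 * y) * (1 + c e2 * x + d e2 * y) - (a e2 * x + b e2 * y) * (c e1 * x + d e1 * y) \<noteq> 0" for x y
      using det[of x y] by simp
    have 1: "(b e1 - a e2) * a e1 + (d e1 - c e2) * a e2 = b e1 * c e2 - b e2 * c e1"
      using hom_coeff(1)[of e1 e2] coeff_expand[of a "pbr e1 e2"] by (simp add: pbr_nth B3)
    have 2: "(b e1 - a e2) * d e1 + (d e1 - c e2) * d e2 = c e1 * b e2 - c e2 * b e1"
      using hom_coeff(4)[of e1 e2] coeff_expand[of d "pbr e1 e2"] by (simp add: pbr_nth B3)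
    show "a e1 + c e2 = 0" "b e1 + d e2 = 0"
      using two_dim_trace_zero[OF nz 1] 2 by simp_all
  qed
  define t1 t2 where t: "t1 = a e1 + d e1" "t2 = a e2 + d e2"
  define \<kappa> where "\<kappa> = q e1 - p e2 + 1"
  have br: "pbr e1 e2 = - t2 *\<^sub>R e1 + t1 *\<^sub>R e2 + \<kappa> *\<^sub>R e3" "pbr e1 e3 = t1 *\<^sub>R e3" "pbr e2 e3 = t2 *\<^sub>R e3"
    using T by (auto intro!: vec3_eqI simp: pbr_nth B3 pq t \<kappa>_def algebra_simps)
  show ?thesis
  proof (cases "t1 = 0 \<and> t2 = 0")
    case True
    then have "pbr u (pbr v w) = 0" for u v w
      using br by (intro two_step[of 0 \<kappa> 0]) simp_all
    then show ?thesis by blast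
  next
    case False
    define n where "n = t1 * t1 + t2 * t2"
    have n: "n \<noteq> 0" using False by (simp add: n_def sum_squares_eq_zero_iff)
    \<comment> \<open>\<open>X\<close> is normalized to act on \<open>e3\<close> as 1.
      \<open>?Y\<close> is the bracket of \<open>e1\<close> and \<open>e2\<close>; with
      \<open>e3\<close> it spans the derived algebra.\<close>
    define X where "X = (t1 / n) *\<^sub>R e1 + (t2 / n) *\<^sub>R e2"
    let ?Y = "- t2 *\<^sub>R e1 + t1 *\<^sub>R e2 + \<kappa> *\<^sub>R e3"
    have u: "t1 / n * t1 + t2 / n * t2 = 1" using n by (simp add: n_def add_divide_distrib[symmetric])
    have XZ: "pbr X e3 = 0 *\<^sub>R ?Y + 1 *\<^sub>R e3"
    proof -
      have "pbr X e3 = (t1 / n * t1 + t2 / n * t2) *\<^sub>R e3"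
        by (simp add: X_def br_simps br scaleR_add_left)
      then show ?thesis unfolding u by simp
    qed
    have XY: "pbr X ?Y = 1 *\<^sub>R ?Y + \<kappa> *\<^sub>R e3"
    proof -
      have "pbr X ?Y = (t1 / n * t1 + t2 / n * t2) *\<^sub>R pbr e1 e2 + \<kappa> *\<^sub>R pbr X e3"
        using br_alt[of e2 e1] by (simp add: X_def br_simps) (simp add: algebra_simps)
      then show ?thesis unfolding u XZ br(1) by simp
    qed
    have YZ: "pbr ?Y e3 = 0" by (simp add: br_simps br)
    have "inj (comb3 X ?Y e3)"
    proof (rule inj_comb3I)
      fix r s t assume "r *\<^sub>R X + s *\<^sub>R ?Y + t *\<^sub>R e3 = 0"
      then have "(r *\<^sub>R X + s *\<^sub>R ?Y + t *\<^sub>R e3) $ i = 0" for i by simp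
      from this[of 1] this[of 2] this[of 3]
      have c: "r * (t1 / n) - s * t2 = 0" "r * (t2 / n) + s * t1 = 0" "s * \<kappa> + t = 0"
        by (simp_all add: X_def)
      have "r * (t1 / n * t1 + t2 / n * t2) = (r * (t1 / n) - s * t2) * t1 + (r * (t2 / n) + s * t1) * t2"
        by (simp add: algebra_simps)
      then have r: "r = 0" unfolding u c by simp
      then have "s = 0" using c False by auto
      then show "r = 0 \<and> s = 0 \<and> t = 0" using r c by simp
    qed
    from classified_double_eigenvalue[OF this YZ XY XZ] show ?thesis by simp
  qed
qed

text \<open>Brackets with \<open>e3\<close> determine the block at \<open>e2\<close> in terms of the
  rest, and the determinant removes \<open>a e1\<close> and \<open>b e1\<close>. Then
  \<open>e2\<close>, \<open>e3\<close> span an abelian ideal on which \<open>e1\<close> acts with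
  the double eigenvalue \<open>d e1\<close>.\<close>

lemma case_B3_nilpotent:
  assumes B3: "a e3 = 0" "b e3 = 0" "d e3 = 0" and c3: "c e3 \<noteq> 0"
  shows "classified pbr \<or> (\<forall>u v w. pbr u (pbr v w) = 0)"
proof -
  have t2: "a e2 + d e2 = 0" using trace_B3(1) c3 by (simp add: B3)
  note expand = coeff_expand[of a] coeff_expand[of b] coeff_expand[of c] coeff_expand[of d]
  have a2: "a e2 = - b e1"
  proof -
    have "c e3 * a e2 = c e3 * (- b e1)"
      using hom_coeff(1)[of e1 e3] expand(1)[of "pbr e1 e3"] by (simp add: pbr_nth B3 algebra_simps)
    then show ?thesis using mult_left_cancel[OF c3] by blast
  qed
  have b2: "b e2 = 0"
    using hom_coeff(2)[of e1 e3] expand(2)[of "pbr e1 e3"] c3 by (simp add: pbr_nth B3)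
  have d2: "d e2 = b e1" using a2 t2 by simp
  have c2: "c e2 = 2 * a e1 - p e3"
  proof -
    have "c e3 * c e2 = c e3 * (2 * a e1 - p e3)"
      using hom_coeff(3)[of e1 e3] expand(3)[of "pbr e1 e3"] by (simp add: pbr_nth B3 algebra_simps)
    then show ?thesis using mult_left_cancel[OF c3] by blast
  qed
  have q3: "q e3 = - 2 * b e1"
  proof -
    have "c e3 * q e3 = c e3 * (- 2 * b e1)"
      using hom_coeff(3)[of e2 e3] expand(3)[of "pbr e2 e3"] a2 d2 by (simp add: pbr_nth B3 algebra_simps)
    then show ?thesis using mult_left_cancel[OF c3] by blast
  qed
  have b1: "b e1 = 0"
  proof (rule affine_nonvanishing[of 1])
    \<comment> \<open>On this axis the first row of the matrix is
      \<open>(1 + z * b e1, 0, 0)\<close>, so its first entry divides the determinant. The same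
      happens for \<open>a e1\<close> on the other axis.\<close>
    show "1 + z * b e1 \<noteq> 0" for z
      using det_nonzero[of 0 z 0] by (auto simp: B3 b2 d2 q3 mult.commute)
  qed
  have a1: "a e1 = 0"
  proof (rule affine_nonvanishing[of 1])
    show "1 + z * a e1 \<noteq> 0" for z
      using det_nonzero[of z 0 0] by (auto simp: B3 b1 a2 b2 mult.commute)
  qed
  define \<nu> where "\<nu> = q e1 - p e2 + 1"
  have \<nu>: "\<nu> * c e3 = c e2 * c e2"
    using hom_coeff(3)[of e1 e2] expand(3)[of "pbr e1 e2"] by (simp add: pbr_nth a1 b1 a2 d2 \<nu>_def algebra_simps)
  have br: "pbr e1 e2 = (d e1 - c e2) *\<^sub>R e2 + \<nu> *\<^sub>R e3" "pbr e1 e3 = (- c e3) *\<^sub>R e2 + (d e1 + c e2) *\<^sub>R e3"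
    "pbr e2 e3 = 0"
    by (auto intro!: vec3_eqI simp: pbr_nth B3 a1 b1 a2 d2 c2 q3 \<nu>_def)
  show ?thesis
  proof (cases "d e1 = 0")
    case True
    have "pbr u (pbr v w) = 0" for u v w
      by (rule two_step[of "- c e2" \<nu> "- c e3"]) (use br True \<nu> in simp_all)
    then show ?thesis by blast
  next
    case False
    have "inj (comb3 e1 e2 e3)"
      by (rule inj_comb3I) (auto simp: vec_eq_iff forall_3)
    then have "classified pbr"
      by (rule classified_double_eigenvalue[OF _ br(3,1,2)])
        (use False \<nu> in \<open>simp_all add: power2_eq_square algebra_simps\<close>)
    then show ?thesis ..
  qed
qed

text \<open>An invertible block \<open>M\<close> at \<open>e3\<close> forces all traces to vanish,
  and \<open>traceless_commutant\<close> makes the blocks at \<open>e1\<close>, \<open>e2\<close>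
  multiples \<open>\<beta> M\<close>, \<open>\<gamma> M\<close>. So \<open>e1 - \<beta> e3\<close>
  and \<open>e2 - \<gamma> e3\<close> have block 0; they span an abelian ideal on which
  \<open>e3\<close> acts by \<open>M\<close>.\<close>

lemma case_B3_invertible:
  assumes D: "a e3 * d e3 - b e3 * c e3 \<noteq> 0"
  shows "classified pbr"
proof -
  define k l m where k: "k = a e3" "l = b e3" "m = c e3"
  have d3: "d e3 = - k" using trace_e3 by (simp add: k)
  have D: "k * k + l * m \<noteq> 0" using D by (simp add: k[symmetric] d3)
  have t: "a e1 + d e1 = 0" "a e2 + d e2 = 0"
  proof -
    have t: "(a e1 + d e1) * k + (a e2 + d e2) * m = 0" "(a e1 + d e1) * l - (a e2 + d e2) * k = 0"
      using trace_B3 by (simp_all add: k[symmetric] d3)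
    have "T1 * (k*k + l*m) = (T1 * k + T2 * m) * k + (T1 * l - T2 * k) * m"
      "T2 * (k*k + l*m) = (T1 * k + T2 * m) * l - (T1 * l - T2 * k) * k" for T1 T2
      by (simp_all add: algebra_simps)
    note e = this(1)[of "a e1 + d e1" "a e2 + d e2"] this(2)[of "a e2 + d e2" "a e1 + d e1"]
    have "(a e1 + d e1) * (k*k + l*m) = 0" unfolding e(1) t by simp
    then show "a e1 + d e1 = 0" using D by simp
    have "(a e2 + d e2) * (k*k + l*m) = 0" unfolding e(2) t by simp
    then show "a e2 + d e2 = 0" using D by simp
  qed
  have d1: "d e1 = - a e1" and d2: "d e2 = - a e2" using t by simp_all
  note expand = coeff_expand[of a] coeff_expand[of b] coeff_expand[of c]
  have eqs: "- k * a e1 - m * a e2 - p e3 * k = b e1 * m - l * c e1"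
    "- k * b e1 - m * b e2 - p e3 * l = 2 * a e1 * l - 2 * k * b e1"
    "- k * c e1 - m * c e2 - p e3 * m = 2 * c e1 * k - 2 * a e1 * m"
    "- l * a e1 + k * a e2 - q e3 * k = b e2 * m - l * c e2"
    "- l * b e1 + k * b e2 - q e3 * l = 2 * a e2 * l - 2 * k * b e2"
    "- l * c e1 + k * c e2 - q e3 * m = 2 * c e2 * k - 2 * a e2 * m"
    using hom_coeff(1-3)[of e1 e3] hom_coeff(1-3)[of e2 e3] expand[of "pbr e1 e3"] expand[of "pbr e2 e3"]
    by (simp_all add: pbr_nth d1 d2 d3 k[symmetric] algebra_simps)
  obtain \<beta> \<gamma> where \<beta>: "a e1 = \<beta> * k" "b e1 = \<beta> * l" "c e1 = \<beta> * m" "a e2 = \<gamma> * k" "b e2 = \<gamma> * l" "c e2 = \<gamma> * m"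
    "p e3 = - (k*\<beta> + m*\<gamma>)" "q e3 = - (l*\<beta> - k*\<gamma>)"
    by (rule traceless_commutant[OF D eqs])
  define \<nu> where "\<nu> = q e1 - p e2 + 1"
  have br: "pbr e1 e2 = (\<beta> * l - \<gamma> * k) *\<^sub>R e1 + (- \<beta> * k - \<gamma> * m) *\<^sub>R e2 + \<nu> *\<^sub>R e3"
    "pbr e1 e3 = (- k) *\<^sub>R e1 + (- m) *\<^sub>R e2 + (k*\<beta> + m*\<gamma>) *\<^sub>R e3"
    "pbr e2 e3 = (- l) *\<^sub>R e1 + k *\<^sub>R e2 + (l*\<beta> - k*\<gamma>) *\<^sub>R e3"
    by (auto intro!: vec3_eqI simp: pbr_nth \<beta> d1 d2 d3 k[symmetric] \<nu>_def)
  \<comment> \<open>The blocks at \<open>e1\<close> and \<open>e2\<close> commute, so the block at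
    their bracket is 0. It is a scalar times \<open>M\<close>, and a nonzero entry of
    \<open>M\<close> shows that the scalar vanishes.\<close>
  have \<nu>: "\<nu> = - ((\<beta> * l - \<gamma> * k) * \<beta> + (- \<beta> * k - \<gamma> * m) * \<gamma>)"
  proof -
    have z: "x * ((\<beta> * l - \<gamma> * k) * \<beta> + (- \<beta> * k - \<gamma> * m) * \<gamma> + \<nu>) = 0" if "x \<in> {k, l, m}" for x
      using hom_coeff(1-3)[of e1 e2] expand[of "pbr e1 e2"] that
      by (auto simp: br(1) \<beta> d1 d2 d3 k[symmetric] algebra_simps)
    have "k \<noteq> 0 \<or> l \<noteq> 0" using D by auto
    then have "(\<beta> * l - \<gamma> * k) * \<beta> + (- \<beta> * k - \<gamma> * m) * \<gamma> + \<nu> = 0" using z[of k] z[of l] by auto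
    then show ?thesis by simp
  qed
  let ?Y = "e1 - \<beta> *\<^sub>R e3" and ?Z = "e2 - \<gamma> *\<^sub>R e3"
  have "pbr ?Y ?Z = pbr e1 e2 - \<gamma> *\<^sub>R pbr e1 e3 + \<beta> *\<^sub>R pbr e2 e3"
    using br_alt[of e3 e2] by (simp add: br_simps)
  also have "\<dots> = 0"
    unfolding br \<nu> by (rule vec3_eqI) (simp_all add: algebra_simps)
  finally have YZ: "pbr ?Y ?Z = 0" .
  have "pbr e3 ?Y = - pbr e1 e3" "pbr e3 ?Z = - pbr e2 e3"
    using br_alt[of e3 e1] br_alt[of e3 e2] by (simp_all add: br_simps)
  then have XY: "pbr e3 ?Y = k *\<^sub>R ?Y + m *\<^sub>R ?Z" and XZ: "pbr e3 ?Z = l *\<^sub>R ?Y + (- k) *\<^sub>R ?Z"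
    unfolding br by (auto intro!: vec3_eqI simp: algebra_simps)
  have "inj (comb3 e3 ?Y ?Z)"
    by (rule inj_comb3I) (auto simp: vec_eq_iff forall_3)
  from classified_trace_zero[OF this YZ XY XZ] show ?thesis using D by simp
qed

end

text \<open>Automorphisms of \<open>\<hh>\<^sub>3\<close> transport the whole structure, which
  permits normalizing the block at \<open>e3\<close>.\<close>

lemma post_lie_conj:
  assumes "post_lie \<delta>" and lin: "linear \<psi>" "linear \<phi>" and inv: "\<And>x. \<phi> (\<psi> x) = x" "\<And>x. \<psi> (\<phi> x) = x"
    and \<psi>: "\<And>x y. \<psi> (lie_bracket h3 x y) = lie_bracket h3 (\<psi> x) (\<psi> y)"
  defines "\<delta>' \<equiv> \<lambda>v u. \<phi> (\<delta> (\<psi> v) (\<psi> u))"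
  shows "post_lie \<delta>'" "post_lie.pbr \<delta>' v w = \<phi> (post_lie.pbr \<delta> (\<psi> v) (\<psi> w))"
proof -
  interpret post_lie \<delta> by fact
  have \<delta>'_app: "\<delta>' v u = \<phi> (\<delta> (\<psi> v) (\<psi> u))" for v u by (simp add: \<delta>'_def)
  have \<phi>: "\<phi> (lie_bracket h3 x y) = lie_bracket h3 (\<phi> x) (\<phi> y)" for x y
    using \<psi>[of "\<phi> x" "\<phi> y"] inv by metis
  note l = linear_add[OF lin(1)] linear_add[OF lin(2)] linear_scale[OF lin(1)] linear_scale[OF lin(2)]
    linear_diff[OF lin(1)] linear_diff[OF lin(2)] linear_0[OF lin(1)] linear_0[OF lin(2)]
  have psi_prod: "\<psi> (\<delta>' v w + (1/2) *\<^sub>R lie_bracket h3 v w) = \<delta> (\<psi> v) (\<psi> w) + (1/2) *\<^sub>R lie_bracket h3 (\<psi> v) (\<psi> w)"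
    for v w by (simp add: \<delta>'_def l inv \<psi>)
  show pl: "post_lie \<delta>'"
  proof (rule post_lie.intro)
    show "linear (\<lambda>v. \<delta>' v u)" for u
      using linear_compose[OF linear_compose[OF lin(1) lin1] lin(2)] by (simp add: \<delta>'_def comp_def)
    show "linear (\<delta>' v)" for v
      using linear_compose[OF linear_compose[OF lin(1) lin2] lin(2)] by (simp add: \<delta>'_def comp_def)
    show "\<delta>' v (lie_bracket h3 u w) = lie_bracket h3 (\<delta>' v u) w + lie_bracket h3 u (\<delta>' v w)" for v u w
      by (simp add: \<delta>'_def \<psi> derivation l \<phi> inv)
    show "\<delta>' ((\<delta>' v w + (1/2) *\<^sub>R lie_bracket h3 v w) - (\<delta>' w v + (1/2) *\<^sub>R lie_bracket h3 w v)) u =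
        \<delta>' v (\<delta>' w u) - \<delta>' w (\<delta>' v u)" for v w u
      unfolding \<delta>'_app[of "_ - _"] linear_diff[OF lin(1)] psi_prod hom
      by (simp add: \<delta>'_def inv l)
    show "v = 0" if "v + (\<delta>' v w + (1/2) *\<^sub>R lie_bracket h3 v w) = 0" for v w
    proof -
      have "\<psi> v + \<psi> (\<delta>' v w + (1/2) *\<^sub>R lie_bracket h3 v w) = 0"
        using that by (metis linear_add[OF lin(1)] linear_0[OF lin(1)])
      then have "\<psi> v = 0" unfolding psi_prod by (rule right_inj)
      then show ?thesis using inv(1)[of v] linear_0[OF lin(2)] by simp
    qed
  qed
  show "post_lie.pbr \<delta>' v w = \<phi> (pbr (\<psi> v) (\<psi> w))"
    unfolding post_lie.pbr_def[OF pl] pbr_def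
    by (simp add: \<delta>'_def l \<phi> inv)
qed

context post_lie
begin

text \<open>An automorphism of \<open>\<hh>\<^sub>3\<close> brings a nonzero nilpotent block to strictly lower triangular form.\<close>

lemma case_B3_singular:
  assumes B3: "a e3 * d e3 - b e3 * c e3 = 0" and nz: "b e3 \<noteq> 0 \<or> c e3 \<noteq> 0"
  shows "classified pbr \<or> (\<forall>u v w. pbr u (pbr v w) = 0)"
proof -
  have d3: "d e3 = - a e3" using trace_e3 by simp
  \<comment> \<open>\<open>f\<close> is chosen such that \<open>f\<close> and
    \<open>\<delta> e3 f\<close> are independent modulo the center.\<close>
  obtain f where f: "f $ 1 * \<delta> e3 f $ 2 - f $ 2 * \<delta> e3 f $ 1 \<noteq> 0"
  proof (cases "c e3 = 0")
    case True
    then show ?thesis using nz that[of e2] by (simp add: \<delta>_nth)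
  next
    case False
    then show ?thesis using that[of e1] by (simp add: \<delta>_nth)
  qed
  define g \<kappa> where "g = \<delta> e3 f" and "\<kappa> = f $ 1 * g $ 2 - f $ 2 * g $ 1"
  have \<kappa>: "\<kappa> \<noteq> 0" using f by (simp add: \<kappa>_def g_def)
  \<comment> \<open>Since the bracket of \<open>f\<close> and \<open>g\<close> is
    \<open>\<kappa> *\<^sub>R e3\<close>, this basis has the relations of \<open>e1\<close>,
    \<open>e2\<close>, \<open>e3\<close>.\<close>
  let ?\<psi> = "comb3 f g (\<kappa> *\<^sub>R e3)"
  have "inj ?\<psi>"
  proof (rule inj_comb3I)
    fix r s t assume "r *\<^sub>R f + s *\<^sub>R g + t *\<^sub>R \<kappa> *\<^sub>R e3 = 0"
    then have "(r *\<^sub>R f + s *\<^sub>R g + t *\<^sub>R \<kappa> *\<^sub>R e3) $ i = 0" for i by simp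
    from this[of 1] this[of 2] this[of 3]
    have e: "r * f$1 + s * g$1 = 0" "r * f$2 + s * g$2 = 0" "r * f$3 + s * g$3 + t * \<kappa> = 0" by simp_all
    have "r * \<kappa> = (r * f$1 + s * g$1) * g$2 - (r * f$2 + s * g$2) * g$1"
      "s * \<kappa> = (r * f$2 + s * g$2) * f$1 - (r * f$1 + s * g$1) * f$2"
      by (simp_all add: \<kappa>_def algebra_simps)
    then have "r = 0" "s = 0" unfolding e using \<kappa> by simp_all
    then show "r = 0 \<and> s = 0 \<and> t = 0" using e \<kappa> by simp
  qed
  then obtain \<phi> where \<phi>: "linear \<phi>" "\<And>x. \<phi> (?\<psi> x) = x" "\<And>x. ?\<psi> (\<phi> x) = x"
    using linear_injective_isomorphism[OF linear_comb3] by metis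
  have \<psi>: "?\<psi> (lie_bracket h3 x y) = lie_bracket h3 (?\<psi> x) (?\<psi> y)" for x y
    by (rule vec3_eqI) (simp_all add: comb3_def \<kappa>_def algebra_simps)
  let ?\<delta>' = "\<lambda>v u. \<phi> (\<delta> (?\<psi> v) (?\<psi> u))"
  note conj = post_lie_conj[OF post_lie_axioms linear_comb3 \<phi> \<psi>]
  interpret conj: post_lie ?\<delta>' by (rule conj(1))
  have \<psi>e: "?\<psi> e1 = f" "?\<psi> e2 = g" "?\<psi> e3 = \<kappa> *\<^sub>R e3" by (simp_all add: comb3_def)
  have 1: "?\<delta>' e3 e1 = \<kappa> *\<^sub>R e2"
    using \<phi>(2)[of e2] by (simp add: \<psi>e linear_scale[OF lin1] linear_scale[OF \<phi>(1)] g_def[symmetric])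
  \<comment> \<open>The block at \<open>e3\<close> squares to zero, so \<open>\<delta> e3\<close>
    maps \<open>g = \<delta> e3 f\<close> into the center.\<close>
  have "\<delta> e3 g = (\<delta> e3 g $ 3 / \<kappa>) *\<^sub>R ?\<psi> e3"
  proof (rule vec3_eqI)
    have bc: "b e3 * c e3 = - (a e3 * a e3)" using B3 by (simp add: d3)
    have "\<delta> e3 g $ 1 = f$1 * (a e3 * a e3 + b e3 * c e3)" "\<delta> e3 g $ 2 = f$2 * (a e3 * a e3 + b e3 * c e3)"
      by (simp_all add: g_def \<delta>_nth d3 algebra_simps)
    then show "\<delta> e3 g $ 1 = ((\<delta> e3 g $ 3 / \<kappa>) *\<^sub>R ?\<psi> e3) $ 1" "\<delta> e3 g $ 2 = ((\<delta> e3 g $ 3 / \<kappa>) *\<^sub>R ?\<psi> e3) $ 2"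
      by (simp_all add: bc \<psi>e)
    show "\<delta> e3 g $ 3 = ((\<delta> e3 g $ 3 / \<kappa>) *\<^sub>R ?\<psi> e3) $ 3" using \<kappa> by (simp add: \<psi>e)
  qed
  then have "\<phi> (\<delta> e3 g) = (\<delta> e3 g $ 3 / \<kappa>) *\<^sub>R e3"
    using \<phi>(2)[of e3] linear_scale[OF \<phi>(1)] by metis
  then have 2: "?\<delta>' e3 e2 = \<kappa> *\<^sub>R (\<delta> e3 g $ 3 / \<kappa>) *\<^sub>R e3"
    by (simp add: \<psi>e linear_scale[OF lin1] linear_scale[OF \<phi>(1)])
  have pbr: "pbr v w = ?\<psi> (conj.pbr (\<phi> v) (\<phi> w))" for v w
    unfolding conj(2) by (simp add: \<phi>)
  have "classified conj.pbr \<or> (\<forall>u v w. conj.pbr u (conj.pbr v w) = 0)"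
    by (rule conj.case_B3_nilpotent)
      (simp_all only: conj.a_def conj.b_def conj.c_def conj.d_def 1 2, simp_all add: \<kappa>)
  then show ?thesis
  proof
    assume "classified conj.pbr"
    then obtain X Y Z where XYZ: "inj (comb3 X Y Z)" "conj.pbr Y Z = 0"
      "conj.pbr X Y = Y \<and> conj.pbr X Z = Y + Z \<or>
      (\<exists>l\<in>{1, -1}. conj.pbr X Y = Y \<and> conj.pbr X Z = l *\<^sub>R Z) \<or>
      conj.pbr X Y = - Z \<and> conj.pbr X Z = Y"
      unfolding classified_def by blast
    have l: "linear ?\<psi>" by (rule linear_comb3)
    have "comb3 (?\<psi> X) (?\<psi> Y) (?\<psi> Z) = ?\<psi> \<circ> comb3 X Y Z"
      by (simp add: fun_eq_iff comb3_def[of "?\<psi> X"] comb3_def[of X] linear_add[OF l] linear_scale[OF l])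
    then have "inj (comb3 (?\<psi> X) (?\<psi> Y) (?\<psi> Z))"
      using inj_compose[OF \<open>inj ?\<psi>\<close> XYZ(1)] by simp
    moreover have "pbr (?\<psi> v) (?\<psi> w) = ?\<psi> (conj.pbr v w)" for v w by (simp only: pbr \<phi>(2))
    ultimately have "classified pbr"
      unfolding classified_def using XYZ(2,3)
      by (intro exI[of _ "?\<psi> X"] exI[of _ "?\<psi> Y"] exI[of _ "?\<psi> Z"])
        (auto simp: linear_add[OF l] linear_scale[OF l] linear_0[OF l] linear_neg[OF l])
    then show ?thesis ..
  next
    assume "\<forall>u v w. conj.pbr u (conj.pbr v w) = 0"
    then have "pbr u (pbr v w) = 0" for u v w
      unfolding pbr \<phi>(2) using linear_0[OF linear_comb3] by metis
    then show ?thesis by blast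
  qed
qed

theorem classification: "classified pbr \<or> (\<forall>u v w. pbr u (pbr v w) = 0)"
proof (cases "a e3 * d e3 - b e3 * c e3 = 0")
  case False
  then show ?thesis using case_B3_invertible by blast
next
  case True
  show ?thesis
  proof (cases "b e3 = 0 \<and> c e3 = 0")
    case bc: True
    have "d e3 = - a e3" using trace_e3 by simp
    then have "a e3 = 0" "d e3 = 0" using True bc by simp_all
    then show ?thesis using case_B3_zero bc by blast
  next
    case False
    then show ?thesis using case_B3_singular[OF True] by blast
  qed
qed

end

section \<open>From the bracket on \<real>^3 to the isomorphism type of the Lie algebra of
  \<open>G\<close>\<close>

lemma (in simply_transitive_affine) post_lie_\<delta>: "post_lie \<delta>"
proof (rule post_lie.intro)
  show "\<delta> ((\<delta> v w + (1/2) *\<^sub>R hb v w) - (\<delta> w v + (1/2) *\<^sub>R hb w v)) u = \<delta> v (\<delta> w u) - \<delta> w (\<delta> v u)" for v w u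
    using \<delta>_br by (simp add: br_def L_def)
  show "v = 0" if "v + (\<delta> v w + (1/2) *\<^sub>R hb v w) = 0" for v w
    using that by (intro right_mult_injective[of v w]) (simp add: L_def)
qed (rule linear_\<delta>1 linear_\<delta>2 \<delta>_derivation)+

lemma (in affine_action) lie_algebra_iso_lie3:
  assumes inj: "inj (comb3 P Q R)" and QR: "br Q R = 0"
    and PQ: "br P Q = comb3 P Q R u" and PR: "br P R = comb3 P Q R v"
  shows "lie_algebra_isomorphic (lie_algebra_of G) (lie3 u v 0)"
proof -
  interpret post_lie \<delta> by (rule post_lie_\<delta>)
  let ?K = "comb3 P Q R"
  have br: "br = pbr" by (simp add: fun_eq_iff br_def pbr_def L_def)
  have l: "linear ?K" by (rule linear_comb3)
  obtain F where F: "linear F" "\<And>x. F (?K x) = x" "\<And>x. ?K (F x) = x"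
    using linear_injective_isomorphism[OF l inj] by metis
  have K: "br (?K x) (?K y) = ?K (bracket3 u v 0 x y)" for x y
  proof -
    have "br (?K x) (?K y) = (x$1 * y$2 - x$2 * y$1) *\<^sub>R br P Q + (x$1 * y$3 - x$3 * y$1) *\<^sub>R br P R +
      (x$2 * y$3 - x$3 * y$2) *\<^sub>R br Q R"
      unfolding br comb3_def using br_alt[of Q P] br_alt[of R P] br_alt[of R Q]
      by (simp add: br_simps) (simp add: algebra_simps)
    also have "\<dots> = ?K (bracket3 u v 0 x y)"
      by (simp add: QR PQ PR bracket3_def linear_add[OF l] linear_scale[OF l])
    finally show ?thesis .
  qed
  show ?thesis
  proof (rule lie_algebra_iso)
    show "bij_betw F UNIV (lie_carrier (lie3 u v 0))"
      using F(2,3) by (intro bij_betwI[of _ _ _ ?K]) (simp_all add: lie3_def)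
    show "F (br x y) = lie_bracket (lie3 u v 0) (F x) (F y)" for x y
      using K[of "F x" "F y"] F(2,3) by (simp add: lie3_def)
  qed (simp_all add: lie3_def linear_add[OF F(1)] linear_scale[OF F(1)])
qed

theorem proposition5p5:
  fixes G :: "('g, 'e::euclidean_space) lie_group"
    and \<rho> :: "'g \<Rightarrow> (real^3) \<times> (real^3 \<Rightarrow> real^3)"
  assumes "is_lie_group G"
    and "solvable G"
    and "\<not> nilpotent_group G"
    and "\<rho> \<in> lie_group_hom G Aff_H3"
    and "\<forall>x\<in>carrier H3. \<forall>y\<in>carrier H3. \<exists>!g. g \<in> carrier G \<and> aff_act H3 (\<rho> g) x = y"
  shows "lie_algebra_isomorphic (lie_algebra_of G) r3 \<or>
    (\<exists>l\<in>{1, -1}. lie_algebra_isomorphic (lie_algebra_of G) (r3_par l)) \<or>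
    lie_algebra_isomorphic (lie_algebra_of G) (r3'_par 0)"
proof -
  interpret affine_action G \<rho> using assms by (intro affine_action.intro)
  interpret post_lie \<delta> by (rule post_lie_\<delta>)
  have br: "br = pbr" by (simp add: fun_eq_iff br_def pbr_def L_def)
  have "classified br"
    using classification nilpotent assms(3) unfolding br by blast
  then obtain P Q R where PQR: "inj (comb3 P Q R)" "br Q R = 0"
    "br P Q = Q \<and> br P R = Q + R \<or> (\<exists>l\<in>{1, -1}. br P Q = Q \<and> br P R = l *\<^sub>R R) \<or>
      br P Q = - R \<and> br P R = Q"
    unfolding classified_def by blast
  note iso = lie_algebra_iso_lie3[OF PQR(1,2)]
  from PQR(3) consider "br P Q = Q" "br P R = Q + R" | l where "l \<in> {1, -1}" "br P Q = Q" "br P R = l *\<^sub>R R" |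
    "br P Q = - R" "br P R = Q" by blast
  then show ?thesis
  proof cases
    case 1
    then have "lie_algebra_isomorphic (lie_algebra_of G) r3"
      unfolding r3_def by (intro iso) (simp_all add: comb3_def)
    then show ?thesis ..
  next
    case 2
    then have "lie_algebra_isomorphic (lie_algebra_of G) (r3_par l)"
      unfolding r3_par_def by (intro iso) (simp_all add: comb3_def)
    then show ?thesis using 2 by blast
  next
    case 3
    then have "lie_algebra_isomorphic (lie_algebra_of G) (r3'_par 0)"
      unfolding r3'_par_def by (intro iso) (simp_all add: comb3_def)
    then show ?thesis by blast
  qed
qed

end
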